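(* Let $N=300$, $0\le n\leq 300$, $u=2^{-53}$, $\nu=3\,352\,801$, $\gamma_m=mu/(1-mu)$ for $mu<1$, and $\bar\gamma=\gamma_{\nu N}$. Assume that the random bits used by the floating-point sampler are independent and uniform. Then the output of the floating-point sampler is within total variation distance $$n\Bigl(\frac{\bar\gamma}{1-\bar\gamma}+7\nu u\Bigr)<3.5\cdot10^{-5}$$ of the uniform distribution on $\mathrm{Av}_n(12453)$.
   Context: $\mathrm{Av}_n(12453)$ is the set of permutations of $[n]=\{1,\ldots,n\}$ with no subsequence in the same relative order as $12453$. $\mathbf 1_P$ is $1$ if $P$ holds and $0$ otherwise. **Exact tables.** For integers $\ell\ge1$, $a,q,s\ge0$, the numbers $R_{\ell,a}(q,s)$ are defined (by recursion on $\ell+a+q$) by $$R_{\ell,a}(q,s)=\sum_{h=0}^{a-1}R_{\ell,h}(a+q-h-1,s)+\sum_{r=0}^{q-1}R_{\ell+q-r-1,a}(r,s)+D_{\ell,a}(q,s)+\sum_{\substack{\ell_1,\ell_2\ge1\\ \ell_1+\ell_2=\ell-1}}\ \sum_{\substack{a_1,a_2\ge0\\ a_1+a_2=a}}\ \sum_{m\ge0}R_{\ell_1,a_1}(q,m)R_{\ell_2,a_2}(m,s),$$ with $D_{1,a}(q,s)=\mathbf 1_{a=0,\,q=s}$ and $D_{\ell,a}(q,s)=2R_{\ell-1,a}(q,s)$ for $\ell\ge2$. Their support is: $0\le s\le q$ if $a=0$, and $0\le s\le a+q-1$ if $a>0$; all other entries are zero. Further $G_{(0,0)}=1$ and for $(p,q)\ne(0,0)$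 $$G_{(p,q)}=\sum_{h=0}^{p-1}G_{(h,p+q-1-h)}+\mathbf 1_{q\ge1}G_{(p,q-1)}+\sum_{h=0}^{q-2}\sum_{c=0}^{p}\sum_{t\ge0}R_{q-1-h,p-c}(h,t)G_{(c,t)}.$$ All sums are taken only over indices for which the $R$ entries lie in the support. One has $G_{(n,0)}=|\mathrm{Av}_n(12453)|$. **Scaled tables.** Put $R'_{\ell,a}(q,s)=2^{-2(\ell+a+q)}R_{\ell,a}(q,s)$ for $\ell+a+q\le N$ and $G'_{(p,q)}=2^{-2(p+q)}G_{(p,q)}$ for $p+q\le N$. They satisfy the same recurrences with the following changes: in the recurrence for $R'$ the terms of the first two sums and $D_{\ell,a}$ with $\ell\ge2$ are multiplied by $1/4$, the split term becomes $4^{m-1}R'_{\ell_1,a_1}(q,m)R'_{\ell_2,a_2}(m,s)$, and $D_{1,a}(q,s)$ becomes $2^{-2(1+a+q)}\mathbf 1_{a=0,\,q=s}$; in the recurrence for $G'$ the terms of the first sum and the second term are multiplied by $1/4$ and the terms of the last sum become $4^{t-1}R'_{q-1-h,p-c}(h,t)G'_{(c,t)}$. **Floating-point computation of the tables.** All arithmetic is IEEE binary64 with rounding to nearest, without reassociation or reordering; a multiplication may be fused with the addition that follows it. A term $4^{m-1}r_1r_2$ with scaled stored factors $r_1,r_2$ is formed as $(2^{m-1}r_1)(2^{m-1}r_2)$, or as $(4^{m-1}r_1)r_2$ when $4^{m-1}r_1\le10^{300}$. The reduced entries $R'$ are computed in increasing $\ell+a+q$ and then the values $G'_{(p,q)}$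 in increasing $p+q$, each from previously stored values. Each value is formed by adding its summands in the scaled recurrence to a running sum, one at a time, in a fixed order, starting from zero; in the last sum for $G'$ the terms with fixed $h$ and $c$ are first added into an inner sum over $t$. In the build for $N=300$ all nonzero stored scaled values lie between $2^{-600}$ and $2^{515}$ and none is infinite or subnormal. **The sampler.** The sampler produces a permutation of $[n]$ letter by letter. Its state consists of two sorted sets of unread values, band $0$ (size $p$) and band $1$ (size $q$), and a stack of blocks (sets of unread values, the first being the head), each block carrying a target control $(c,t)$ at which it must be exposed. Initially band $0$ is $[n]$, band $1$ and the stack are empty; it stops when all values are read. In each letter choice the candidates, their values and their effects are as follows. (i) Empty stack, $(p,q)\ne(0,0)$; the stored value of the state is the stored $G'_{(p,q)}$. Candidates: - for each $0\le h<p$, value $\tfrac14G'_{(h,p+q-1-h)}$: read the value of band $0$ with $h$ band-$0$ values below it; the band-$0$ values above it join band $1$; - if $q\ge1$, value $\tfrac14G'_{(p,q-1)}$: read the greatest value of band $1$; - for $0\le h\le q-2$, $0\le c\le p$, $t\ge0$, value $4^{t-1}R'_{q-1-h,p-c}(h,t)G'_{(c,t)}$: read the value of band $1$ with $h$ band-$1$ values below it; the $q-1-h$ band-$1$ values above it leave band $1$ and form a block with target $(c,t)$. (ii) Head of size $\ell$ with target $(c,t)$, $a=p-c$; the stored value of the state is the stored $R'_{\ell,a}(q,t)$. Candidates: - for $0\le h<a$, value $\tfrac14R'_{\ell,h}(a+q-h-1,t)$: read the value of band $0$ with $c+h$ band-$0$ values below it; the band-$0$ values above it join band $1$; - for $0\le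 r<q$, value $\tfrac14R'_{\ell+q-r-1,a}(r,t)$: read the value of band $1$ with $r$ band-$1$ values below it; the band-$1$ values above it join the head; - if $\ell=1$, value $2^{-2(1+a+q)}\mathbf 1_{a=0,\,q=t}$: read the only value of the head and remove the head; - if $\ell\ge2$, two candidates, each of value $\tfrac14R'_{\ell-1,a}(q,t)$: read the least, respectively the greatest, value of the head (the remaining head keeps its target); - for $\ell_1,\ell_2\ge1$ with $\ell_1+\ell_2=\ell-1$, $a_1,a_2\ge0$ with $a_1+a_2=a$, and $m\ge0$, value $4^{m-1}R'_{\ell_1,a_1}(q,m)R'_{\ell_2,a_2}(m,t)$: read the head value with $\ell_1$ head values below it; the head is replaced by the block of its values below it, with target $(c+a_2,m)$ (new head), followed by the block of its values above it, with target $(c,t)$. The sampler uses the stored floating-point tables, and forms a product $4^{k-1}r_1r_2$ of two stored factors $r_1,r_2$ (with $k=t$ in the third kind of (i) and $k=m$ in the last kind of (ii)) as $(2^{k-1}r_1)(2^{k-1}r_2)$, or as $(4^{k-1}r_1)r_2$ when $4^{k-1}r_1\le10^{300}$, in IEEE binary64 arithmetic with rounding to nearest. Candidates are scanned in a fixed order, in groups: each candidate of the first two kinds in (i), and each candidate of the first four kinds in (ii), is a group of its own; in (i) the candidates of the third kind with fixed $h$ and $c$ form a group; in (ii) the candidates of the last kind with fixed $\ell_1$ and $a_1$ form a group. The sampler computes the sum of each group by adding its members in order, and the running sums $A_1\le A_2\le\cdots$ of the group sums by adding these in order (with $A_0=0$). From $53$ fresh random bits it takes $x$, a multiple of $2^{-53}$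 in $[0,1)$, and rounds $x\hat T$ to $y$, where $\hat T$ is the stored value of the state. It takes the first group $g$ with $A_g>y$ and, inside that group, the first member whose running sum within the group exceeds the rounded difference $y-A_{g-1}$, or the last member if there is none. Candidates of value zero are skipped. If no group has $A_g>y$, it scans again with $y$ multiplied by $\hat A/\hat T$, where $\hat A$ is the total of the scan, and if that also falls short it takes the last candidate of positive value. *)

theory Defs
  imports "HOL-Probability.Probability" "HOL-Library.Sublist" "HOL-Combinatorics.Multiset_Permutations"
begin

section \<open>Pattern avoidance and total variation distance\<close>

definition contains_pattern :: "nat list \<Rightarrow> nat list \<Rightarrow> bool" where
  "contains_pattern p w \<longleftrightarrow> (\<exists>us. subseq us w \<and> length us = length p \<and>
     (\<forall>i<length p. \<forall>j<length p. us ! i < us ! j \<longleftrightarrow> p ! i < p ! j))"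

definition Av :: "nat \<Rightarrow> nat list \<Rightarrow> nat list set" where
  "Av n p = {w \<in> permutations_of_set {1..n}. \<not> contains_pattern p w}"

definition tv_dist :: "'a pmf \<Rightarrow> 'a pmf \<Rightarrow> real" where
  "tv_dist P Q = (SUP A. \<bar>measure_pmf.prob P A - measure_pmf.prob Q A\<bar>)"


section \<open>IEEE binary64 arithmetic\<close>

text \<open>The sign of a zero is not represented; it does not influence any comparison or any
  sum, difference or product, and a quotient by zero does not occur for nonzero stored values.\<close>

datatype binary64 = NaN | Num ereal

abbreviation num :: "real \<Rightarrow> binary64" where "num x \<equiv> Num (ereal x)"

definition nearest_even :: "real \<Rightarrow> int" where
  "nearest_even x =
     (if x - \<lfloor>x\<rfloor> < 1/2 \<or> (x - \<lfloor>x\<rfloor> = 1/2 \<and> even \<lfloor>x\<rfloor>) then \<lfloor>x\<rfloor> else \<lfloor>x\<rfloor> + 1)"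

text \<open>Exponent of the unit in the last place: 53 significant bits, and the fixed exponent
  \<open>-1074\<close> in the subnormal range.\<close>

definition ulp_exponent :: "real \<Rightarrow> int" where
  "ulp_exponent x = max (\<lfloor>log 2 \<bar>x\<bar>\<rfloor> - 52) (-1074)"

definition round64 :: "ereal \<Rightarrow> ereal" where
  "round64 x = (if \<bar>x\<bar> = \<infinity> then x else
     let r = real_of_ereal x; e = ulp_exponent r; z = of_int (nearest_even (r / 2 powi e)) * 2 powi e
     in if \<bar>z\<bar> < 2 ^ 1024 then ereal z else if z > 0 then \<infinity> else - \<infinity>)"

definition invalid_add :: "ereal \<Rightarrow> ereal \<Rightarrow> bool" where
  "invalid_add a b \<longleftrightarrow> \<bar>a\<bar> = \<infinity> \<and> b = - a"

definition invalid_mult :: "ereal \<Rightarrow> ereal \<Rightarrow> bool" where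
  "invalid_mult a b \<longleftrightarrow> (a = 0 \<and> \<bar>b\<bar> = \<infinity>) \<or> (\<bar>a\<bar> = \<infinity> \<and> b = 0)"

fun fadd :: "binary64 \<Rightarrow> binary64 \<Rightarrow> binary64" (infixl "\<oplus>" 65) where
  "Num a \<oplus> Num b = (if invalid_add a b then NaN else Num (round64 (a + b)))"
| "_ \<oplus> _ = NaN"

fun fsub :: "binary64 \<Rightarrow> binary64 \<Rightarrow> binary64" (infixl "\<ominus>" 65) where
  "Num a \<ominus> Num b = Num a \<oplus> Num (- b)"
| "_ \<ominus> _ = NaN"

fun fmul :: "binary64 \<Rightarrow> binary64 \<Rightarrow> binary64" (infixl "\<otimes>" 70) where
  "Num a \<otimes> Num b = (if invalid_mult a b then NaN else Num (round64 (a * b)))"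
| "_ \<otimes> _ = NaN"

fun fdiv :: "binary64 \<Rightarrow> binary64 \<Rightarrow> binary64" (infixl "\<oslash>" 70) where
  "Num a \<oslash> Num b =
     (if (a = 0 \<and> b = 0) \<or> (\<bar>a\<bar> = \<infinity> \<and> \<bar>b\<bar> = \<infinity>) then NaN else Num (round64 (a / b)))"
| "_ \<oslash> _ = NaN"

fun fma :: "binary64 \<Rightarrow> binary64 \<Rightarrow> binary64 \<Rightarrow> binary64" where
  "fma (Num a) (Num b) (Num c) =
     (if invalid_mult a b \<or> invalid_add (a * b) c then NaN else Num (round64 (a * b + c)))"
| "fma _ _ _ = NaN"

fun fless :: "binary64 \<Rightarrow> binary64 \<Rightarrow> bool" where
  "fless (Num a) (Num b) \<longleftrightarrow> a < b"
| "fless _ _ \<longleftrightarrow> False"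

fun fle :: "binary64 \<Rightarrow> binary64 \<Rightarrow> bool" where
  "fle (Num a) (Num b) \<longleftrightarrow> a \<le> b"
| "fle _ _ \<longleftrightarrow> False"


section \<open>Floating-point sums\<close>

text \<open>\<open>Scaled d r\<close> stands for \<open>d r\<close> (with \<open>d\<close> a power of two), \<open>Product k r1 r2\<close> for
  \<open>4\<^sup>k\<^sup>-\<^sup>1 r1 r2\<close>. A summand is evaluated as a product of two factors; \<open>factorings\<close> lists
  the admissible pairs.\<close>

datatype summand = Scaled real binary64 | Product nat binary64 binary64

fun factorings :: "summand \<Rightarrow> (binary64 \<times> binary64) set" where
  "factorings (Scaled d r) = {(num d, r)}"
| "factorings (Product k r1 r2) =
     {(num (2 powi (int k - 1)) \<otimes> r1, num (2 powi (int k - 1)) \<otimes> r2)} \<union>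
     {(f, r2) | f. f = num (4 powi (int k - 1)) \<otimes> r1 \<and> fle f (num (10 ^ 300))}"

definition add_product :: "bool \<Rightarrow> binary64 \<times> binary64 \<Rightarrow> binary64 \<Rightarrow> binary64" where
  "add_product fused fg acc =
     (if fused then fma (fst fg) (snd fg) acc else acc \<oplus> (fst fg \<otimes> snd fg))"

fun accumulates :: "binary64 \<Rightarrow> summand list \<Rightarrow> binary64 \<Rightarrow> bool" where
  "accumulates acc [] v \<longleftrightarrow> v = acc"
| "accumulates acc (x # xs) v \<longleftrightarrow>
     (\<exists>fg \<in> factorings x. \<exists>fused. accumulates (add_product fused fg acc) xs v)"

text \<open>\<open>v\<close> is the floating-point sum of the multiset of summands for some order of summation, some
  way of forming each product and some choice of the fused operations.\<close>

definition computed_sum :: "summand multiset \<Rightarrow> binary64 \<Rightarrow> bool" where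
  "computed_sum M v \<longleftrightarrow> (\<exists>xs. mset xs = M \<and> accumulates (num 0) xs v)"


section \<open>The stored tables\<close>

text \<open>\<open>R l a q s\<close> and \<open>G p q\<close> are the stored values of the scaled entries
  \<open>2\<^sup>-\<^sup>2\<^sup>(\<^sup>l\<^sup>+\<^sup>a\<^sup>+\<^sup>q\<^sup>) R\<^sub>l\<^sub>,\<^sub>a(q,s)\<close> and \<open>2\<^sup>-\<^sup>2\<^sup>(\<^sup>p\<^sup>+\<^sup>q\<^sup>) G\<^sub>(\<^sub>p\<^sub>,\<^sub>q\<^sub>)\<close>.\<close>

type_synonym rtable = "nat \<Rightarrow> nat \<Rightarrow> nat \<Rightarrow> nat \<Rightarrow> binary64"
type_synonym gtable = "nat \<Rightarrow> nat \<Rightarrow> binary64"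

definition in_support :: "nat \<Rightarrow> nat \<Rightarrow> nat \<Rightarrow> nat \<Rightarrow> bool" where
  "in_support l a q s \<longleftrightarrow> 1 \<le> l \<and> (if a = 0 then s \<le> q else s \<le> a + q - 1)"

text \<open>In the third summand, \<open>1/2\<close> is the scaling \<open>1/4\<close> times the factor 2 of
  \<open>D\<^sub>l\<^sub>,\<^sub>a(q,s) = 2 R\<^sub>l\<^sub>-\<^sub>1\<^sub>,\<^sub>a(q,s)\<close>.\<close>

definition R_summands :: "rtable \<Rightarrow> nat \<Rightarrow> nat \<Rightarrow> nat \<Rightarrow> nat \<Rightarrow> summand multiset" where
  "R_summands R l a q s =
     {#Scaled (1/4) (R l h (a + q - h - 1) s).
         h \<in># mset_set {h. h < a \<and> in_support l h (a + q - h - 1) s}#}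
   + {#Scaled (1/4) (R (l + q - r - 1) a r s).
         r \<in># mset_set {r. r < q \<and> in_support (l + q - r - 1) a r s}#}
   + {#if l = 1 then Scaled 1 (num (if a = 0 \<and> q = s then 2 powi (- 2 * int (1 + a + q)) else 0))
       else Scaled (1/2) (R (l - 1) a q s)#}
   + {#Product m (R l1 a1 q m) (R l2 a2 m s).
         (l1, l2, a1, a2, m) \<in># mset_set {(l1, l2, a1, a2, m).
            1 \<le> l1 \<and> 1 \<le> l2 \<and> l1 + l2 + 1 = l \<and> a1 + a2 = a \<and>
            in_support l1 a1 q m \<and> in_support l2 a2 m s}#}"

definition G_inner_summands ::
    "rtable \<Rightarrow> gtable \<Rightarrow> nat \<Rightarrow> nat \<Rightarrow> nat \<Rightarrow> nat \<Rightarrow> summand multiset" where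
  "G_inner_summands R G p q h c =
     {#Product t (R (q - 1 - h) (p - c) h t) (G c t).
         t \<in># mset_set {t. in_support (q - 1 - h) (p - c) h t}#}"

text \<open>\<open>W h c\<close> is the computed inner sum over \<open>t\<close>.\<close>

definition G_summands :: "gtable \<Rightarrow> (nat \<Rightarrow> nat \<Rightarrow> binary64) \<Rightarrow> nat \<Rightarrow> nat \<Rightarrow> summand multiset" where
  "G_summands G W p q =
     {#Scaled (1/4) (G h (p + q - 1 - h)). h \<in># mset_set {h. h < p}#}
   + (if q \<ge> 1 then {#Scaled (1/4) (G p (q - 1))#} else {#})
   + {#Scaled 1 (W h c). (h, c) \<in># mset_set {(h, c). h + 2 \<le> q \<and> c \<le> p}#}"

definition stored_tables :: "nat \<Rightarrow> rtable \<Rightarrow> gtable \<Rightarrow> bool" where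
  "stored_tables N R G \<longleftrightarrow>
     (\<forall>l a q s. 1 \<le> l \<and> l + a + q \<le> N \<longrightarrow>
        (if in_support l a q s then computed_sum (R_summands R l a q s) (R l a q s)
         else R l a q s = num 0)) \<and>
     G 0 0 = num 1 \<and>
     (\<forall>p q. 0 < p + q \<and> p + q \<le> N \<longrightarrow>
        (\<exists>W. (\<forall>h c. h + 2 \<le> q \<and> c \<le> p \<longrightarrow> computed_sum (G_inner_summands R G p q h c) (W h c)) \<and>
             computed_sum (G_summands G W p q) (G p q)))"

text \<open>The bounds exclude NaN, infinite and subnormal values.\<close>

definition in_safe_range :: "binary64 \<Rightarrow> bool" where
  "in_safe_range v \<longleftrightarrow> v \<noteq> num 0 \<longrightarrow> fle (num (2 powi (- 600))) v \<and> fle v (num (2 ^ 515))"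

definition tables_in_safe_range :: "nat \<Rightarrow> rtable \<Rightarrow> gtable \<Rightarrow> bool" where
  "tables_in_safe_range N R G \<longleftrightarrow>
     (\<forall>l a q s. 1 \<le> l \<and> l + a + q \<le> N \<longrightarrow> in_safe_range (R l a q s)) \<and>
     (\<forall>p q. p + q \<le> N \<longrightarrow> in_safe_range (G p q))"


section \<open>Candidates of the sampler\<close>

text \<open>\<open>Free p q\<close>: empty stack, bands of sizes \<open>p\<close> and \<open>q\<close>. \<open>Exposing l a q t\<close>: head of size \<open>l\<close>
  with target \<open>(c,t)\<close>, \<open>a = p - c\<close>.\<close>

datatype control = Free nat nat | Exposing nat nat nat nat

text \<open>\<open>Cut_Band1\<close> forms a block from the upper part of band 1, \<open>Join_Band1\<close> moves that part to the
  head, \<open>Split_Head\<close> has arguments \<open>l1 l2 a1 a2 m\<close>.\<close>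

datatype move =
    Read_Band0 nat
  | Read_Greatest_Band1
  | Cut_Band1 nat nat nat
  | Join_Band1 nat
  | Read_Only
  | Read_Least
  | Read_Greatest
  | Split_Head nat nat nat nat nat

fun stored_value :: "rtable \<Rightarrow> gtable \<Rightarrow> control \<Rightarrow> binary64" where
  "stored_value R G (Free p q) = G p q"
| "stored_value R G (Exposing l a q t) = R l a q t"

fun move_value :: "rtable \<Rightarrow> gtable \<Rightarrow> control \<Rightarrow> move \<Rightarrow> summand" where
  "move_value R G (Free p q) (Read_Band0 h) = Scaled (1/4) (G h (p + q - 1 - h))"
| "move_value R G (Free p q) Read_Greatest_Band1 = Scaled (1/4) (G p (q - 1))"
| "move_value R G (Free p q) (Cut_Band1 h c t) = Product t (R (q - 1 - h) (p - c) h t) (G c t)"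
| "move_value R G (Exposing l a q t) (Read_Band0 h) = Scaled (1/4) (R l h (a + q - h - 1) t)"
| "move_value R G (Exposing l a q t) (Join_Band1 r) = Scaled (1/4) (R (l + q - r - 1) a r t)"
| "move_value R G (Exposing l a q t) Read_Only =
     Scaled 1 (num (if a = 0 \<and> q = t then 2 powi (- 2 * int (1 + a + q)) else 0))"
| "move_value R G (Exposing l a q t) Read_Least = Scaled (1/4) (R (l - 1) a q t)"
| "move_value R G (Exposing l a q t) Read_Greatest = Scaled (1/4) (R (l - 1) a q t)"
| "move_value R G (Exposing l a q t) (Split_Head l1 l2 a1 a2 m) =
     Product m (R l1 a1 q m) (R l2 a2 m t)"
| "move_value R G _ _ = Scaled 1 (num 0)"

text \<open>The infinitely many indices outside the support give candidates of value zero, which are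
  skipped; they are left out, and so are groups that become empty thereby.\<close>

fun groups :: "control \<Rightarrow> move set set" where
  "groups (Free p q) =
     {{Read_Band0 h} | h. h < p}
   \<union> (if q \<ge> 1 then {{Read_Greatest_Band1}} else {})
   \<union> {{Cut_Band1 h c t | t. in_support (q - 1 - h) (p - c) h t} | h c. h + 2 \<le> q \<and> c \<le> p}"
| "groups (Exposing l a q t) =
     {{Read_Band0 h} | h. h < a}
   \<union> {{Join_Band1 r} | r. r < q}
   \<union> (if l = 1 then {{Read_Only}} else {})
   \<union> (if l \<ge> 2 then {{Read_Least}, {Read_Greatest}} else {})
   \<union> ({{Split_Head l1 l2 a1 a2 m | l2 a2 m. 1 \<le> l2 \<and> l1 + l2 + 1 = l \<and> a1 + a2 = a \<and>
          in_support l1 a1 q m \<and> in_support l2 a2 m t} | l1 a1. 1 \<le> l1 \<and> a1 \<le> a} - {{}})"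

text \<open>The choices of an implementation of the scan: the order of the groups and of the members of
  each group, the way in which each product is formed, and whether it is fused with the addition
  to the running sum of its group.\<close>

record scan =
  scan_order :: "control \<Rightarrow> move list list"
  scan_factors :: "control \<Rightarrow> move \<Rightarrow> binary64 \<times> binary64"
  scan_fused :: "control \<Rightarrow> move \<Rightarrow> bool"

definition valid_scan :: "rtable \<Rightarrow> gtable \<Rightarrow> scan \<Rightarrow> bool" where
  "valid_scan R G sc \<longleftrightarrow> (\<forall>k.
     distinct (concat (scan_order sc k)) \<and>
     set ` set (scan_order sc k) = groups k \<and>
     (\<forall>m. scan_factors sc k m \<in> factorings (move_value R G k m)))"


section \<open>Scanning the candidates\<close>

text \<open>Each item together with the running sum before it and after it.\<close>

primrec running_sums :: "('a \<Rightarrow> 'b \<Rightarrow> 'b) \<Rightarrow> 'b \<Rightarrow> 'a list \<Rightarrow> ('a \<times> 'b \<times> 'b) list" where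
  "running_sums f acc [] = []"
| "running_sums f acc (x # xs) = (x, acc, f x acc) # running_sums f (f x acc) xs"

definition add_move :: "scan \<Rightarrow> control \<Rightarrow> move \<Rightarrow> binary64 \<Rightarrow> binary64" where
  "add_move sc k m = add_product (scan_fused sc k m) (scan_factors sc k m)"

definition add_group :: "scan \<Rightarrow> control \<Rightarrow> move list \<Rightarrow> binary64 \<Rightarrow> binary64" where
  "add_group sc k g acc = acc \<oplus> fold (add_move sc k) g (num 0)"

text \<open>The groups after the removal of the candidates of value zero.\<close>

definition live_groups :: "scan \<Rightarrow> control \<Rightarrow> move list list" where
  "live_groups sc k = filter (\<lambda>g. g \<noteq> []) (map (filter (\<lambda>m.
     fst (scan_factors sc k m) \<otimes> snd (scan_factors sc k m) \<noteq> num 0)) (scan_order sc k))"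

definition find_move :: "scan \<Rightarrow> control \<Rightarrow> binary64 \<Rightarrow> move option" where
  "find_move sc k y =
     (case find (\<lambda>(g, A, A'). fless y A') (running_sums (add_group sc k) (num 0) (live_groups sc k)) of
        None \<Rightarrow> None
      | Some (g, A, A') \<Rightarrow>
          Some (case find (\<lambda>(m, S, S'). fless (y \<ominus> A) S') (running_sums (add_move sc k) (num 0) g) of
                  None \<Rightarrow> last g
                | Some (m, S, S') \<Rightarrow> m))"

text \<open>\<open>T\<close> is the stored value of the state; the result is \<open>None\<close> only if there is no candidate
  of positive value.\<close>

definition choose_move :: "scan \<Rightarrow> control \<Rightarrow> binary64 \<Rightarrow> real \<Rightarrow> move option" where
  "choose_move sc k T x =
     (let y = num x \<otimes> T;
          total = fold (add_group sc k) (live_groups sc k) (num 0)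
      in case find_move sc k y of
           Some m \<Rightarrow> Some m
         | None \<Rightarrow>
             (case find_move sc k (y \<otimes> (total \<oslash> T)) of
                Some m \<Rightarrow> Some m
              | None \<Rightarrow> if live_groups sc k = [] then None else Some (last (last (live_groups sc k)))))"


section \<open>The sampler\<close>

record state =
  band0 :: "nat set"
  band1 :: "nat set"
  blocks :: "(nat set \<times> nat \<times> nat) list"
  letters :: "nat list"

definition initial_state :: "nat \<Rightarrow> state" where
  "initial_state n = \<lparr>band0 = {1..n}, band1 = {}, blocks = [], letters = []\<rparr>"

fun control_of :: "state \<Rightarrow> control" where
  "control_of st = (case blocks st of
     [] \<Rightarrow> Free (card (band0 st)) (card (band1 st))
   | (H, c, t) # _ \<Rightarrow> Exposing (card H) (card (band0 st) - c) (card (band1 st)) t)"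

definition nth_least :: "nat set \<Rightarrow> nat \<Rightarrow> nat" where
  "nth_least B k = sorted_list_of_set B ! k"

definition below :: "nat set \<Rightarrow> nat \<Rightarrow> nat set" where "below B v = {w \<in> B. w < v}"
definition above :: "nat set \<Rightarrow> nat \<Rightarrow> nat set" where "above B v = {w \<in> B. v < w}"

definition read_letter :: "nat \<Rightarrow> state \<Rightarrow> state" where
  "read_letter v st = st\<lparr>letters := letters st @ [v]\<rparr>"

definition apply_move :: "state \<Rightarrow> move \<Rightarrow> state" where
  "apply_move st mv =
     (let B0 = band0 st; B1 = band1 st; (H, c, t) = hd (blocks st); rest = tl (blocks st) in
      case mv of
        Read_Band0 h \<Rightarrow>
          (let v = nth_least B0 ((if blocks st = [] then 0 else c) + h) in
           read_letter v (st\<lparr>band0 := below B0 v, band1 := B1 \<union> above B0 v\<rparr>))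
      | Read_Greatest_Band1 \<Rightarrow>
          (let v = Max B1 in read_letter v (st\<lparr>band1 := B1 - {v}\<rparr>))
      | Cut_Band1 h c' t' \<Rightarrow>
          (let v = nth_least B1 h in
           read_letter v (st\<lparr>band1 := below B1 v, blocks := [(above B1 v, c', t')]\<rparr>))
      | Join_Band1 r \<Rightarrow>
          (let v = nth_least B1 r in
           read_letter v (st\<lparr>band1 := below B1 v, blocks := (H \<union> above B1 v, c, t) # rest\<rparr>))
      | Read_Only \<Rightarrow>
          read_letter (the_elem H) (st\<lparr>blocks := rest\<rparr>)
      | Read_Least \<Rightarrow>
          (let v = Min H in read_letter v (st\<lparr>blocks := (H - {v}, c, t) # rest\<rparr>))
      | Read_Greatest \<Rightarrow>
          (let v = Max H in read_letter v (st\<lparr>blocks := (H - {v}, c, t) # rest\<rparr>))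
      | Split_Head l1 l2 a1 a2 m \<Rightarrow>
          (let v = nth_least H l1 in
           read_letter v (st\<lparr>blocks := (below H v, c + a2, m) # (above H v, c, t) # rest\<rparr>)))"

definition random_bits :: "bool list pmf" where
  "random_bits = replicate_pmf 53 (bernoulli_pmf (1/2))"

definition uniform53 :: "bool list \<Rightarrow> real" where
  "uniform53 bs = horner_sum of_bool 2 bs / 2 ^ 53"

text \<open>Without a candidate of positive value the letter choice fails; failure counts as an outcome
  outside the support of the uniform distribution in \<open>tv_dist\<close>.\<close>

definition letter_choice :: "rtable \<Rightarrow> gtable \<Rightarrow> scan \<Rightarrow> state \<Rightarrow> state spmf" where
  "letter_choice R G sc st =
     map_pmf (\<lambda>bs. map_option (apply_move st)
                (choose_move sc (control_of st) (stored_value R G (control_of st)) (uniform53 bs)))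
       random_bits"

primrec run_sampler :: "rtable \<Rightarrow> gtable \<Rightarrow> scan \<Rightarrow> nat \<Rightarrow> state \<Rightarrow> nat list spmf" where
  "run_sampler R G sc 0 st = return_spmf (letters st)"
| "run_sampler R G sc (Suc k) st = bind_spmf (letter_choice R G sc st) (run_sampler R G sc k)"

text \<open>Each letter choice reads exactly one value, so all values are read after \<open>n\<close> of them.\<close>

definition sampler :: "rtable \<Rightarrow> gtable \<Rightarrow> scan \<Rightarrow> nat \<Rightarrow> nat list spmf" where
  "sampler R G sc n = run_sampler R G sc n (initial_state n)"


section \<open>The error bound\<close>

definition unit_roundoff :: real where "unit_roundoff = 1 / 2 ^ 53"

definition gamma_err :: "nat \<Rightarrow> real" where
  "gamma_err m = real m * unit_roundoff / (1 - real m * unit_roundoff)"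

definition \<nu> :: nat where "\<nu> = 3352801"

definition table_size :: nat where "table_size = 300"

end

theory Submission
  imports Defs
begin

text \<open>The state of the sampler records which values can play the roles of 2, 4 and 3 in 12453, and the
  completions of a state are the words on the unread values that create no such pattern and meet the
  targets of the blocks. A completion determines the next move, targets included, and a legal move leaves
  exactly the completions that start with its letter. Hence the number of completions of a state
  with \<open>n\<close> unread values is \<open>4\<^sup>n\<close> times a product of exact table entries, and the moves chosen with
  probabilities proportional to the exact candidate values would give the uniform distribution.

  Every stored entry has relative error at most \<open>\<gamma>\<close>, because each recurrence consumes one letter and adds
  at most \<open>\<nu>\<close> roundings. Normalizing the stored candidate values costs \<open>\<gamma> / (1 - \<gamma>)\<close> in total
  variation. In the scan a move is chosen on an interval of \<open>x\<close> whose length differs from the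
  normalized stored value by a few units of roundoff, which costs \<open>7\<nu>u\<close> over all moves. One-sided
  lower bounds on the choice probabilities suffice, so the second scan and the fallback to the last
  candidate may be ignored. The losses add up over the \<open>n\<close> letters.\<close>

section \<open>Rounding of nonnegative reals\<close>

text \<open>Two obstacles shape the error analysis. A relative error per rounding presupposes that
  nothing underflows, but two values of the safe range can have a product near
  \<open>2 powi (-1200)\<close>. The lower bound therefore comes from the exact side: by the
  recurrences a nonzero exact candidate value is at least \<open>4 powi (-300)\<close>, and the
  stored one differs from it by a factor of at most 2. As this uses the accuracy of smaller entries,
  normality and accuracy have to be obtained in one induction. In the scan, a move is chosen on an
  interval between two running sums. Small relative errors of the two sums say nothing about a short
  interval late in the scan. So every addition is bounded absolutely as well, by
  \<open>1.01 * u * T\<close> with \<open>T\<close> the stored value, and the number of candidates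
  enters as a factor. The sampler multiplies \<open>x\<close> by \<open>T\<close>, not by the total
  of the scan; the excess of the running sums over \<open>T\<close> is charged only once, by
  telescoping. With at most 3375301 candidates in a free state and 2000302 otherwise, these losses
  fit into \<open>7 * \<nu> * u\<close>.\<close>

abbreviation (input) uu :: real where "uu \<equiv> unit_roundoff"

lemma unit_roundoff_bounds: "0 < uu" "uu < 1"
  by (auto simp: unit_roundoff_def)

text \<open>\<open>round64\<close> without the overflow test, so that rounding errors and overflow
  can be treated separately.\<close>

definition rnd :: "real \<Rightarrow> real" where
  "rnd r = of_int (nearest_even (r / 2 powi ulp_exponent r)) * 2 powi ulp_exponent r"

lemma round64_ereal:
  "round64 (ereal r) = (if \<bar>rnd r\<bar> < 2 ^ 1024 then ereal (rnd r) else if rnd r > 0 then \<infinity> else - \<infinity>)"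
  by (simp add: round64_def rnd_def Let_def)

lemma nearest_even_bounds: "\<bar>of_int (nearest_even x) - x\<bar> \<le> 1/2" "\<lfloor>x\<rfloor> \<le> nearest_even x" "nearest_even x \<le> \<lfloor>x\<rfloor> + 1"
proof -
  have 1: "of_int \<lfloor>x\<rfloor> \<le> x" "x < of_int \<lfloor>x\<rfloor> + 1" by linarith+
  show "\<bar>of_int (nearest_even x) - x\<bar> \<le> 1/2" unfolding nearest_even_def using 1 by (auto simp: abs_real_def) linarith+
  show "\<lfloor>x\<rfloor> \<le> nearest_even x" "nearest_even x \<le> \<lfloor>x\<rfloor> + 1" unfolding nearest_even_def by auto
qed

lemma binade:
  fixes r :: real assumes "0 < r"
  shows "2 powi \<lfloor>log 2 r\<rfloor> \<le> r" "r < 2 powi (\<lfloor>log 2 r\<rfloor> + 1)"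
proof -
  have "2 powr of_int \<lfloor>log 2 r\<rfloor> \<le> r" using assms by (simp add: le_log_iff[symmetric])
  thus "2 powi \<lfloor>log 2 r\<rfloor> \<le> r" by (simp add: powr_real_of_int')
  have "log 2 r < of_int (\<lfloor>log 2 r\<rfloor> + 1)" by linarith
  hence "r < 2 powr of_int (\<lfloor>log 2 r\<rfloor> + 1)" using assms by (simp only: log_less_iff)
  thus "r < 2 powi (\<lfloor>log 2 r\<rfloor> + 1)" using powr_real_of_int'[of 2 "\<lfloor>log 2 r\<rfloor> + 1"] by simp
qed

lemma powi2_mono: "a \<le> b \<Longrightarrow> (2::real) powi a \<le> 2 powi b"
  by (simp add: power_int_increasing)

text \<open>Half a unit in the last place is \<open>u\<close> times the lower end of the binade of
  \<open>r\<close>; in the subnormal range the unit is fixed, which gives the floor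
  \<open>2 powi (-1022)\<close>.\<close>

lemma rnd_error:
  assumes "0 \<le> r" shows "\<bar>rnd r - r\<bar> \<le> uu * max r (2 powi (-1022))"
proof (cases "r = 0")
  case True thus ?thesis by (simp add: rnd_def nearest_even_def unit_roundoff_def)
next
  case False
  hence r: "0 < r" using assms by simp
  define e where "e = ulp_exponent r"
  have p: "(0::real) < 2 powi e" by simp
  have "\<bar>rnd r - r\<bar> = \<bar>of_int (nearest_even (r / 2 powi e)) - r / 2 powi e\<bar> * 2 powi e"
  proof -
    have "rnd r - r = (of_int (nearest_even (r / 2 powi e)) - r / 2 powi e) * 2 powi e"
      using p unfolding rnd_def e_def[symmetric] by (simp add: left_diff_distrib)
    thus ?thesis by (simp add: abs_mult)
  qed
  also have "\<dots> \<le> 1/2 * 2 powi e" by (intro mult_right_mono nearest_even_bounds) simp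
  also have "\<dots> = uu * 2 powi (e + 52)"
    by (simp add: unit_roundoff_def power_int_add)
  also have "2 powi (e + 52) \<le> max r (2 powi (-1022))"
  proof (cases "\<lfloor>log 2 r\<rfloor> - 52 \<ge> -1074")
    case True
    hence "e + 52 = \<lfloor>log 2 r\<rfloor>" using r by (simp add: e_def ulp_exponent_def)
    thus ?thesis using binade[OF r] by (simp add: max_def)
  next
    case False
    hence "e + 52 = -1022" using r by (simp add: e_def ulp_exponent_def)
    thus ?thesis by (simp only: max.cobounded2)
  qed
  finally show ?thesis using unit_roundoff_bounds by (simp add: mult_left_mono)
qed

lemma rnd_nonneg: "0 \<le> r \<Longrightarrow> 0 \<le> rnd r"
proof -
  assume "0 \<le> r"
  hence "0 \<le> \<lfloor>r / 2 powi ulp_exponent r\<rfloor>" by simp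
  hence "0 \<le> nearest_even (r / 2 powi ulp_exponent r)" using nearest_even_bounds(2) order.trans by blast
  thus ?thesis by (simp add: rnd_def)
qed

lemma rnd_0 [simp]: "rnd 0 = 0"
  by (simp add: rnd_def nearest_even_def)

section \<open>Floating-point numbers and monotonicity of rounding\<close>

definition is_float :: "real \<Rightarrow> bool" where
  "is_float f \<longleftrightarrow> (\<exists>n e::int. -1074 \<le> e \<and> 0 \<le> n \<and> n \<le> 2 ^ 53 \<and> f = of_int n * 2 powi e)"

lemma is_float_0 [simp]: "is_float 0"
  unfolding is_float_def by (rule exI[of _ 0], rule exI[of _ 0]) simp

lemma is_float_powi: "-1074 \<le> e \<Longrightarrow> is_float (2 powi e)"
  unfolding is_float_def by (rule exI[of _ 1], rule exI[of _ e]) simp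

text \<open>Rounding up may carry the mantissa to \<open>2 ^ 53\<close>, which is why
  \<open>is_float\<close> includes this value.\<close>

lemma is_float_rnd:
  assumes "0 \<le> r" shows "is_float (rnd r)"
proof (cases "r = 0")
  case False
  hence r: "0 < r" using assms by simp
  define e where "e = ulp_exponent r"
  have "r < 2 powi (\<lfloor>log 2 r\<rfloor> + 1)" using binade[OF r] by simp
  also have "\<dots> \<le> 2 powi (e + 53)" by (rule powi2_mono) (use r in \<open>simp add: e_def ulp_exponent_def\<close>)
  finally have "r / 2 powi e < 2 ^ 53" by (simp add: power_int_add field_simps)
  hence "\<lfloor>r / 2 powi e\<rfloor> < 2 ^ 53" by (simp add: floor_less_iff)
  hence "nearest_even (r / 2 powi e) \<le> 2 ^ 53" using nearest_even_bounds(3)[of "r / 2 powi e"] by linarith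
  moreover have "0 \<le> nearest_even (r / 2 powi e)"
    using nearest_even_bounds(2)[of "r / 2 powi e"] assms by (meson order.trans zero_le_floor divide_nonneg_nonneg zero_le_power_int zero_le_numeral)
  ultimately show ?thesis unfolding is_float_def rnd_def e_def[symmetric]
    by (intro exI[of _ "nearest_even (r / 2 powi e)"] exI[of _ e]) (simp add: e_def ulp_exponent_def)
qed simp

text \<open>Rounding never crosses a floating-point number. Two things rest on this: lower bounds by
  powers of two survive any number of roundings, and computed running sums of nonnegative terms
  increase exactly, not only up to errors.\<close>

lemma rnd_ge_float:
  assumes f: "is_float f" and "f \<le> r" shows "f \<le> rnd r"
proof (cases "r > 0")
  case False
  obtain n e :: int where ne: "0 \<le> n" "f = of_int n * 2 powi e" using f by (auto simp: is_float_def)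
  hence "0 \<le> f" by simp
  with False assms have "r = 0" "f = 0" by auto
  thus ?thesis by simp
next
  case True
  obtain n e :: int where ne: "-1074 \<le> e" "0 \<le> n" "n \<le> 2 ^ 53" "f = of_int n * 2 powi e"
    using f by (auto simp: is_float_def)
  define d where "d = ulp_exponent r"
  have fl: "of_int \<lfloor>r / 2 powi d\<rfloor> * 2 powi d \<le> rnd r"
    unfolding rnd_def d_def[symmetric] by (intro mult_right_mono) (auto simp: nearest_even_bounds)
  show ?thesis
  proof (cases "d \<le> e")
    \<comment> \<open>If the grid of \<open>r\<close> is at least as fine as that of
      \<open>f\<close>, then \<open>f\<close> is a multiple of the unit of \<open>r\<close>, and
      rounding down already stays above it.\<close>
    case True
    define k where "k = n * 2 ^ nat (e - d)"
    have "(2::real) powi e = 2 powi (d + int (nat (e - d)))" using True by simp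
    also have "\<dots> = 2 ^ nat (e - d) * 2 powi d" by (subst power_int_add) (auto simp: power_int_def)
    finally have fk: "f = of_int k * 2 powi d" by (simp add: ne k_def)
    hence "of_int k \<le> r / 2 powi d" using assms(2) by (simp add: field_simps)
    hence "k \<le> \<lfloor>r / 2 powi d\<rfloor>" by (simp add: le_floor_iff)
    hence "f \<le> of_int \<lfloor>r / 2 powi d\<rfloor> * 2 powi d" unfolding fk by (intro mult_right_mono) auto
    with fl show ?thesis by simp
  next
    case False
    \<comment> \<open>\<open>d > e \<ge> -1074\<close> rules out the subnormal clamp, so
      \<open>r\<close> has at least \<open>2 ^ 52\<close> units, whereas \<open>f\<close> has at
      most \<open>2 ^ 53\<close> units of half that size or less.\<close>
    hence d: "d = \<lfloor>log 2 r\<rfloor> - 52" using ne \<open>r > 0\<close> by (simp add: d_def ulp_exponent_def)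
    have "of_int n \<le> (2 ^ 53 :: real)" using ne(3) by (metis of_int_le_iff of_int_numeral of_int_power)
    hence "f \<le> 2 ^ 53 * 2 powi e" unfolding ne by (intro mult_right_mono) auto
    also have "\<dots> = 2 powi (e + 53)" by (simp add: power_int_add)
    also have "\<dots> \<le> 2 powi (d + 52)" by (rule powi2_mono) (use False in simp)
    finally have 1: "f \<le> 2 ^ 52 * 2 powi d" by (simp add: power_int_add)
    have "2 powi (d + 52) \<le> r" using binade(1)[OF True] by (simp add: d)
    hence "2 ^ 52 \<le> r / 2 powi d" by (simp add: power_int_add field_simps)
    hence "2 ^ 52 \<le> \<lfloor>r / 2 powi d\<rfloor>" by (simp add: le_floor_iff)
    hence "(2::real) ^ 52 \<le> of_int \<lfloor>r / 2 powi d\<rfloor>" by (metis of_int_le_iff of_int_numeral of_int_power)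
    hence "2 ^ 52 * (2::real) powi d \<le> of_int \<lfloor>r / 2 powi d\<rfloor> * 2 powi d" by (intro mult_right_mono) auto
    with 1 fl show ?thesis by linarith
  qed
qed

section \<open>Relative errors\<close>

text \<open>In contrast to \<open>\<bar>y - x\<bar> \<le> \<delta> * x\<close>, this relation is symmetric, and the exponents add under
  composition and multiplication.\<close>

definition rel :: "nat \<Rightarrow> real \<Rightarrow> real \<Rightarrow> bool" where
  "rel k x y \<longleftrightarrow> 0 \<le> x \<and> 0 \<le> y \<and> x * (1 - uu) ^ k \<le> y \<and> y * (1 - uu) ^ k \<le> x"

lemma one_minus_uu: "0 < 1 - uu" "1 - uu \<le> 1" "0 \<le> 1 - uu"
  using unit_roundoff_bounds by auto

lemma uu_pow: "0 < (1 - uu) ^ k" "(1 - uu) ^ k \<le> 1"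
  using one_minus_uu by (auto intro: power_le_one)

lemma rel_refl: "0 \<le> x \<Longrightarrow> rel k x x"
  using mult_left_mono[OF uu_pow(2), of x k] by (simp add: rel_def)

lemma rel_sym: "rel k x y \<Longrightarrow> rel k y x" by (auto simp: rel_def)

lemma rel_0_left [simp]: "rel k 0 y \<longleftrightarrow> y = 0"
  using uu_pow(1)[of k] by (auto simp: rel_def mult_le_0_iff)

lemma rel_0_right [simp]: "rel k x 0 \<longleftrightarrow> x = 0"
  using rel_sym rel_0_left by blast

lemma rel_trans: "rel j x y \<Longrightarrow> rel k y z \<Longrightarrow> rel (j + k) x z"
proof -
  assume a: "rel j x y" "rel k y z"
  have "x * (1 - uu) ^ (j + k) = (x * (1 - uu) ^ j) * (1 - uu) ^ k" by (simp add: power_add)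
  also have "\<dots> \<le> y * (1 - uu) ^ k" using a one_minus_uu by (intro mult_right_mono) (auto simp: rel_def)
  finally have 1: "x * (1 - uu) ^ (j + k) \<le> z" using a by (auto simp: rel_def)
  have "z * (1 - uu) ^ (j + k) = (z * (1 - uu) ^ k) * (1 - uu) ^ j" by (simp add: power_add)
  also have "\<dots> \<le> y * (1 - uu) ^ j" using a one_minus_uu by (intro mult_right_mono) (auto simp: rel_def)
  finally have 2: "z * (1 - uu) ^ (j + k) \<le> x" using a by (auto simp: rel_def)
  show ?thesis using a 1 2 by (auto simp: rel_def)
qed

lemma rel_mono: "rel j x y \<Longrightarrow> j \<le> k \<Longrightarrow> rel k x y"
  using rel_trans[of j x y "k - j" y] rel_refl[of y "k - j"] by (auto simp: rel_def)

lemma rel_mult: "rel j x y \<Longrightarrow> rel k x' y' \<Longrightarrow> rel (j + k) (x * x') (y * y')"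
proof -
  assume a: "rel j x y" "rel k x' y'"
  have "(x * (1 - uu) ^ j) * (x' * (1 - uu) ^ k) \<le> y * y'" "(y * (1 - uu) ^ j) * (y' * (1 - uu) ^ k) \<le> x * x'"
    using a one_minus_uu by (auto simp: rel_def intro!: mult_mono)
  thus ?thesis using a by (auto simp: rel_def power_add mult_ac)
qed

lemma rel_scale: "rel k x y \<Longrightarrow> 0 \<le> d \<Longrightarrow> rel k (d * x) (d * y)"
  using rel_mult[of 0 d d k x y] rel_refl[of d 0] by simp

text \<open>Here nonnegativity pays off: in a sum the relative errors of the operands take their
  maximum and do not add up.\<close>

lemma rel_add: "rel k x y \<Longrightarrow> rel k x' y' \<Longrightarrow> rel k (x + x') (y + y')"
  by (auto simp: rel_def distrib_right)

lemma rel_sum: "(\<And>i. i \<in> I \<Longrightarrow> rel k (f i) (g i)) \<Longrightarrow> rel k (sum f I) (sum g I)"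
  by (induction I rule: infinite_finite_induct) (auto intro: rel_add rel_refl)

lemma uu_pow_ge: "1 - real k * uu \<le> (1 - uu) ^ k"
  using Bernoulli_inequality[of "-uu" k] unit_roundoff_bounds by simp

text \<open>A crude factor 2 for any number of roundings that can occur; it serves to keep values
  away from underflow and overflow.\<close>

lemma uu_pow_half: "k \<le> 2 ^ 52 \<Longrightarrow> 1/2 \<le> (1 - uu) ^ k"
proof -
  assume "k \<le> 2 ^ 52"
  hence "real k \<le> 2 ^ 52" by (metis of_nat_le_iff of_nat_numeral of_nat_power)
  hence "real k * uu \<le> 2 ^ 52 * uu" using unit_roundoff_bounds by (intro mult_right_mono) auto
  also have "\<dots> = 1/2" by (simp add: unit_roundoff_def)
  finally show ?thesis using uu_pow_ge[of k] by linarith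
qed

text \<open>The bound is a floating-point number, so it is preserved by rounding, whereas a relative error
  would accumulate.\<close>

definition normal0 :: "real \<Rightarrow> bool" where "normal0 y \<longleftrightarrow> y = 0 \<or> 2 powi (-1000) \<le> y"

lemma normal0_0 [simp]: "normal0 0" by (simp add: normal0_def)
lemma normal0_nonneg: "normal0 y \<Longrightarrow> 0 \<le> y" by (auto simp: normal0_def intro: order.trans[OF zero_le_power_int])
lemma normal0_add: "normal0 x \<Longrightarrow> normal0 y \<Longrightarrow> normal0 (x + y)"
  using normal0_nonneg[of x] normal0_nonneg[of y] by (auto simp: normal0_def)

lemma normal0_rnd: "normal0 r \<Longrightarrow> normal0 (rnd r)"
  using rnd_ge_float[OF is_float_powi, of "-1000" r] by (auto simp: normal0_def)

text \<open>The upper bound \<open>(1 + u) * r\<close> becomes the symmetric form with a single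
  factor because \<open>(1 + u) * (1 - u) \<le> 1\<close>.\<close>

lemma rel_rnd: assumes "normal0 r" shows "rel 1 r (rnd r)"
proof (cases "r = 0")
  case False
  have r0: "0 \<le> r" using assms normal0_nonneg by simp
  have "2 powi (-1022) \<le> (2::real) powi (-1000)" by (rule powi2_mono) simp
  also have "\<dots> \<le> r" using assms False by (simp add: normal0_def)
  finally have "max r (2 powi (-1022)) = r" by simp
  hence e: "\<bar>rnd r - r\<bar> \<le> uu * r" using rnd_error[OF r0] by simp
  hence "rnd r \<le> r * (1 + uu)" by (simp add: algebra_simps)
  hence "rnd r * (1 - uu) \<le> r * (1 + uu) * (1 - uu)" using one_minus_uu by (intro mult_right_mono) auto
  also have "\<dots> = r - r * uu^2" by (simp add: algebra_simps power2_eq_square)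
  also have "\<dots> \<le> r" using r0 by simp
  finally show ?thesis using e r0 rnd_nonneg[OF r0] by (auto simp: rel_def algebra_simps)
qed simp

lemma round64_cases:
  assumes "normal0 r" shows "round64 (ereal r) = \<infinity> \<or> round64 (ereal r) = ereal (rnd r)"
  using rnd_nonneg[OF normal0_nonneg[OF assms]] by (auto simp: round64_ereal)

lemma round64_finite:
  assumes "normal0 r" "r \<le> 2 ^ 1000" shows "round64 (ereal r) = ereal (rnd r)"
proof -
  have "rnd r * (1 - uu) \<le> r" using rel_rnd[OF assms(1)] by (simp add: rel_def)
  moreover have "rnd r * (1/2) \<le> rnd r * (1 - uu)"
    using rnd_nonneg[OF normal0_nonneg[OF assms(1)]] uu_pow_half[of 1] by (intro mult_left_mono) auto
  ultimately have "rnd r \<le> 2 * 2 ^ 1000" using assms(2) by linarith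
  also have "\<dots> < (2::real) ^ 1024" by simp
  finally show ?thesis using rnd_nonneg[OF normal0_nonneg[OF assms(1)]] by (auto simp: round64_ereal)
qed


section \<open>Relative errors of floating-point sums\<close>

definition approx :: "nat \<Rightarrow> real \<Rightarrow> binary64 \<Rightarrow> bool" where
  "approx k x v \<longleftrightarrow> (\<exists>y. v = num y \<and> normal0 y \<and> rel k x y)"

text \<open>Overflow is carried along instead of being excluded at each step. With nonnegative
  operands \<open>Num \<infinity>\<close> is absorbing under addition and never produces
  \<open>NaN\<close>, so a finite final value leaves only the accurate case.\<close>

definition approx_inf :: "nat \<Rightarrow> real \<Rightarrow> binary64 \<Rightarrow> bool" where
  "approx_inf k x v \<longleftrightarrow> v = Num \<infinity> \<or> approx k x v"

text \<open>The product of the two factors is taken exactly: a fused operation rounds it only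
  together with the addition, an unfused one rounds it separately.\<close>

definition pair_fin :: "nat \<Rightarrow> real \<Rightarrow> binary64 \<times> binary64 \<Rightarrow> bool" where
  "pair_fin j e fg \<longleftrightarrow> (\<exists>a b. fg = (num a, num b) \<and> normal0 (a * b) \<and> rel j e (a * b))"

text \<open>The second case occurs for an overflowing inner sum; it is excluded afterwards, as the stored sum is
  finite.\<close>

definition pair_ok :: "nat \<Rightarrow> real \<Rightarrow> binary64 \<times> binary64 \<Rightarrow> bool" where
  "pair_ok j e fg \<longleftrightarrow> pair_fin j e fg \<or> (\<exists>a>0. fg = (num a, Num \<infinity>))"

lemma approx_mono: "approx j x v \<Longrightarrow> j \<le> k \<Longrightarrow> approx k x v"
  by (auto simp: approx_def intro: rel_mono)

lemma approx_inf_mono: "approx_inf j x v \<Longrightarrow> j \<le> k \<Longrightarrow> approx_inf k x v"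
  by (auto simp: approx_inf_def intro: approx_mono)

lemma num_add: "num x \<oplus> num y = Num (round64 (ereal (x + y)))"
  by (simp add: invalid_add_def)

lemma num_mult: "num x \<otimes> num y = Num (round64 (ereal (x * y)))"
  by (simp add: invalid_mult_def)

lemma num_fma: "fma (num a) (num b) (num y) = Num (round64 (ereal (a * b + y)))"
  by (simp add: invalid_mult_def invalid_add_def)

lemma round64_inf: "round64 \<infinity> = \<infinity>" by (simp add: round64_def)

lemma approx_add:
  assumes "approx k x v" "approx j y w" "k \<le> n" "j \<le> n"
  shows "approx_inf (Suc n) (x + y) (v \<oplus> w)"
proof -
  from assms obtain a b where ab: "v = num a" "normal0 a" "rel k x a" "w = num b" "normal0 b" "rel j y b"
    unfolding approx_def by blast
  have n: "normal0 (a + b)" using ab normal0_add by blast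
  have "rel n (x + y) (a + b)" using ab assms by (intro rel_add) (auto intro: rel_mono)
  from rel_trans[OF this rel_rnd[OF n]] have "rel (Suc n) (x + y) (rnd (a + b))" by simp
  with round64_cases[OF n] normal0_rnd[OF n] show ?thesis
    unfolding ab(1,4) num_add by (auto simp: approx_inf_def approx_def)
qed

lemma add_inf: "approx_inf k x v \<Longrightarrow> v \<oplus> Num \<infinity> = Num \<infinity> \<and> Num \<infinity> \<oplus> v = Num \<infinity>"
  by (auto simp: approx_inf_def approx_def invalid_add_def round64_inf)

lemma pair_ok_mult:
  assumes "pair_ok j e fg" shows "approx_inf (Suc j) e (fst fg \<otimes> snd fg)"
  using assms unfolding pair_ok_def pair_fin_def
proof (elim disjE exE conjE)
  fix a b assume ab: "fg = (num a, num b)" "normal0 (a * b)" "rel j e (a * b)"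
  from rel_trans[OF ab(3) rel_rnd[OF ab(2)]] have "rel (Suc j) e (rnd (a * b))" by simp
  thus ?thesis using round64_cases[OF ab(2)] normal0_rnd[OF ab(2)]
    unfolding ab(1) fst_conv snd_conv num_mult by (auto simp: approx_inf_def approx_def)
next
  fix a :: real assume "0 < a" "fg = (num a, Num \<infinity>)"
  thus ?thesis by (simp add: invalid_mult_def round64_inf approx_inf_def)
qed

text \<open>\<open>Suc j\<close> leaves room for the rounding of an unfused product. Accumulator and
  product are then both within \<open>n\<close>, and the addition costs one more.\<close>

lemma add_product_approx:
  assumes "pair_ok j e fg" "approx_inf k x v" "k \<le> n" "Suc j \<le> n"
  shows "approx_inf (Suc n) (x + e) (add_product fused fg v)"
proof (cases fused)
  case False
  from pair_ok_mult[OF assms(1)] have m: "approx_inf (Suc j) e (fst fg \<otimes> snd fg)" .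
  show ?thesis
  proof (cases "v = Num \<infinity> \<or> fst fg \<otimes> snd fg = Num \<infinity>")
    case True
    hence "v \<oplus> (fst fg \<otimes> snd fg) = Num \<infinity>" using add_inf[OF m] add_inf[OF assms(2)] by auto
    thus ?thesis using False by (simp add: add_product_def approx_inf_def)
  next
    case False
    hence "approx k x v" "approx (Suc j) e (fst fg \<otimes> snd fg)" using m assms by (auto simp: approx_inf_def)
    from approx_add[OF this assms(3,4)] show ?thesis using \<open>\<not> fused\<close> by (simp add: add_product_def)
  qed
next
  case True
  from assms(1)[unfolded pair_ok_def pair_fin_def] show ?thesis
  proof (elim disjE exE conjE)
    fix a b assume ab: "fg = (num a, num b)" "normal0 (a * b)" "rel j e (a * b)"
    from assms(2)[unfolded approx_inf_def approx_def] show ?thesis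
    proof (elim disjE exE conjE)
      assume "v = Num \<infinity>"
      thus ?thesis using True ab by (simp add: add_product_def approx_inf_def invalid_mult_def invalid_add_def round64_inf)
    next
      fix y assume y: "v = num y" "normal0 y" "rel k x y"
      have n: "normal0 (a * b + y)" using ab y normal0_add by blast
      have "rel n (e + x) (a * b + y)" using ab y assms by (intro rel_add) (auto intro: rel_mono)
      from rel_trans[OF this rel_rnd[OF n]] have "rel (Suc n) (x + e) (rnd (a * b + y))" by (simp add: add.commute)
      thus ?thesis using True round64_cases[OF n] normal0_rnd[OF n]
        by (auto simp: add_product_def ab(1) y(1) num_fma approx_inf_def approx_def simp del: fma.simps)
    qed
  next
    fix a :: real assume a: "0 < a" "fg = (num a, Num \<infinity>)"
    show ?thesis using True a assms(2)
      by (auto simp: add_product_def approx_inf_def approx_def invalid_mult_def invalid_add_def round64_inf)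
  qed
qed

lemma accumulates_approx:
  assumes "accumulates acc (map f xs) v" "approx_inf k x acc" "k \<le> n" "Suc j \<le> n"
    and "\<And>s fg. s \<in> set xs \<Longrightarrow> fg \<in> factorings (f s) \<Longrightarrow> pair_ok j (e s) fg"
  shows "approx_inf (n + length xs) (x + sum_list (map e xs)) v"
  using assms
proof (induction xs arbitrary: acc k x n)
  case Nil
  thus ?case by (auto intro: approx_inf_mono)
next
  case (Cons s xs)
  from Cons.prems(1) obtain fg fused where fg: "fg \<in> factorings (f s)"
    and acc: "accumulates (add_product fused fg acc) (map f xs) v" by auto
  have "approx_inf (Suc n) (x + e s) (add_product fused fg acc)"
    using Cons.prems fg by (intro add_product_approx) auto
  from Cons.IH[OF acc this, of "Suc n"] Cons.prems show ?case by (simp add: add.assoc)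
qed

lemma approx_0: "approx k 0 (num 0)" by (simp add: approx_def)

lemma mset_eq_image_mset_E:
  assumes "mset xs = image_mset f N" obtains ys where "mset ys = N" "xs = map f ys"
  using assms
proof (induction xs arbitrary: N thesis)
  case (Cons x xs)
  from Cons.prems(2) obtain M y where "N = add_mset y M" "f y = x" "image_mset f M = mset xs"
    by (metis mset.simps(2) msed_map_invR)
  with Cons.IH[of M] Cons.prems(1) show ?case by (metis list.simps(9) mset.simps(2))
qed auto

text \<open>Summands are paired with their exact values, as equal floating-point summands may stand for
  different exact values.\<close>

lemma computed_sum_approx:
  assumes "computed_sum (image_mset fst N) v" "Suc j \<le> n"
    and "\<And>s e fg. (s, e) \<in># N \<Longrightarrow> fg \<in> factorings s \<Longrightarrow> pair_ok j e fg"
  shows "approx_inf (n + size N) (\<Sum>s\<in>#N. snd s) v"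
proof -
  from assms(1) obtain xs where xs: "mset xs = image_mset fst N" "accumulates (num 0) xs v"
    unfolding computed_sum_def by blast
  then obtain ys where ys: "mset ys = N" "xs = map fst ys" using mset_eq_image_mset_E by blast
  have "approx_inf (n + length ys) (0 + sum_list (map snd ys)) v"
  proof (rule accumulates_approx[where f = fst and k = 0 and j = j])
    show "accumulates (num 0) (map fst ys) v" using xs ys by simp
    show "pair_ok j (snd s) fg" if "s \<in> set ys" "fg \<in> factorings (fst s)" for s fg
      using assms(3)[of "fst s" "snd s" fg] that ys(1) by (metis prod.collapse set_mset_mset)
  qed (use assms(2) approx_0 in \<open>auto simp: approx_inf_def\<close>)
  thus ?thesis using ys(1) by (auto simp flip: sum_mset_sum_list)
qed

lemma approx_finite:
  assumes "approx_inf k x v" "v \<noteq> Num \<infinity>" shows "approx k x v"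
  using assms by (simp add: approx_inf_def)

section \<open>Exact tables\<close>

fun csize :: "control \<Rightarrow> nat" where
  "csize (Free p q) = p + q"
| "csize (Exposing l a q t) = l + a + q"

text \<open>For an exposing control this is the number of letters read until the head is exhausted:
  \<open>l + p + q\<close> values are unread now and \<open>c + t\<close> then, where
  \<open>a = p - c\<close>.\<close>

fun unread_letters :: "control \<Rightarrow> nat" where
  "unread_letters (Free p q) = p + q"
| "unread_letters (Exposing l a q t) = l + a + q - t"

fun supported :: "control \<Rightarrow> bool" where
  "supported (Free p q) = True"
| "supported (Exposing l a q t) = in_support l a q t"

fun children :: "control \<Rightarrow> move \<Rightarrow> control list" where
  "children (Free p q) (Read_Band0 h) = [Free h (p + q - 1 - h)]"
| "children (Free p q) Read_Greatest_Band1 = [Free p (q - 1)]"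
| "children (Free p q) (Cut_Band1 h c t) = [Exposing (q - 1 - h) (p - c) h t, Free c t]"
| "children (Exposing l a q t) (Read_Band0 h) = [Exposing l h (a + q - h - 1) t]"
| "children (Exposing l a q t) (Join_Band1 r) = [Exposing (l + q - r - 1) a r t]"
| "children (Exposing l a q t) Read_Least = [Exposing (l - 1) a q t]"
| "children (Exposing l a q t) Read_Greatest = [Exposing (l - 1) a q t]"
| "children (Exposing l a q t) (Split_Head l1 l2 a1 a2 m) = [Exposing l1 a1 q m, Exposing l2 a2 m t]"
| "children _ _ = []"

fun coef :: "control \<Rightarrow> move \<Rightarrow> real" where
  "coef (Free p q) (Read_Band0 h) = 1/4"
| "coef (Free p q) Read_Greatest_Band1 = 1/4"
| "coef (Free p q) (Cut_Band1 h c t) = 4 powi (int t - 1)"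
| "coef (Exposing l a q t) (Read_Band0 h) = 1/4"
| "coef (Exposing l a q t) (Join_Band1 r) = 1/4"
| "coef (Exposing l a q t) Read_Only = (if a = 0 \<and> q = t then 2 powi (- 2 * int (1 + a + q)) else 0)"
| "coef (Exposing l a q t) Read_Least = 1/4"
| "coef (Exposing l a q t) Read_Greatest = 1/4"
| "coef (Exposing l a q t) (Split_Head l1 l2 a1 a2 m) = 4 powi (int m - 1)"
| "coef _ _ = 0"

text \<open>Both recurrences become sums over \<open>moves\<close> of a coefficient times a product
  of at most two entries. \<open>Y\<close> is left open so that the exact and the stored tables
  share this form. The factor 2 of \<open>D\<close> is split between \<open>Read_Least\<close> and
  \<open>Read_Greatest\<close>.\<close>

definition weight :: "(control \<Rightarrow> real) \<Rightarrow> control \<Rightarrow> move \<Rightarrow> real" where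
  "weight Y k m = coef k m * prod_list (map Y (children k m))"

definition moves :: "control \<Rightarrow> move set" where
  "moves k = \<Union> (groups k)"

definition cut_indices :: "nat \<Rightarrow> nat \<Rightarrow> (nat \<times> nat \<times> nat) set" where
  "cut_indices p q = {(h, c, t). h + 2 \<le> q \<and> c \<le> p \<and> in_support (q - 1 - h) (p - c) h t}"

definition split_indices :: "nat \<Rightarrow> nat \<Rightarrow> nat \<Rightarrow> nat \<Rightarrow> (nat \<times> nat \<times> nat \<times> nat \<times> nat) set" where
  "split_indices l a q s = {(l1, l2, a1, a2, m). 1 \<le> l1 \<and> 1 \<le> l2 \<and> l1 + l2 + 1 = l \<and> a1 + a2 = a \<and>
            in_support l1 a1 q m \<and> in_support l2 a2 m s}"

lemma Union_Collect: "\<Union> {F x | x. P x} = (\<Union>x\<in>{x. P x}. F x)" by auto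
lemma Union_Collect2: "\<Union> {F x y | x y. P x y} = (\<Union>(x, y)\<in>{(x, y). P x y}. F x y)" by auto

lemma moves_Free:
  "moves (Free p q) = Read_Band0 ` {..<p} \<union> (if q \<ge> 1 then {Read_Greatest_Band1} else {})
     \<union> (\<lambda>(h, c, t). Cut_Band1 h c t) ` cut_indices p q"
  unfolding moves_def groups.simps Union_Un_distrib Union_Collect Union_Collect2
  by (auto simp: cut_indices_def image_iff)

lemma moves_Exposing:
  "moves (Exposing l a q t) = Read_Band0 ` {..<a} \<union> Join_Band1 ` {..<q} \<union> (if l = 1 then {Read_Only} else {})
     \<union> (if l \<ge> 2 then {Read_Least, Read_Greatest} else {})
     \<union> (\<lambda>(l1, l2, a1, a2, m). Split_Head l1 l2 a1 a2 m) ` split_indices l a q t"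
proof (rule set_eqI)
  fix x
  have U: "\<Union> (A - {{}}) = \<Union> A" for A :: "'b set set" by auto
  show "x \<in> moves (Exposing l a q t) \<longleftrightarrow> x \<in> Read_Band0 ` {..<a} \<union> Join_Band1 ` {..<q} \<union> (if l = 1 then {Read_Only} else {})
     \<union> (if l \<ge> 2 then {Read_Least, Read_Greatest} else {})
     \<union> (\<lambda>(l1, l2, a1, a2, m). Split_Head l1 l2 a1 a2 m) ` split_indices l a q t"
    unfolding moves_def groups.simps Union_Un_distrib U Union_Collect Union_Collect2
    by (cases x) (auto simp: split_indices_def image_iff)
qed

lemma in_support_le: "in_support l a q s \<Longrightarrow> 1 \<le> l \<and> s \<le> a + q"
  by (auto simp: in_support_def split: if_splits)

lemma children_csize:
  assumes "supported k" "m \<in> moves k" "c \<in> set (children k m)"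
  shows "csize c < csize k"
  using assms
  by (cases k) (auto simp: moves_Free moves_Exposing cut_indices_def split_indices_def in_support_def split: if_splits)

text \<open>The scaled exact tables as one function: \<open>Exposing\<close> gives the entries
  \<open>R'\<close> and \<open>Free\<close> the entries \<open>G'\<close>. Unsupported entries are
  zero by the second test, so the sum may run over all moves.\<close>

function exact :: "control \<Rightarrow> real" where
  "exact k = (if k = Free 0 0 then 1 else if \<not> supported k then 0 else
     \<Sum>m\<in>moves k. coef k m * prod_list (map exact (children k m)))"
  by auto
termination by (relation "Wellfounded.measure csize") (auto intro: children_csize)

declare exact.simps [simp del]

lemma exact_Free_0: "exact (Free 0 0) = 1"
  by (simp add: exact.simps)

lemma exact_unsupported: "\<not> supported k \<Longrightarrow> exact k = 0"
  by (subst exact.simps) auto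

lemma exact_sum: "supported k \<Longrightarrow> k \<noteq> Free 0 0 \<Longrightarrow> exact k = (\<Sum>m\<in>moves k. weight exact k m)"
  by (subst exact.simps) (simp add: weight_def)

text \<open>In a split the first part ends with \<open>m\<close> values in band 1 and the second
  starts from there, so \<open>m\<close> cancels; in a cut, \<open>t\<close> cancels in the same
  way.\<close>

lemma children_unread:
  assumes "supported k" "m \<in> moves k"
  shows "sum_list (map unread_letters (children k m)) + 1 \<le> unread_letters k"
  using assms
proof (cases k)
  case (Free p q)
  thus ?thesis using assms by (auto simp: moves_Free cut_indices_def dest!: in_support_le split: if_splits)
next
  case (Exposing l a q t)
  hence "1 \<le> l \<and> t \<le> a + q" using assms by (auto dest: in_support_le)
  thus ?thesis using assms(2) unfolding Exposing moves_Exposing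
    by (auto simp: split_indices_def dest!: in_support_le split: if_splits)
qed

lemma coef_nonneg: "0 \<le> coef k m"
  by (induction k m rule: coef.induct) auto

lemma exact_nonneg: "0 \<le> exact k"
proof (induction k rule: measure_induct_rule[of csize])
  case (less k)
  show ?case
  proof (cases "k = Free 0 0 \<or> \<not> supported k")
    case True thus ?thesis by (auto simp: exact_Free_0 exact_unsupported)
  next
    case False
    hence "0 \<le> weight exact k m" if "m \<in> moves k" for m
      unfolding weight_def using less that children_csize[of k m]
      by (intro mult_nonneg_nonneg coef_nonneg prod_list_nonneg) auto
    thus ?thesis using False by (simp add: exact_sum sum_nonneg)
  qed
qed

lemma weight_nonneg: "(\<And>k. 0 \<le> Y k) \<Longrightarrow> 0 \<le> weight Y k m"
  unfolding weight_def by (intro mult_nonneg_nonneg coef_nonneg prod_list_nonneg) auto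

section \<open>Lower bounds for nonzero exact values\<close>

lemma powi4: "(4::real) powi n = 2 powi (2 * n)"
  by (simp add: power_int_mult)

text \<open>The scaling attaches a factor 1/4 to each letter. In a cut or a split the band-1 values
  left at the exposure are counted in the sizes of both children; the coefficient
  \<open>4 powi (int t - 1)\<close> makes up for that.\<close>

lemma coef_csize:
  assumes "supported k" "m \<in> moves k" "coef k m \<noteq> 0"
  shows "4 powi (- int (csize k)) \<le> coef k m * 4 powi (- int (sum_list (map csize (children k m))))"
proof -
  have q: "4 powi (- int n) \<le> (1/4) * (4::real) powi (- int n')" if "n' + 1 \<le> n" for n n'
  proof -
    have "4 powi (- int n) \<le> (4::real) powi (-1 + - int n')" using that by (intro power_int_increasing) auto
    also have "\<dots> = (1/4) * 4 powi (- int n')" by (subst power_int_add) (auto simp: power_int_minus)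
    finally show ?thesis .
  qed
  have p: "4 powi (- int n) \<le> 4 powi (int t - 1) * (4::real) powi (- int n')" if "n' + 1 \<le> n + t" for n n' t
  proof -
    have "4 powi (- int n) \<le> (4::real) powi ((int t - 1) + - int n')" using that by (intro power_int_increasing) auto
    thus ?thesis by (subst (asm) power_int_add) auto
  qed
  let ?S = "sum_list (map csize (children k m))"
  have "(coef k m = 1/4 \<and> ?S + 1 \<le> csize k) \<or> (\<exists>t. coef k m = 4 powi (int t - 1) \<and> ?S + 1 \<le> csize k + t)
      \<or> (children k m = [] \<and> coef k m = 4 powi (- int (csize k)))"
  proof (cases k)
    case (Free p' q')
    thus ?thesis using assms(2) unfolding Free moves_Free
      by (auto simp: cut_indices_def dest!: in_support_le split: if_splits)
  next
    case (Exposing l a q' t)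
    hence l: "1 \<le> l \<and> t \<le> a + q'" using assms by (auto dest: in_support_le)
    show ?thesis
    proof (cases m)
      case Read_Only
      thus ?thesis using assms(2,3) unfolding Exposing moves_Exposing powi4
        by (auto split: if_splits)
    qed (use assms(2) l in \<open>auto simp: Exposing moves_Exposing split_indices_def dest!: in_support_le split: if_splits\<close>)
  qed
  thus ?thesis 
  proof (elim disjE exE conjE)
    fix t assume 1: "coef k m = 4 powi (int t - 1)" "?S + 1 \<le> csize k + t"
    show ?thesis unfolding 1(1) by (rule p[OF 1(2)])
  next
    assume 1: "coef k m = 1/4" "?S + 1 \<le> csize k"
    show ?thesis unfolding 1(1) by (rule q[OF 1(2)])
  qed simp
qed

lemma prod_list_powi: 
  assumes "\<And>c. c \<in> set cs \<Longrightarrow> 4 powi (- int (f c)) \<le> (Y c :: real)"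
  shows "4 powi (- int (sum_list (map f cs))) \<le> prod_list (map Y cs)"
  using assms
proof (induction cs)
  case (Cons c cs)
  have "4 powi (- int (f c)) * 4 powi (- int (sum_list (map f cs))) \<le> Y c * prod_list (map Y cs)"
    using Cons by (intro mult_mono) (auto intro: order.trans[OF zero_le_power_int[of 4 "- int (f c)"]])
  thus ?case by (simp add: power_int_diff power_int_minus divide_simps power_int_add)
qed simp

lemma weight_exact_lower:
  assumes "supported k" "m \<in> moves k" "weight exact k m \<noteq> 0"
    and "\<And>c. csize c < csize k \<Longrightarrow> exact c = 0 \<or> 4 powi (- int (csize c)) \<le> exact c"
  shows "4 powi (- int (csize k)) \<le> weight exact k m"
proof -
  have normal0: "coef k m \<noteq> 0" "c \<in> set (children k m) \<Longrightarrow> exact c \<noteq> 0" for c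
    using assms(3) by (auto simp: weight_def prod_list_zero_iff)
  have "4 powi (- int (csize k)) \<le> coef k m * 4 powi (- int (sum_list (map csize (children k m))))"
    using assms normal0 by (intro coef_csize)
  also have "\<dots> \<le> weight exact k m" unfolding weight_def
    using assms normal0 children_csize[OF assms(1,2)] by (intro mult_left_mono prod_list_powi coef_nonneg) metis
  finally show ?thesis .
qed

lemma finite_cut: "finite (cut_indices p q)"
proof (rule finite_subset)
  show "cut_indices p q \<subseteq> {..q} \<times> {..p} \<times> {..p + q}"
    by (auto simp: cut_indices_def dest: in_support_le)
qed auto

lemma finite_split: "finite (split_indices l a q t)"
proof (rule finite_subset)
  show "split_indices l a q t \<subseteq> {..l} \<times> {..l} \<times> {..a} \<times> {..a} \<times> {..a + q}"
    by (auto simp: split_indices_def dest: in_support_le)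
qed auto

lemma finite_moves: "finite (moves k)"
  by (cases k) (auto simp: moves_Free moves_Exposing finite_cut finite_split)

text \<open>In unscaled form this says that a nonzero entry is at least 1. Up to size 300, nonzero
  entries are thus at least \<open>2 powi (-600)\<close>.\<close>

lemma exact_lower: "exact k = 0 \<or> 4 powi (- int (csize k)) \<le> exact k"
proof (induction k rule: measure_induct_rule[of csize])
  case (less k)
  show ?case
  proof (cases "k = Free 0 0 \<or> \<not> supported k")
    case True thus ?thesis by (auto simp: exact_Free_0 exact_unsupported)
  next
    case False
    hence k: "exact k = (\<Sum>m\<in>moves k. weight exact k m)" "supported k" by (auto simp: exact_sum)
    show ?thesis
    proof (cases "\<exists>m\<in>moves k. weight exact k m \<noteq> 0")
      case True
      then obtain m where m: "m \<in> moves k" "weight exact k m \<noteq> 0" by blast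
      have "4 powi (- int (csize k)) \<le> weight exact k m"
        using weight_exact_lower[OF k(2) m less] .
      also have "\<dots> \<le> exact k" unfolding k using m(1) finite_moves weight_nonneg[of exact k] exact_nonneg
        by (intro member_le_sum) auto
      finally show ?thesis by simp
    qed (use k in auto)
  qed
qed

lemma sum_moves_Free:
  "(\<Sum>m\<in>moves (Free p q). f m) = (\<Sum>h<p. f (Read_Band0 h)) + (if q \<ge> 1 then f Read_Greatest_Band1 else 0)
     + (\<Sum>(h, c, t)\<in>cut_indices p q. f (Cut_Band1 h c t) :: real)"
proof -
  have "sum f (moves (Free p q)) = sum f (Read_Band0 ` {..<p}) + sum f (if q \<ge> 1 then {Read_Greatest_Band1} else {})
     + sum f ((\<lambda>(h, c, t). Cut_Band1 h c t) ` cut_indices p q)"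
    (is "_ = sum f ?A + sum f ?B + sum f ?C")
  proof -
    have "sum f (?A \<union> ?B \<union> ?C) = sum f (?A \<union> ?B) + sum f ?C"
      by (rule sum.union_disjoint) (auto simp: finite_cut)
    moreover have "sum f (?A \<union> ?B) = sum f ?A + sum f ?B"
      by (rule sum.union_disjoint) auto
    ultimately show ?thesis unfolding moves_Free by simp
  qed
  also have "sum f (Read_Band0 ` {..<p}) = (\<Sum>h<p. f (Read_Band0 h))"
    by (subst sum.reindex) (auto simp: inj_on_def)
  also have "sum f ((\<lambda>(h, c, t). Cut_Band1 h c t) ` cut_indices p q) = (\<Sum>(h, c, t)\<in>cut_indices p q. f (Cut_Band1 h c t))"
    by (subst sum.reindex) (auto simp: inj_on_def case_prod_unfold)
  finally show ?thesis by simp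
qed

lemma sum_moves_Exposing:
  "(\<Sum>m\<in>moves (Exposing l a q t). f m) = (\<Sum>h<a. f (Read_Band0 h)) + (\<Sum>r<q. f (Join_Band1 r))
     + (if l = 1 then f Read_Only else 0) + (if l \<ge> 2 then f Read_Least + f Read_Greatest else 0)
     + (\<Sum>(l1, l2, a1, a2, m)\<in>split_indices l a q t. f (Split_Head l1 l2 a1 a2 m) :: real)"
proof -
  have "sum f (moves (Exposing l a q t)) = sum f (Read_Band0 ` {..<a}) + sum f (Join_Band1 ` {..<q})
     + sum f (if l = 1 then {Read_Only} else {}) + sum f (if l \<ge> 2 then {Read_Least, Read_Greatest} else {})
     + sum f ((\<lambda>(l1, l2, a1, a2, m). Split_Head l1 l2 a1 a2 m) ` split_indices l a q t)"
    (is "_ = sum f ?A + sum f ?B + sum f ?C + sum f ?D + sum f ?E")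
  proof -
    have "sum f (?A \<union> ?B \<union> ?C \<union> ?D \<union> ?E) = sum f (?A \<union> ?B \<union> ?C \<union> ?D) + sum f ?E"
      by (rule sum.union_disjoint) (auto simp: finite_split)
    moreover have "sum f (?A \<union> ?B \<union> ?C \<union> ?D) = sum f (?A \<union> ?B \<union> ?C) + sum f ?D"
      by (rule sum.union_disjoint) auto
    moreover have "sum f (?A \<union> ?B \<union> ?C) = sum f (?A \<union> ?B) + sum f ?C"
      by (rule sum.union_disjoint) auto
    moreover have "sum f (?A \<union> ?B) = sum f ?A + sum f ?B"
      by (rule sum.union_disjoint) auto
    ultimately show ?thesis unfolding moves_Exposing by (simp only:)
  qed
  also have "sum f (Read_Band0 ` {..<a}) = (\<Sum>h<a. f (Read_Band0 h))"
    by (subst sum.reindex) (auto simp: inj_on_def)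
  also have "sum f (Join_Band1 ` {..<q}) = (\<Sum>h<q. f (Join_Band1 h))"
    by (subst sum.reindex) (auto simp: inj_on_def)
  also have "sum f ((\<lambda>(l1, l2, a1, a2, m). Split_Head l1 l2 a1 a2 m) ` split_indices l a q t)
     = (\<Sum>(l1, l2, a1, a2, m)\<in>split_indices l a q t. f (Split_Head l1 l2 a1 a2 m))"
    by (subst sum.reindex) (auto simp: inj_on_def case_prod_unfold)
  finally show ?thesis by simp
qed

section \<open>Numbers of summands\<close>

lemma am_gm_3:
  fixes a b c :: real assumes "0 \<le> a" "0 \<le> b" "0 \<le> c"
  shows "27 * (a * b * c) \<le> (a + b + c) ^ 3"
proof -
  have "2 * ((a + b + c) ^ 3 - 27 * (a * b * c)) = (a + b + c) * ((a - b)^2 + (b - c)^2 + (c - a)^2)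
      + 6 * (a * (b - c)^2 + b * (c - a)^2 + c * (a - b)^2)"
    by (simp add: power2_eq_square power3_eq_cube algebra_simps)
  also have "\<dots> \<ge> 0" using assms by (intro add_nonneg_nonneg mult_nonneg_nonneg) auto
  finally show ?thesis by simp
qed

text \<open>A split is determined by \<open>l1\<close>, \<open>a1\<close> and \<open>m\<close>,
  which leaves at most \<open>(l - 2) * (a + 1) * (2 * q + a + 2) / 2\<close> choices. With
  \<open>l - 2\<close> doubled, the three factors add up to
  \<open>2 * (l + a + q) - 1 \<le> 599\<close>, so the AM-GM inequality gives at most
  \<open>599 ^ 3 / 108\<close>, which is below 1990017.\<close>

lemma card_split_indices:
  assumes "l + a + q \<le> 300" shows "card (split_indices l a q t) \<le> 2000000"
proof (cases "l \<ge> 3")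
  case False
  hence "split_indices l a q t = {}" by (auto simp: split_indices_def)
  thus ?thesis by simp
next
  case True
  have "card (split_indices l a q t) \<le> card ({1..l - 2} \<times> (SIGMA a1:{..a}. {..a1 + q}))"
  proof (rule card_inj_on_le[where f = "\<lambda>(l1, l2, a1, a2, m). (l1, a1, m)"])
    show "inj_on (\<lambda>(l1, l2, a1, a2, m). (l1, a1, m)) (split_indices l a q t)"
      by (auto simp: inj_on_def split_indices_def)
    show "(\<lambda>(l1, l2, a1, a2, m). (l1, a1, m)) ` split_indices l a q t \<subseteq> {1..l - 2} \<times> (SIGMA a1:{..a}. {..a1 + q})"
      by (auto simp: split_indices_def dest: in_support_le)
  qed auto
  also have "\<dots> = (l - 2) * (\<Sum>a1\<le>a. a1 + q + 1)" by (simp add: card_cartesian_product)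
  finally have 1: "card (split_indices l a q t) \<le> (l - 2) * (\<Sum>a1\<le>a. a1 + q + 1)" .
  have "2 * (\<Sum>a1\<le>a. a1 + q + 1) = (a + 1) * (2 * q + a + 2)"
    by (induction a) (auto simp: algebra_simps)
  with 1 have "2 * card (split_indices l a q t) \<le> (l - 2) * ((a + 1) * (2 * q + a + 2))"
    using mult_le_mono2[OF 1, of 2] by (simp only: mult.left_commute[of 2])
  hence "real (2 * card (split_indices l a q t)) \<le> real ((l - 2) * ((a + 1) * (2 * q + a + 2)))"
    by (rule of_nat_mono)
  also have "\<dots> = (real l - 2) * ((real a + 1) * (2 * real q + real a + 2))" 
  proof -
    have "real (l - 2) = real l - 2" using True by simp
    thus ?thesis by (simp only: of_nat_mult of_nat_add of_nat_numeral of_nat_1)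
  qed
  also have "54 * \<dots> = 27 * ((2 * real l - 4) * (real a + 1) * (2 * real q + real a + 2))" by (simp add: algebra_simps)
  also have "\<dots> \<le> (2 * real l - 4 + (real a + 1) + (2 * real q + real a + 2)) ^ 3"
    using True by (intro am_gm_3) auto
  also have "\<dots> \<le> 599 ^ 3" using assms True by (intro power_mono) auto
  finally show ?thesis by simp
qed

lemma pairs_bound:
  fixes p q :: nat
  assumes "p + q \<le> 300" shows "(q - 1) * (p + 1) \<le> 22500"
proof -
  have x: "x * y \<le> 22500" if "x + y \<le> 300" "0 \<le> x + y" for x y :: real
  proof -
    have "4 * (x * y) \<le> (x + y)\<^sup>2" using zero_le_power2[of "x - y"] by (simp add: power2_eq_square algebra_simps)
    also have "\<dots> \<le> 300\<^sup>2" using that by (intro power_mono)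
    finally show ?thesis by simp
  qed
  show ?thesis
  proof (cases "q = 0")
    case False
    hence "real (q - 1) * real (p + 1) \<le> 22500" using assms by (intro x) auto
    hence "real ((q - 1) * (p + 1)) \<le> real 22500" unfolding of_nat_mult by simp
    thus ?thesis by (simp only: of_nat_le_iff)
  qed simp
qed

text \<open>As \<open>t\<close> ranges up to \<open>p - c + h\<close>, the substitution of
  \<open>p - c\<close> for \<open>c\<close> gives a sum with the closed form
  \<open>(q - 1) * (p + 1) * (p + q) / 2\<close>, at most \<open>150 ^ 2 * 300 / 2\<close>.\<close>

lemma card_cut_indices:
  assumes "p + q \<le> 300" shows "card (cut_indices p q) \<le> 3375000"
proof (cases "q \<ge> 1")
  case False
  hence "cut_indices p q = {}" by (auto simp: cut_indices_def)
  thus ?thesis by simp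
next
  case True
  have "card (cut_indices p q) \<le> card (SIGMA h:{..<q - 1}. SIGMA c:{..p}. {..c + h})"
  proof (rule card_inj_on_le[where f = "\<lambda>(h, c, t). (h, p - c, t)"])
    show "inj_on (\<lambda>(h, c, t). (h, p - c, t)) (cut_indices p q)"
      by (auto simp: inj_on_def cut_indices_def)
    show "(\<lambda>(h, c, t). (h, p - c, t)) ` cut_indices p q \<subseteq> (SIGMA h:{..<q - 1}. SIGMA c:{..p}. {..c + h})"
      by (auto simp: cut_indices_def dest: in_support_le)
  qed auto
  also have "\<dots> = (\<Sum>h<q - 1. \<Sum>c\<le>p. c + h + 1)" by (simp add: card_SigmaI)
  also have "2 * \<dots> = (q - 1) * ((p + 1) * (p + q))"
  proof -
    have i: "2 * (\<Sum>c\<le>p. c + h + 1) = (p + 1) * (p + 2 * h + 2)" for h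
      by (induction p) (auto simp: algebra_simps)
    have "2 * (\<Sum>h<n. \<Sum>c\<le>p. c + h + 1) = n * ((p + 1) * (p + (n + 1)))" for n
    proof (induction n)
      case (Suc n)
      show ?case unfolding sum.lessThan_Suc distrib_left Suc i by (simp add: algebra_simps)
    qed simp
    from this[of "q - 1"] show ?thesis using True by simp
  qed
  finally have "2 * card (cut_indices p q) \<le> (q - 1) * ((p + 1) * (p + q))" by simp
  also have "\<dots> = ((q - 1) * (p + 1)) * (p + q)" by (simp only: mult.assoc)
  also have "\<dots> \<le> 22500 * 300"
  proof (intro mult_mono)
    show "(q - 1) * (p + 1) \<le> 22500" using pairs_bound[OF assms] .
  qed (use assms in auto)
  finally show ?thesis by simp
qed

section \<open>Accuracy of the stored tables\<close>

fun real_val :: "binary64 \<Rightarrow> real" where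
  "real_val (Num a) = real_of_ereal a"
| "real_val NaN = 0"

fun summand_value :: "summand \<Rightarrow> real" where
  "summand_value (Scaled d r) = d * real_val r"
| "summand_value (Product k r s) = 4 powi (int k - 1) * real_val r * real_val s"

definition safe_real :: "real \<Rightarrow> bool" where
  "safe_real y \<longleftrightarrow> y = 0 \<or> 2 powi (-600) \<le> y \<and> y \<le> 2 ^ 515"

text \<open>An intermediate threshold: far enough below \<open>2 powi (-600)\<close> for a scaling
  by 1/4 or an accumulated error factor 1/2, and far enough above \<open>2 powi (-1000)\<close> for
  the errors in forming a product.\<close>

definition normal0_610 :: "real \<Rightarrow> bool" where
  "normal0_610 y \<longleftrightarrow> y = 0 \<or> 2 powi (-610) \<le> y"

fun valid_control :: "control \<Rightarrow> bool" where
  "valid_control (Free p q) = (p + q \<le> 300)"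
| "valid_control (Exposing l a q t) = (1 \<le> l \<and> l + a + q \<le> 300)"

lemma powi2_pos: "0 < (2::real) powi n" by simp

lemma in_safe_rangeD:
  assumes "in_safe_range v" shows "v = num (real_val v) \<and> safe_real (real_val v)"
proof (cases "v = num 0")
  case False
  hence f: "fle (num (2 powi (- 600))) v" "fle v (num (2 ^ 515))" using assms by (auto simp: in_safe_range_def)
  then obtain a where v: "v = Num a" by (cases v) auto
  with f have a: "ereal (2 powi (- 600)) \<le> a" "a \<le> ereal (2 ^ 515)" by (auto simp del: ereal_less_eq)
  then obtain r where "a = ereal r" by (cases a) auto
  with a v show ?thesis by (simp add: safe_real_def)
qed (simp add: safe_real_def)

lemma safe_real_nonneg: "safe_real y \<Longrightarrow> 0 \<le> y"
  by (auto simp: safe_real_def intro: order.trans[OF less_imp_le[OF powi2_pos[of "-600"]]])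

lemma normal0_610_normal0: "normal0_610 y \<Longrightarrow> normal0 y"
  by (auto simp: normal0_610_def normal0_def intro: order.trans[OF powi2_mono])

lemma scale_safe_normal0:
  assumes "safe_real y" "-2 \<le> j" shows "normal0_610 (2 powi j * y)"
proof (cases "y = 0")
  case False
  hence y: "2 powi (-600) \<le> y" using assms(1) unfolding safe_real_def by blast
  have "2 powi (-610) \<le> (2::real) powi (j + -600)" by (rule powi2_mono) (use assms in simp)
  also have "\<dots> = 2 powi j * 2 powi (-600)" by (rule power_int_add) simp
  also have "\<dots> \<le> 2 powi j * y" using y by (rule mult_left_mono) simp
  finally show ?thesis unfolding normal0_610_def by blast
qed (simp add: normal0_610_def)

text \<open>The exponent 400 exceeds every target that occurs, and \<open>2 ^ (400 + 515)\<close> is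
  still far from overflow.\<close>

lemma scale_safe:
  assumes "safe_real y" "-2 \<le> j" "j \<le> 400"
  shows "num (2 powi j) \<otimes> num y = num (rnd (2 powi j * y)) \<and> rel 1 (2 powi j * y) (rnd (2 powi j * y))"
proof -
  have n: "normal0 (2 powi j * y)" using scale_safe_normal0 assms normal0_610_normal0 by blast
  have "y \<le> 2 ^ 515" using assms(1) by (auto simp: safe_real_def)
  moreover have "(2::real) powi j \<le> 2 powi 400" using assms by (intro powi2_mono)
  ultimately have "2 powi j * y \<le> 2 powi 400 * 2 ^ 515"
    using safe_real_nonneg[OF assms(1)] by (intro mult_mono) auto
  also have "\<dots> \<le> 2 ^ 1000" by simp
  finally show ?thesis using round64_finite[OF n] rel_rnd[OF n] by (simp add: num_mult del: fmul.simps)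
qed

lemma rel_normal0_610: assumes "rel k x y" "normal0_610 x" "k \<le> 2 ^ 52" shows "normal0 y"
proof (cases "x = 0")
  case False
  have "2 powi (-1000) \<le> 2 powi (-610) * (1/2 :: real)" by simp
  also have "\<dots> \<le> x * (1 - uu) ^ k"
    using assms False uu_pow_half[OF assms(3)] by (intro mult_mono) (auto simp: normal0_610_def rel_def)
  also have "\<dots> \<le> y" using assms by (simp add: rel_def)
  finally show ?thesis by (simp add: normal0_def)
qed (use assms in auto)

lemma pair_fin_Scaled:
  assumes "safe_real y" "d = 2 powi j" "-2 \<le> j" "fg \<in> factorings (Scaled d (num y))"
  shows "pair_fin 2 (d * y) fg"
  using assms scale_safe_normal0[OF assms(1,3)] normal0_610_normal0 rel_refl[of "d * y" 2] safe_real_nonneg[OF assms(1)]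
  by (auto simp: pair_fin_def)

text \<open>Each scaling of a factor is charged with one rounding, hence the exponent 2. The product
  of two safe values may be tiny, so the lower bound on \<open>e\<close> is an assumption, to be
  supplied by the exact weights.\<close>

lemma pair_fin_Product:
  assumes y: "safe_real y1" "safe_real y2" and k: "k \<le> 400"
    and e: "e = 4 powi (int k - 1) * y1 * y2" "normal0_610 e"
    and fg: "fg \<in> factorings (Product k (num y1) (num y2))"
  shows "pair_fin 2 e fg"
proof -
  define j where "j = int k - 1"
  have j: "-2 \<le> j" "j \<le> 400" "-2 \<le> 2 * j" using k by (auto simp: j_def)
  from fg[unfolded factorings.simps j_def[symmetric]] consider
     "fg = (num (2 powi j) \<otimes> num y1, num (2 powi j) \<otimes> num y2)"
   | f where "fg = (f, num y2)" "f = num (4 powi j) \<otimes> num y1" "fle f (num (10 ^ 300))" by auto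
  thus ?thesis
  proof cases
    case 1
    have "rel (1 + 1) ((2 powi j * y1) * (2 powi j * y2)) (rnd (2 powi j * y1) * rnd (2 powi j * y2))"
      using scale_safe[OF y(1) j(1,2)] scale_safe[OF y(2) j(1,2)] by (intro rel_mult) auto
    moreover have "(2 powi j * y1) * (2 powi j * y2) = e"
    proof -
      have "(4::real) powi j = 2 powi j * 2 powi j" using power_int_mult_distrib[of "2::real" 2 j] by simp
      thus ?thesis unfolding e(1) j_def[symmetric] by (simp only: mult_ac)
    qed
    ultimately have r: "rel 2 e (rnd (2 powi j * y1) * rnd (2 powi j * y2))" by (simp add: numeral_2_eq_2)
    show ?thesis unfolding pair_fin_def 1
      using scale_safe[OF y(1) j(1,2)] scale_safe[OF y(2) j(1,2)] r rel_normal0_610[OF r e(2)] by auto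
  next
    case 2
    have n: "normal0 (4 powi j * y1)" using scale_safe_normal0[OF y(1) j(3)] normal0_610_normal0 by (simp add: powi4)
    \<comment> \<open>The test against \<open>10 ^ 300\<close> fails for an infinite factor, so this
      way of forming the product is admissible only without overflow.\<close>
    from round64_cases[OF n] have f: "f = num (rnd (4 powi j * y1))"
      using 2(2,3) unfolding num_mult by auto
    have "rel (1 + 0) ((4 powi j * y1) * y2) (rnd (4 powi j * y1) * y2)"
      using rel_rnd[OF n] rel_refl[OF safe_real_nonneg[OF y(2)]] by (rule rel_mult)
    hence r: "rel 2 e (rnd (4 powi j * y1) * y2)"
      by (intro rel_mono[of "1 + 0" _ _ 2]) (auto simp: e(1) j_def)
    show ?thesis unfolding pair_fin_def 2(1) f
      using r rel_normal0_610[OF r e(2)] by auto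
  qed
qed

lemma rel_prod_list:
  assumes "\<And>c. c \<in> set cs \<Longrightarrow> rel (k * f c) (X c) (Y c)"
  shows "rel (k * sum_list (map f cs)) (prod_list (map X cs)) (prod_list (map Y cs))"
  using assms by (induction cs) (auto simp: distrib_left intro: rel_mult rel_refl)

lemma valid_child:
  assumes "valid_control k" "supported k" "m \<in> moves k" "c \<in> set (children k m)"
  shows "valid_control c"
proof -
  have "csize c < csize k" using children_csize assms by blast
  thus ?thesis using assms
    by (cases k) (auto simp: moves_Free moves_Exposing cut_indices_def split_indices_def dest!: in_support_le split: if_splits)
qed

definition stored :: "rtable \<Rightarrow> gtable \<Rightarrow> control \<Rightarrow> real" where
  "stored R G k = real_val (stored_value R G k)"

lemma summand_value_move:
  "summand_value (move_value R G k m) = weight (stored R G) k m"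
  by (induction R G k m rule: move_value.induct) (auto simp: weight_def stored_def)

definition candidate_sum :: "rtable \<Rightarrow> gtable \<Rightarrow> control \<Rightarrow> real" where
  "candidate_sum R G k = (\<Sum>m\<in>moves k. weight (stored R G) k m)"

lemma pair_finD: "pair_fin j e fg \<Longrightarrow> pair_ok j e fg" by (simp add: pair_ok_def)

lemma sum_mset_pairs: "(\<Sum>s\<in>#image_mset g (mset_set A). snd s) = (\<Sum>x\<in>A. snd (g x))"
  by (simp add: multiset.map_comp comp_def sum_unfold_sum_mset)

locale stored_tables_300 =
  fixes R :: rtable and G :: gtable
  assumes tables: "stored_tables 300 R G" and safe: "tables_in_safe_range 300 R G"
begin

abbreviation "Y \<equiv> stored R G"

lemma stored_safe:
  assumes "valid_control k"
  shows "stored_value R G k = num (Y k)" "safe_real (Y k)"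
proof -
  have "in_safe_range (stored_value R G k)"
    using assms safe by (cases k) (auto simp: tables_in_safe_range_def)
  from in_safe_rangeD[OF this] show "stored_value R G k = num (Y k)" "safe_real (Y k)"
    by (auto simp: stored_def)
qed

lemma stored_unsupported:
  assumes "valid_control k" "\<not> supported k" shows "Y k = 0"
proof (cases k)
  case (Exposing l a q t)
  hence "R l a q t = num 0" using assms tables unfolding stored_tables_def by auto
  thus ?thesis by (simp add: stored_def Exposing)
qed (use assms in auto)

lemma R_num: "1 \<le> l \<Longrightarrow> l + a + q \<le> 300 \<Longrightarrow> R l a q t = num (Y (Exposing l a q t)) \<and> safe_real (Y (Exposing l a q t))"
  using stored_safe[of "Exposing l a q t"] by simp

lemma G_num: "p + q \<le> 300 \<Longrightarrow> G p q = num (Y (Free p q)) \<and> safe_real (Y (Free p q))"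
  using stored_safe[of "Free p q"] by simp

text \<open>The safe range alone does not yield the normality assumption \<open>w\<close>; it is
  discharged inside the induction of \<open>stored_rel\<close>.\<close>

lemma pair_fin_move:
  assumes k: "valid_control k" "supported k" and m: "m \<in> moves k"
    and w: "normal0_610 (weight Y k m)" and fg: "fg \<in> factorings (move_value R G k m)"
  shows "pair_fin 2 (weight Y k m) fg"
proof -
  have v: "stored_value R G c = num (Y c) \<and> safe_real (Y c)" if "c \<in> set (children k m)" for c
    using stored_safe[OF valid_child[OF k m that]] by simp
  consider c where "children k m = [c]" "coef k m = 1/4" "move_value R G k m = Scaled (1/4) (stored_value R G c)"
    | t c c' where "children k m = [c, c']" "coef k m = 4 powi (int t - 1)" "t \<le> 400"
        "move_value R G k m = Product t (stored_value R G c) (stored_value R G c')"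
    | d where "children k m = []" "coef k m = d" "move_value R G k m = Scaled 1 (num d)"
  proof (cases k)
    case (Free p q)
    thus ?thesis using m k that unfolding Free moves_Free
      by (auto simp: cut_indices_def dest!: in_support_le split: if_splits)
  next
    case (Exposing l a q t)
    thus ?thesis using m k that unfolding Exposing moves_Exposing
      by (auto simp: split_indices_def dest!: in_support_le split: if_splits)
  qed
  thus ?thesis
  proof cases
    case 1
    hence "fg \<in> factorings (Scaled (1/4) (num (Y c)))" using v fg by simp
    from pair_fin_Scaled[OF _ _ _ this, of "-2"] have "pair_fin 2 (1/4 * Y c) fg" using v 1(1) by simp
    moreover have "weight Y k m = 1/4 * Y c" unfolding weight_def 1(1,2) by simp
    ultimately show ?thesis by (simp only:)
  next
    case (2 t c c')
    have w': "weight Y k m = 4 powi (int t - 1) * Y c * Y c'" using 2 by (simp add: weight_def)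
    show ?thesis using pair_fin_Product[OF _ _ 2(3) w' w, of fg] v 2 fg by auto
  next
    case (3 d)
    hence "fg = (num 1, num d)" "weight Y k m = d" using fg by (auto simp: weight_def)
    thus ?thesis using w normal0_610_normal0[OF w] normal0_nonneg[OF normal0_610_normal0[OF w]] by (auto simp: pair_fin_def intro: rel_refl)
  qed
qed

lemmas pair_ok_move = pair_fin_move[THEN pair_finD]

text \<open>At most 2000000 splits, \<open>a + q\<close> further terms and the term for
  \<open>D\<close> are added up; two roundings in the factors and one in the product come on top.
  The resulting number is rounded up.\<close>

lemma stored_R_approx:
  assumes k: "k = Exposing l a q s" "valid_control k" "supported k"
    and w: "\<And>m. m \<in> moves k \<Longrightarrow> normal0_610 (weight Y k m)"
  shows "rel 2000310 (candidate_sum R G k) (Y k)"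
proof -
  have l: "1 \<le> l" "l + a + q \<le> 300" using k by auto
  have sup: "in_support l a q s" using k by simp
  define A where "A = {h. h < a \<and> in_support l h (a + q - h - 1) s}"
  define B where "B = {r. r < q \<and> in_support (l + q - r - 1) a r s}"
  define g where "g = (\<lambda>s. (s, summand_value s))"
  define N where "N = image_mset g (R_summands R l a q s)"
  have fin: "finite A" "finite B" by (auto simp: A_def B_def)
  have N: "N = image_mset (\<lambda>h. g (Scaled (1/4) (R l h (a + q - h - 1) s))) (mset_set A)
    + image_mset (\<lambda>r. g (Scaled (1/4) (R (l + q - r - 1) a r s))) (mset_set B)
    + {#g (if l = 1 then Scaled 1 (num (if a = 0 \<and> q = s then 2 powi (- 2 * int (1 + a + q)) else 0))
         else Scaled (1/2) (R (l - 1) a q s))#}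
    + image_mset (\<lambda>(l1, l2, a1, a2, m). g (Product m (R l1 a1 q m) (R l2 a2 m s))) (mset_set (split_indices l a q s))"
    unfolding N_def R_summands_def A_def B_def split_indices_def
    by (simp add: multiset.map_comp comp_def case_prod_unfold)
  have "computed_sum (image_mset fst N) (R l a q s)"
    using tables sup l unfolding stored_tables_def N_def g_def by (auto simp: multiset.map_comp comp_def)
  moreover have "pair_ok 2 e fg" if e: "(x, e) \<in># N" "fg \<in> factorings x" for x e fg
  proof -
    have M: "pair_ok 2 e fg" if "m \<in> moves k" "(x, e) = g (move_value R G k m)" for m
      using pair_ok_move[OF k(2,3) that(1) w[OF that(1)], of fg] e(2) that(2) by (simp add: g_def summand_value_move)
    \<comment> \<open>\<open>D\<close> is a single summand with factor 1/2 in the table, whereas the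
      sampler has two candidates for it.\<close>
    have S: "pair_ok 2 (1/2 * Y (Exposing (l - 1) a q s)) fg" if "l \<ge> 2" "x = Scaled (1/2) (R (l - 1) a q s)"
      using pair_finD[OF pair_fin_Scaled[of "Y (Exposing (l - 1) a q s)" "1/2" "-1" fg]] R_num[of "l - 1" a q s] that l e(2) by simp
    from e(1) consider h where "h < a" "(x, e) = g (move_value R G k (Read_Band0 h))"
      | r where "r < q" "(x, e) = g (move_value R G k (Join_Band1 r))"
      | "l = 1" "(x, e) = g (move_value R G k Read_Only)"
      | "l \<ge> 2" "(x, e) = g (Scaled (1/2) (R (l - 1) a q s))"
      | l1 l2 a1 a2 m where "(l1, l2, a1, a2, m) \<in> split_indices l a q s"
          "(x, e) = g (move_value R G k (Split_Head l1 l2 a1 a2 m))"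
      using fin finite_split l(1) unfolding N k(1) by (fastforce simp: A_def B_def split: if_splits)
    thus ?thesis
    proof cases
      case 4
      hence "x = Scaled (1/2) (R (l - 1) a q s)" "e = 1/2 * Y (Exposing (l - 1) a q s)"
        by (auto simp: g_def stored_def)
      with S 4(1) show ?thesis by (simp only:)
    next
      case (5 l1 l2 a1 a2 m)
      hence "Split_Head l1 l2 a1 a2 m \<in> moves k" by (force simp: k(1) moves_Exposing)
      from M[OF this 5(2)] show ?thesis .
    next
      case (1 h)
      hence "Read_Band0 h \<in> moves k" by (auto simp: k(1) moves_Exposing)
      from M[OF this 1(2)] show ?thesis .
    next
      case (2 r)
      hence "Join_Band1 r \<in> moves k" by (auto simp: k(1) moves_Exposing)
      from M[OF this 2(2)] show ?thesis .
    next
      case 3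
      hence "Read_Only \<in> moves k" by (auto simp: k(1) moves_Exposing)
      from M[OF this 3(2)] show ?thesis .
    qed
  qed
  ultimately have ap: "approx_inf (3 + size N) (\<Sum>s\<in>#N. snd s) (R l a q s)"
    by (intro computed_sum_approx[where j = 2]) auto
  have "(\<Sum>s\<in>#N. snd s) = candidate_sum R G k"
  proof -
    \<comment> \<open>The table sums over supported indices only, \<open>moves\<close> over all of
      them; the difference vanishes because unsupported entries are stored as zero.\<close>
    have a: "(\<Sum>h\<in>A. snd (g (Scaled (1/4) (R l h (a + q - h - 1) s)))) = (\<Sum>h<a. weight Y k (Read_Band0 h))"
    proof (rule sum.mono_neutral_cong_left)
      show "\<forall>i\<in>{..<a} - A. weight Y k (Read_Band0 i) = 0"
        using stored_unsupported l by (auto simp: k(1) weight_def A_def)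
    qed (auto simp: A_def g_def k(1) weight_def stored_def)
    have b: "(\<Sum>h\<in>B. snd (g (Scaled (1/4) (R (l + q - h - 1) a h s)))) = (\<Sum>h<q. weight Y k (Join_Band1 h))"
    proof (rule sum.mono_neutral_cong_left)
      have "valid_control (Exposing (l + q - i - 1) a i s)" if "i < q" for i using l that by auto
      hence "Y (Exposing (l + q - i - 1) a i s) = 0" if "i \<in> {..<q} - B" for i
        using stored_unsupported[of "Exposing (l + q - i - 1) a i s"] that by (auto simp: B_def)
      thus "\<forall>i\<in>{..<q} - B. weight Y k (Join_Band1 i) = 0"
        by (auto simp: k(1) weight_def)
    qed (auto simp: B_def g_def k(1) weight_def stored_def)
    have c: "(\<Sum>x\<in>split_indices l a q s. snd (case x of (l1, l2, a1, a2, m) \<Rightarrow> g (Product m (R l1 a1 q m) (R l2 a2 m s))))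
      = (\<Sum>(l1, l2, a1, a2, m)\<in>split_indices l a q s. weight Y k (Split_Head l1 l2 a1 a2 m))"
      by (intro sum.cong) (auto simp: g_def k(1) weight_def stored_def)
    show ?thesis unfolding N candidate_sum_def
      using l(1) a b c
      by (auto simp: sum_mset_pairs k(1) sum_moves_Exposing g_def weight_def stored_def simp del: image_mset_mset_set)
  qed
  moreover have "size N \<le> 2000301"
  proof -
    have "card A \<le> card {..<a}" "card B \<le> card {..<q}" by (intro card_mono; auto simp: A_def B_def)+
    thus ?thesis using card_split_indices[OF l(2), of s] l by (simp add: N)
  qed
  moreover have "R l a q s = num (Y k)" using R_num l k(1) by simp
  ultimately have "approx 2000310 (candidate_sum R G k) (num (Y k))"
    using approx_inf_mono[OF ap, of 2000310] by (simp add: approx_finite)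
  thus ?thesis by (auto simp: approx_def)
qed

lemma pair_ok_mono: "pair_ok i e fg \<Longrightarrow> i \<le> j \<Longrightarrow> pair_ok j e fg"
  unfolding pair_ok_def pair_fin_def by (blast intro: rel_mono)

text \<open>The nesting keeps the error small: there may be 3375000 products, but each passes
  through at most 301 inner and 22801 outer additions. The error 304 of an inner sum becomes the
  error of a summand of the outer one.\<close>

lemma stored_G_approx:
  assumes k: "k = Free p q" "valid_control k" "k \<noteq> Free 0 0"
    and w: "\<And>m. m \<in> moves k \<Longrightarrow> normal0_610 (weight Y k m)"
  shows "rel 24000 (candidate_sum R G k) (Y k)"
proof -
  have pq: "p + q \<le> 300" "0 < p + q" using k by auto
  obtain W where Wi: "\<And>h c. h + 2 \<le> q \<Longrightarrow> c \<le> p \<Longrightarrow> computed_sum (G_inner_summands R G p q h c) (W h c)"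
    and Wo: "computed_sum (G_summands G W p q) (G p q)"
    using tables[unfolded stored_tables_def, THEN conjunct2, THEN conjunct2, rule_format, of p q] pq by auto
  define T where "T = (\<lambda>h c. {t. in_support (q - 1 - h) (p - c) h t})"
  define D where "D = {(h, c). h + 2 \<le> q \<and> c \<le> p}"
  define e where "e = (\<lambda>h c. \<Sum>t\<in>T h c. weight Y k (Cut_Band1 h c t))"
  have T: "finite (T h c) \<and> card (T h c) \<le> 301" if "(h, c) \<in> D" for h c
  proof -
    have s: "T h c \<subseteq> {..300}" using that pq by (auto simp: T_def D_def dest!: in_support_le)
    show ?thesis using finite_subset[OF s] card_mono[OF _ s] by simp
  qed
  have D: "D = {..<q - 1} \<times> {..p}" by (auto simp: D_def)
  have cD: "finite D" "card D \<le> 22500" using pairs_bound[OF pq(1)] by (auto simp: D)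
  have Wa: "approx_inf 304 (e h c) (W h c)" if hc: "(h, c) \<in> D" for h c
  proof -
    define N where "N = image_mset (\<lambda>t. (move_value R G k (Cut_Band1 h c t), weight Y k (Cut_Band1 h c t))) (mset_set (T h c))"
    have "image_mset fst N = G_inner_summands R G p q h c"
      by (simp add: N_def G_inner_summands_def multiset.map_comp comp_def T_def k(1))
    hence "computed_sum (image_mset fst N) (W h c)" using Wi hc by (auto simp: D_def)
    moreover have "pair_ok 2 y fg" if y: "(x, y) \<in># N" "fg \<in> factorings x" for x y fg
    proof -
      from y(1) obtain t where t: "t \<in> T h c" "x = move_value R G k (Cut_Band1 h c t)" "y = weight Y k (Cut_Band1 h c t)"
        using T[OF hc] by (auto simp: N_def)
      have "(h, c, t) \<in> cut_indices p q" using t hc by (auto simp: T_def D_def cut_indices_def)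
      hence "Cut_Band1 h c t \<in> moves k" by (force simp: k(1) moves_Free)
      from pair_ok_move[OF k(2) _ this w[OF this], of fg] show ?thesis using y t k(1) by simp
    qed
    ultimately have "approx_inf (3 + size N) (\<Sum>s\<in>#N. snd s) (W h c)"
      by (intro computed_sum_approx[where j = 2]) auto
    moreover have "(\<Sum>s\<in>#N. snd s) = e h c" by (simp add: N_def sum_mset_pairs e_def del: image_mset_mset_set)
    moreover have "size N \<le> 301" using T[OF hc] by (simp add: N_def)
    ultimately show ?thesis by (auto intro: approx_inf_mono)
  qed
  define N where "N = image_mset (\<lambda>h. (move_value R G k (Read_Band0 h), weight Y k (Read_Band0 h))) (mset_set {..<p})
    + (if q \<ge> 1 then {#(move_value R G k Read_Greatest_Band1, weight Y k Read_Greatest_Band1)#} else {#})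
    + image_mset (\<lambda>(h, c). (Scaled 1 (W h c), e h c)) (mset_set D)"
  have "image_mset fst N = G_summands G W p q"
    unfolding N_def G_summands_def D_def[symmetric]
    by (simp add: multiset.map_comp comp_def case_prod_unfold k(1) lessThan_def)
  hence "computed_sum (image_mset fst N) (G p q)" using Wo by simp
  moreover have "pair_ok 304 y fg" if y: "(x, y) \<in># N" "fg \<in> factorings x" for x y fg
  proof -
    have M: "pair_ok 304 y fg" if m: "m \<in> moves k" "x = move_value R G k m" "y = weight Y k m" for m
      using pair_ok_mono[OF pair_ok_move[OF k(2) _ m(1) w[OF m(1)], of fg]] y m k(1) by simp
    from y(1) consider h where "h < p" "x = move_value R G k (Read_Band0 h)" "y = weight Y k (Read_Band0 h)"
      | "q \<ge> 1" "x = move_value R G k Read_Greatest_Band1" "y = weight Y k Read_Greatest_Band1"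
      | h c where "(h, c) \<in> D" "x = Scaled 1 (W h c)" "y = e h c"
      using cD by (auto simp: N_def split: if_splits)
    thus ?thesis
    proof cases
      case (1 h)
      hence "Read_Band0 h \<in> moves k" by (auto simp: k(1) moves_Free)
      from M[OF this 1(2,3)] show ?thesis .
    next
      case 2
      hence "Read_Greatest_Band1 \<in> moves k" by (auto simp: k(1) moves_Free)
      from M[OF this 2(2,3)] show ?thesis .
    next
      case (3 h c)
      have fg: "fg = (num 1, W h c)" using 3 y by simp
      show ?thesis using Wa[OF 3(1)] unfolding fg 3(3) approx_inf_def
      proof
        assume W: "W h c = Num \<infinity>"
        show "pair_ok 304 (e h c) (num 1, W h c)" unfolding pair_ok_def W by (intro disjI2 exI[of _ 1]) simp
      next
        assume "approx 304 (e h c) (W h c)"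
        thus "pair_ok 304 (e h c) (num 1, W h c)" by (auto simp: approx_def pair_ok_def pair_fin_def)
      qed
    qed
  qed
  ultimately have ap: "approx_inf (305 + size N) (\<Sum>s\<in>#N. snd s) (G p q)"
    by (intro computed_sum_approx[where j = 304]) auto
  have "(\<Sum>s\<in>#N. snd s) = candidate_sum R G k"
  proof -
    have "(\<Sum>x\<in>D. snd (case x of (h, c) \<Rightarrow> (Scaled 1 (W h c), e h c))) = (\<Sum>x\<in>D. \<Sum>t\<in>T (fst x) (snd x). weight Y k (Cut_Band1 (fst x) (snd x) t))"
      by (intro sum.cong) (auto simp: e_def)
    also have "\<dots> = (\<Sum>(x, t)\<in>Sigma D (\<lambda>x. T (fst x) (snd x)). weight Y k (Cut_Band1 (fst x) (snd x) t))"
      using cD T by (intro sum.Sigma) auto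
    also have "\<dots> = (\<Sum>(h, c, t)\<in>cut_indices p q. weight Y k (Cut_Band1 h c t))"
      by (rule sum.reindex_bij_witness[of _ "\<lambda>(h, c, t). ((h, c), t)" "\<lambda>((h, c), t). (h, c, t)"])
        (auto simp: D_def T_def cut_indices_def)
    finally show ?thesis unfolding N_def candidate_sum_def
      by (simp add: sum_mset_pairs k(1) sum_moves_Free del: image_mset_mset_set)
  qed
  moreover have "size N \<le> 22801" using cD pq by (simp add: N_def)
  moreover have "G p q = num (Y k)" using G_num pq k(1) by simp
  ultimately have "approx 24000 (candidate_sum R G k) (num (Y k))"
    using approx_inf_mono[OF ap, of 24000] by (simp add: approx_finite)
  thus ?thesis by (auto simp: approx_def)
qed

text \<open>The unread letters of the children of a move add up to one less than those of the state, whereas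
  their sizes may add up to more; so the error is measured by the former.\<close>

lemma weight_rel_if:
  assumes k: "valid_control k" "supported k" "m \<in> moves k"
    and IH: "\<And>c. csize c < csize k \<Longrightarrow> valid_control c \<Longrightarrow> rel (\<nu> * unread_letters c) (exact c) (Y c)"
  shows "rel (\<nu> * (unread_letters k - 1)) (weight exact k m) (weight Y k m)"
proof -
  have "rel (\<nu> * unread_letters c) (exact c) (Y c)" if "c \<in> set (children k m)" for c
    using IH valid_child[OF k that] children_csize[OF k(2,3) that] by simp
  hence "rel (\<nu> * sum_list (map unread_letters (children k m))) (weight exact k m) (weight Y k m)"
    unfolding weight_def by (intro rel_scale rel_prod_list coef_nonneg) auto
  thus ?thesis by (rule rel_mono) (use children_unread[OF k(2,3)] in \<open>auto intro: mult_le_mono2\<close>)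
qed

lemma unread_le: "valid_control k \<Longrightarrow> unread_letters k \<le> 300"
  by (cases k) auto

text \<open>A nonzero exact weight is at least \<open>2 powi (-600)\<close>, and an error exponent
  of at most \<open>\<nu> * 300 \<le> 2 ^ 52\<close> halves it at worst.\<close>

lemma weight_normal0_610:
  assumes k: "valid_control k" "supported k" "m \<in> moves k"
    and r: "rel (\<nu> * (unread_letters k - 1)) (weight exact k m) (weight Y k m)"
  shows "normal0_610 (weight Y k m)"
proof (cases "weight exact k m = 0")
  case True thus ?thesis using r by (simp add: normal0_610_def)
next
  case False
  have "csize k \<le> 300" using k(1) by (cases k) auto
  have n: "\<nu> * (unread_letters k - 1) \<le> 2 ^ 52"
  proof -
    have "\<nu> * (unread_letters k - 1) \<le> \<nu> * 300" using unread_le[OF k(1)] by (intro mult_le_mono2) simp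
    also have "\<dots> \<le> 2 ^ 52" by (simp add: \<nu>_def)
    finally show ?thesis .
  qed
  have "2 powi (-610) \<le> (2 powi (-600)) * (1/2 :: real)" by simp
  also have "\<dots> \<le> 4 powi (- int (csize k)) * (1/2)"
  proof (intro mult_right_mono)
    show "(2::real) powi (-600) \<le> 4 powi (- int (csize k))" unfolding powi4
      by (rule powi2_mono) (use \<open>csize k \<le> 300\<close> in simp)
  qed simp
  also have "\<dots> \<le> weight exact k m * (1 - uu) ^ (\<nu> * (unread_letters k - 1))"
    using weight_exact_lower[OF k(2,3) False exact_lower] uu_pow_half[OF n] weight_nonneg[of exact k m] exact_nonneg
    by (intro mult_mono) auto
  also have "\<dots> \<le> weight Y k m" using r by (simp add: rel_def)
  finally show ?thesis unfolding normal0_610_def by blast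
qed

text \<open>The rounding analysis of an entry needs its summands to be normal, and this follows from
  the accuracy of the smaller entries; hence one induction on \<open>csize\<close> for both.\<close>

lemma stored_rel: "valid_control k \<Longrightarrow> rel (\<nu> * unread_letters k) (exact k) (Y k)"
proof (induction k rule: measure_induct_rule[of csize])
  case (less k)
  consider "\<not> supported k" | "k = Free 0 0" | "supported k" "k \<noteq> Free 0 0" by blast
  thus ?case
  proof cases
    case 1
    thus ?thesis using stored_unsupported[OF less.prems] exact_unsupported by simp
  next
    case 2
    have "G 0 0 = num 1" using tables by (simp add: stored_tables_def)
    thus ?thesis using 2 by (simp add: exact_Free_0 stored_def rel_refl)
  next
    case 3
    have w: "rel (\<nu> * (unread_letters k - 1)) (weight exact k m) (weight Y k m)" if "m \<in> moves k" for m
      using weight_rel_if[OF less.prems 3(1) that less.IH] .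
    have z: "normal0_610 (weight Y k m)" if "m \<in> moves k" for m
      using weight_normal0_610[OF less.prems 3(1) that w[OF that]] .
    have "rel (\<nu> * (unread_letters k - 1)) (exact k) (candidate_sum R G k)"
      unfolding exact_sum[OF 3] candidate_sum_def by (intro rel_sum w)
    moreover have "rel \<nu> (candidate_sum R G k) (Y k)"
    proof (cases k)
      case (Free p q)
      show ?thesis by (rule rel_mono[OF stored_G_approx[OF Free less.prems 3(2) z]]) (auto simp: \<nu>_def)
    next
      case (Exposing l a q s)
      show ?thesis by (rule rel_mono[OF stored_R_approx[OF Exposing less.prems 3(1) z]]) (auto simp: \<nu>_def)
    qed
    ultimately have "rel (\<nu> * (unread_letters k - 1) + \<nu>) (exact k) (Y k)" by (rule rel_trans)
    moreover have "1 \<le> unread_letters k" using 3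
      by (cases k) (auto dest: in_support_le)
    hence "\<nu> * (unread_letters k - 1) + \<nu> = \<nu> * unread_letters k"
      by (metis le_add_diff_inverse2 mult.right_neutral distrib_left)
    ultimately show ?thesis by simp
  qed
qed

lemma weight_rel:
  assumes "valid_control k" "supported k" "m \<in> moves k"
  shows "rel (\<nu> * (unread_letters k - 1)) (weight exact k m) (weight Y k m)" "normal0_610 (weight Y k m)"
proof -
  show r: "rel (\<nu> * (unread_letters k - 1)) (weight exact k m) (weight Y k m)"
    by (rule weight_rel_if[OF assms]) (rule stored_rel)
  show "normal0_610 (weight Y k m)" by (rule weight_normal0_610[OF assms r])
qed

end

section \<open>The scan of the candidates\<close>

text \<open>Expresses the running sums as folds over prefixes, the form in which the error estimates
  are available.\<close>

lemma find_running_sums: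
  assumes "P (x, fold f xs acc, f x (fold f xs acc))"
    and "\<And>us u vs. xs = us @ u # vs \<Longrightarrow> \<not> P (u, fold f us acc, f u (fold f us acc))"
  shows "find P (running_sums f acc (xs @ x # ys)) = Some (x, fold f xs acc, f x (fold f xs acc))"
  using assms
proof (induction xs arbitrary: acc)
  case (Cons z xs)
  have "\<not> P (z, acc, f z acc)" using Cons.prems(2)[of "[]" z xs] by simp
  moreover have "find P (running_sums f (f z acc) (xs @ x # ys)) = Some (x, fold f xs (f z acc), f x (fold f xs (f z acc)))"
  proof (rule Cons.IH)
    show "\<not> P (u, fold f us (f z acc), f u (fold f us (f z acc)))" if "xs = us @ u # vs" for us u vs
      using Cons.prems(2)[of "z # us" u vs] that by simp
  qed (use Cons.prems(1) in simp)
  ultimately show ?case by simp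
qed simp

lemma card_moves: "valid_control k \<Longrightarrow> card (moves k) \<le> (case k of Free p q \<Rightarrow> 3375301 | Exposing l a q t \<Rightarrow> 2000302)"
proof (cases k)
  case (Free p q)
  assume "valid_control k"
  hence pq: "p + q \<le> 300" by (simp add: Free)
  have "card (moves k) \<le> card (Read_Band0 ` {..<p}) + card (if q \<ge> 1 then {Read_Greatest_Band1} else {})
     + card ((\<lambda>(h, c, t). Cut_Band1 h c t) ` cut_indices p q)"
    unfolding Free moves_Free by (intro order.trans[OF card_Un_le] add_mono order.refl)
  also have "\<dots> \<le> p + (if q \<ge> 1 then 1 else 0) + card (cut_indices p q)"
    using card_image_le[of "{..<p}" Read_Band0] card_image_le[OF finite_cut]
    by (intro add_mono) auto
  finally show ?thesis using card_cut_indices[OF pq] pq by (auto simp: Free split: if_splits)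
next
  case (Exposing l a q t)
  assume "valid_control k"
  hence lq: "l + a + q \<le> 300" "1 \<le> l" by (simp_all add: Exposing)
  have "card (moves k) \<le> card (Read_Band0 ` {..<a}) + card (Join_Band1 ` {..<q}) + card (if l = 1 then {Read_Only} else {})
     + card (if l \<ge> 2 then {Read_Least, Read_Greatest} else {})
     + card ((\<lambda>(l1, l2, a1, a2, m). Split_Head l1 l2 a1 a2 m) ` split_indices l a q t)"
    unfolding Exposing moves_Exposing by (intro order.trans[OF card_Un_le] add_mono order.refl)
  also have "\<dots> \<le> a + q + (if l = 1 then 1 else 0) + (if l \<ge> 2 then 2 else 0) + card (split_indices l a q t)"
    using card_image_le[of "{..<a}" Read_Band0] card_image_le[of "{..<q}" Join_Band1] card_image_le[OF finite_split]
    by (intro add_mono) auto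
  finally show ?thesis using card_split_indices[OF lq(1), of t] lq by (auto simp: Exposing split: if_splits)
qed

locale scan_state = stored_tables_300 +
  fixes sc :: scan and k :: control
  assumes scan: "valid_scan R G sc"
    and valid: "valid_control k" and supp: "supported k" and not_final: "k \<noteq> Free 0 0"
    and positive: "0 < exact k"
begin

text \<open>The values of \<open>K0\<close> bound the numbers of summands found above, plus the roundings of a product.\<close>

definition "T = Y k"
definition "F = candidate_sum R G k"
definition "v m = weight Y k m"
definition K0 :: nat where "K0 = (case k of Free p q \<Rightarrow> 24000 | Exposing l a q t \<Rightarrow> 2000310)"

lemma K0_le: "K0 \<le> 2000310" by (simp add: K0_def split: control.splits)

lemma F_T: "rel K0 F T"
proof (cases k)
  case (Free p q)
  have "K0 = 24000" unfolding K0_def by (simp add: Free)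
  with stored_G_approx[OF Free valid not_final weight_rel(2)[OF valid supp]]
  show ?thesis by (simp add: F_def T_def)
next
  case (Exposing l a q t)
  have "K0 = 2000310" unfolding K0_def by (simp add: Exposing)
  with stored_R_approx[OF Exposing valid supp weight_rel(2)[OF valid supp]]
  show ?thesis by (simp add: F_def T_def)
qed

lemma T_bounds: "0 < T" "2 powi (-600) \<le> T" "T \<le> 2 ^ 515"
proof -
  have "T \<noteq> 0" using stored_rel[OF valid] positive by (auto simp: T_def)
  hence T: "2 powi (-600) \<le> T \<and> T \<le> 2 ^ 515" using stored_safe(2)[OF valid] by (simp only: T_def safe_real_def) blast
  thus "2 powi (-600) \<le> T" "T \<le> 2 ^ 515" by auto
  show "0 < T" using T powi2_pos[of "-600"] by linarith
qed

lemma tiny_le_T: "2 powi (-1022) \<le> T"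
  by (rule order.trans[OF powi2_mono T_bounds(2)]) simp

text \<open>Turns the rounding error of any value up to \<open>1.01 * T\<close> into one and the
  same absolute error. The subnormal floor is harmless because \<open>T\<close> is far above
  it.\<close>

lemma max_tiny_le: "z \<le> 101/100 * T \<Longrightarrow> uu * max z (2 powi (-1022)) \<le> uu * (101/100 * T)"
proof (intro mult_left_mono max.boundedI)
  have "T \<le> 101/100 * T" using T_bounds(1) by simp
  thus "2 powi (-1022) \<le> 101/100 * T" using tiny_le_T by (rule order.trans[rotated])
qed (use unit_roundoff_bounds in auto)

lemma F_pos: "0 < F"
  using F_T T_bounds(1) by (metis rel_0_left rel_def order_le_less)

lemma v_nonneg: "m \<in> moves k \<Longrightarrow> 0 \<le> v m"
  using weight_rel(1)[OF valid supp] by (auto simp: v_def rel_def)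

lemma sum_v_le:
  assumes "distinct ms" "set ms \<subseteq> moves k" shows "sum_list (map v ms) \<le> F" "0 \<le> sum_list (map v ms)"
proof -
  have e: "sum_list (map v ms) = sum v (set ms)" using assms(1) by (simp add: sum_list_distinct_conv_sum_set)
  show "sum_list (map v ms) \<le> F" unfolding e F_def candidate_sum_def v_def[symmetric]
    using assms(2) v_nonneg finite_moves by (intro sum_mono2) auto
  show "0 \<le> sum_list (map v ms)" unfolding e using assms(2) v_nonneg by (intro sum_nonneg) auto
qed

lemma uu_pow_small: "j \<le> 20000000 \<Longrightarrow> 1000/1001 \<le> (1 - uu) ^ j"
proof -
  assume "j \<le> 20000000"
  hence "real j * uu \<le> 20000000 * uu" by (intro mult_right_mono) (use unit_roundoff_bounds in auto)
  also have "\<dots> \<le> 1 - 1000/1001" by (simp add: unit_roundoff_def)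
  finally show ?thesis using uu_pow_ge[of j] by linarith
qed

text \<open>Fewer than twenty million roundings lie between \<open>y\<close> and \<open>T\<close>,
  so no computed sum exceeds \<open>T\<close> by more than a thousandth. This makes the absolute
  error of an addition uniform over the scan.\<close>

lemma le_T:
  assumes "rel j x y" "x \<le> F" "j \<le> 10000000" shows "y \<le> 1001/1000 * T"
proof -
  have "y * (1 - uu) ^ j \<le> F" using assms by (auto simp: rel_def)
  hence "y * (1 - uu) ^ j * (1 - uu) ^ K0 \<le> F * (1 - uu) ^ K0" by (intro mult_right_mono) (use one_minus_uu in auto)
  also have "\<dots> \<le> T" using F_T by (simp add: rel_def)
  finally have "y * (1 - uu) ^ (j + K0) \<le> T" by (simp add: power_add mult_ac)
  moreover have "y * (1000/1001) \<le> y * (1 - uu) ^ (j + K0)"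
    using assms K0_le by (intro mult_left_mono uu_pow_small) (auto simp: rel_def)
  ultimately show ?thesis by simp
qed

lemma finite_of_le_T: "normal0 z \<Longrightarrow> z \<le> 1001/1000 * T \<Longrightarrow> round64 (ereal z) = ereal (rnd z)"
proof -
  assume z: "normal0 z" "z \<le> 1001/1000 * T"
  have "1001/1000 * T \<le> 1001/1000 * 2 ^ 515" using T_bounds(3) by simp
  also have "\<dots> \<le> 2 ^ 1000" by simp
  finally have "z \<le> 2 ^ 1000" using z(2) by linarith
  thus ?thesis using round64_finite z(1) by blast
qed

text \<open>Two kinds of error are tracked at once. The relative error bounds the running sum by a
  multiple of \<open>T\<close>; the absolute error, which follows from that bound, controls the
  lengths of the intervals on which moves are chosen.\<close>

lemma rnd_add_step:
  assumes s: "normal0 s" "is_float s" "rel j x s" "j \<le> 9999999" and c: "normal0 c" "rel j e c" "x + e \<le> F"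
  shows "round64 (ereal (s + c)) = ereal (rnd (s + c))" "normal0 (rnd (s + c))" "is_float (rnd (s + c))"
    "rel (Suc j) (x + e) (rnd (s + c))" "s \<le> rnd (s + c)"
    "s + c - uu * (101/100 * T) \<le> rnd (s + c)" "rnd (s + c) \<le> s + c + uu * (101/100 * T)"
proof -
  have n: "normal0 (s + c)" using s c normal0_add by blast
  have r: "rel j (x + e) (s + c)" using s c rel_add by blast
  have b: "s + c \<le> 1001/1000 * T" using le_T[OF r] s c by simp
  show "round64 (ereal (s + c)) = ereal (rnd (s + c))" using finite_of_le_T n b by blast
  show "normal0 (rnd (s + c))" using normal0_rnd n by blast
  show "is_float (rnd (s + c))" using is_float_rnd normal0_nonneg[OF n] by blast
  show "rel (Suc j) (x + e) (rnd (s + c))" using rel_trans[OF r rel_rnd[OF n]] by simp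
  show "s \<le> rnd (s + c)" using normal0_nonneg[OF c(1)] by (intro rnd_ge_float s) auto
  have "s + c \<le> 101/100 * T" using b T_bounds(1) by linarith
  note max_tiny_le[OF this]
  with rnd_error[OF normal0_nonneg[OF n]]
  show "s + c - uu * (101/100 * T) \<le> rnd (s + c)" "rnd (s + c) \<le> s + c + uu * (101/100 * T)" by linarith+
qed

text \<open>Of the three factors \<open>1 - u\<close>, two come from forming the factors of the
  product and one from its own rounding, which a fused operation avoids.\<close>

lemma add_move_step:
  assumes s: "normal0 s" "is_float s" "rel j x s" "3 \<le> j" "j \<le> 9999999" and m: "m \<in> moves k" "x + v m \<le> F"
  shows "\<exists>s'. add_move sc k m (num s) = num s' \<and> normal0 s' \<and> is_float s' \<and> rel (Suc j) (x + v m) s' \<and> s \<le> s' \<and>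
      s + v m * (1 - uu) ^ 3 - uu * (101/100 * T) \<le> s'"
proof -
  have "scan_factors sc k m \<in> factorings (move_value R G k m)" using scan unfolding valid_scan_def by blast
  from pair_fin_move[OF valid supp m(1) weight_rel(2)[OF valid supp m(1)] this]
  obtain a b where ab: "scan_factors sc k m = (num a, num b)" "normal0 (a * b)" "rel 2 (v m) (a * b)"
    by (auto simp: pair_fin_def v_def)
  have v0: "0 \<le> v m" "0 \<le> x" using ab s by (auto simp: rel_def)
  show ?thesis
  proof (cases "scan_fused sc k m")
    case True
    have r: "rel j (v m) (a * b)" using ab(3) by (rule rel_mono) (use s in simp)
    note st = rnd_add_step[OF s(1,2,3,5) ab(2) r m(2)]
    have "v m * (1 - uu) ^ 3 \<le> v m * (1 - uu) ^ 2"
      using v0 one_minus_uu by (intro mult_left_mono power_decreasing) auto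
    also have "\<dots> \<le> a * b" using ab(3) by (simp add: rel_def)
    finally have "s + v m * (1 - uu) ^ 3 - uu * (101/100 * T) \<le> rnd (s + a * b)" using st(6) by linarith
    with st show ?thesis using True
      by (intro exI[of _ "rnd (s + a * b)"]) (simp add: add_move_def add_product_def ab num_fma add.commute del: fma.simps)
  next
    case False
    have "a * b \<le> 1001/1000 * T" using le_T[OF ab(3)] m v0 by simp
    hence f: "num a \<otimes> num b = num (rnd (a * b))" using finite_of_le_T[OF ab(2)] by (simp add: num_mult del: fmul.simps)
    have r3: "rel 3 (v m) (rnd (a * b))" using rel_trans[OF ab(3) rel_rnd[OF ab(2)]] by (simp add: numeral_3_eq_3 numeral_2_eq_2)
    hence r: "rel j (v m) (rnd (a * b))" by (rule rel_mono) (use s in simp)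
    note st = rnd_add_step[OF s(1,2,3,5) normal0_rnd[OF ab(2)] r m(2)]
    have "v m * (1 - uu) ^ 3 \<le> rnd (a * b)" using r3 by (simp add: rel_def)
    hence "s + v m * (1 - uu) ^ 3 - uu * (101/100 * T) \<le> rnd (s + rnd (a * b))" using st(6) by linarith
    with st show ?thesis using False
      by (intro exI[of _ "rnd (s + rnd (a * b))"]) (simp add: add_move_def add_product_def ab f num_add del: fmul.simps fadd.simps)
  qed
qed

section \<open>Running sums within a group\<close>

definition "S ms = real_val (fold (add_move sc k) ms (num 0))"

lemma fold_moves_step:
  assumes "distinct (ms @ [m])" "set (ms @ [m]) \<subseteq> moves k" "length ms \<le> 4000000"
    and "fold (add_move sc k) ms (num 0) = num (S ms)" "normal0 (S ms)" "is_float (S ms)"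
      "rel (3 + length ms) (sum_list (map v ms)) (S ms)"
  shows "fold (add_move sc k) (ms @ [m]) (num 0) = num (S (ms @ [m])) \<and> normal0 (S (ms @ [m])) \<and> is_float (S (ms @ [m])) \<and>
    rel (3 + length (ms @ [m])) (sum_list (map v (ms @ [m]))) (S (ms @ [m])) \<and> S ms \<le> S (ms @ [m]) \<and>
    S ms + v m * (1 - uu) ^ 3 - uu * (101/100 * T) \<le> S (ms @ [m])"
proof -
  have "sum_list (map v ms) + v m \<le> F" using sum_v_le(1)[OF assms(1,2)] by simp
  from add_move_step[OF assms(5,6,7) _ _ _ this] assms(2,3)
  obtain s' where s': "add_move sc k m (num (S ms)) = num s' \<and> normal0 s' \<and> is_float s' \<and>
     rel (Suc (3 + length ms)) (sum_list (map v ms) + v m) s' \<and> S ms \<le> s' \<and>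
      S ms + v m * (1 - uu) ^ 3 - uu * (101/100 * T) \<le> s'" by auto
  hence "S (ms @ [m]) = s'" using assms(4) by (simp add: S_def[of "ms @ [m]"])
  with s' assms(4) show ?thesis by simp
qed

lemma fold_moves:
  assumes "distinct ms" "set ms \<subseteq> moves k" "length ms \<le> 4000000"
  shows "fold (add_move sc k) ms (num 0) = num (S ms) \<and> normal0 (S ms) \<and> is_float (S ms) \<and>
    rel (3 + length ms) (sum_list (map v ms)) (S ms)"
  using assms
proof (induction ms rule: rev_induct)
  case Nil
  show ?case by (simp add: S_def)
next
  case (snoc m ms)
  thus ?case using fold_moves_step[OF snoc.prems(1,2)] by simp
qed

lemma S_step:
  assumes "distinct (ms @ [m])" "set (ms @ [m]) \<subseteq> moves k" "length ms \<le> 4000000"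
  shows "S ms \<le> S (ms @ [m])" "S ms + v m * (1 - uu) ^ 3 - uu * (101/100 * T) \<le> S (ms @ [m])"
  using fold_moves_step[OF assms] fold_moves[of ms] assms by auto

lemma S_mono:
  assumes "distinct (us @ vs)" "set (us @ vs) \<subseteq> moves k" "length (us @ vs) \<le> 4000000"
  shows "S us \<le> S (us @ vs)"
  using assms
proof (induction vs rule: rev_induct)
  case (snoc m vs)
  have "S us \<le> S (us @ vs)" using snoc by simp
  also have "\<dots> \<le> S ((us @ vs) @ [m])" using snoc.prems by (intro S_step) auto
  finally show ?case by simp
qed simp

section \<open>Running sums over the groups\<close>

definition "A gs = real_val (fold (add_group sc k) gs (num 0))"

text \<open>The group lengths are bounded separately from the number of groups, since a value passes
  through at most \<open>ml\<close> additions in its group and \<open>length gs\<close> among the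
  groups. The bounds 4000000 keep the sum of both below the limit in
  \<open>rnd_add_step\<close>.\<close>

definition good_groups :: "nat \<Rightarrow> move list list \<Rightarrow> bool" where
  "good_groups ml gs \<longleftrightarrow> distinct (concat gs) \<and> set (concat gs) \<subseteq> moves k \<and> (\<forall>g\<in>set gs. length g \<le> ml) \<and>
     length gs \<le> 4000000 \<and> ml \<le> 4000000"

lemma fold_groups_step:
  assumes g: "good_groups ml (gs @ [g])"
    and "fold (add_group sc k) gs (num 0) = num (A gs)" "normal0 (A gs)" "is_float (A gs)"
      "rel (3 + ml + length gs) (sum_list (map v (concat gs))) (A gs)"
  shows "fold (add_group sc k) (gs @ [g]) (num 0) = num (A (gs @ [g])) \<and> normal0 (A (gs @ [g])) \<and> is_float (A (gs @ [g])) \<and>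
    rel (3 + ml + length (gs @ [g])) (sum_list (map v (concat (gs @ [g])))) (A (gs @ [g])) \<and> A gs \<le> A (gs @ [g]) \<and>
    A gs + S g - uu * (101/100 * T) \<le> A (gs @ [g]) \<and> A (gs @ [g]) \<le> A gs + S g + uu * (101/100 * T)"
proof -
  have gg: "distinct g" "set g \<subseteq> moves k" "length g \<le> ml" "ml \<le> 4000000" "length gs < 4000000"
    using g by (auto simp: good_groups_def)
  have fg: "fold (add_move sc k) g (num 0) = num (S g)" "normal0 (S g)" "rel (3 + length g) (sum_list (map v g)) (S g)"
    using fold_moves[OF gg(1,2)] gg by auto
  have sm: "sum_list (map v (concat gs)) + sum_list (map v g) \<le> F"
    using sum_v_le(1)[of "concat (gs @ [g])"] g by (simp add: good_groups_def)
  have r: "rel (3 + ml + length gs) (sum_list (map v g)) (S g)" using fg(3) by (rule rel_mono) (use gg in simp)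
  have "3 + ml + length gs \<le> 9999999" using gg by simp
  note st = rnd_add_step[OF assms(3,4,5) this fg(2) r sm]
  have e: "add_group sc k g (num (A gs)) = num (rnd (A gs + S g))"
    using st(1) by (simp add: add_group_def fg num_add del: fadd.simps)
  hence "A (gs @ [g]) = rnd (A gs + S g)" using assms(2) by (simp add: A_def[of "gs @ [g]"])
  thus ?thesis using st e assms(2) by simp
qed

lemma fold_groups:
  assumes "good_groups ml gs"
  shows "fold (add_group sc k) gs (num 0) = num (A gs) \<and> normal0 (A gs) \<and> is_float (A gs) \<and>
    rel (3 + ml + length gs) (sum_list (map v (concat gs))) (A gs)"
  using assms
proof (induction gs rule: rev_induct)
  case Nil
  show ?case by (simp add: A_def)
next
  case (snoc g gs)
  have "good_groups ml gs" using snoc.prems by (auto simp: good_groups_def)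
  thus ?case using fold_groups_step[OF snoc.prems] snoc.IH by simp
qed

lemma A_step:
  assumes "good_groups ml (gs @ [g])"
  shows "A gs \<le> A (gs @ [g])" "A gs + S g - uu * (101/100 * T) \<le> A (gs @ [g])" "A (gs @ [g]) \<le> A gs + S g + uu * (101/100 * T)"
proof -
  have "good_groups ml gs" using assms by (auto simp: good_groups_def)
  from fold_groups_step[OF assms] fold_groups[OF this]
  show "A gs \<le> A (gs @ [g])" "A gs + S g - uu * (101/100 * T) \<le> A (gs @ [g])" "A (gs @ [g]) \<le> A gs + S g + uu * (101/100 * T)"
    by auto
qed

lemma good_groups_prefix: "good_groups ml (us @ vs) \<Longrightarrow> good_groups ml us"
  by (auto simp: good_groups_def)

lemma A_mono: "good_groups ml (us @ vs) \<Longrightarrow> A us \<le> A (us @ vs)"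
proof (induction vs rule: rev_induct)
  case (snoc g vs)
  have "A us \<le> A (us @ vs)" using snoc good_groups_prefix[of ml "us @ vs" "[g]"] by simp
  also have "\<dots> \<le> A ((us @ vs) @ [g])" using snoc.prems by (intro A_step) auto
  finally show ?case by simp
qed simp

subsection \<open>The choice made from the random bits\<close>

text \<open>Each margin consists of two roundings. One is that of \<open>x * T\<close>; the other is
  that of the difference \<open>y - A gs1\<close> or, when the group is found at its upper end, that
  of adding the group sum. Inside the margins the first scan already finds \<open>m\<close>.\<close>

lemma choose_move_if:
  assumes live: "live_groups sc k = gs1 @ g # gs2" and g: "g = ms1 @ m # ms2"
    and good: "good_groups ml (live_groups sc k)"
    and x: "x = 0 \<or> 2 powi (-53) \<le> x" "x < 1"
    and lo: "A gs1 + S ms1 + 2 * (uu * (101/100 * T)) \<le> x * T"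
    and hi: "x * T < A gs1 + S (ms1 @ [m]) - 2 * (uu * (101/100 * T))"
  shows "choose_move sc k (stored_value R G k) x = Some m"
proof -
  define E where "E = uu * (101/100 * T)"
  have T0: "0 < T" "0 < E" using T_bounds(1) unit_roundoff_bounds by (auto simp: E_def)
  have gp: "good_groups ml (gs1 @ [g])" using good live good_groups_prefix[of ml "gs1 @ [g]" gs2] by simp
  note gp1 = good_groups_prefix[OF gp]
  have gg: "distinct g" "set g \<subseteq> moves k" "length g \<le> 4000000" using gp by (auto simp: good_groups_def)
  define y where "y = rnd (x * T)"
  have x0: "0 \<le> x" using x powi2_pos[of "-53"] by linarith
  \<comment> \<open>A nonzero \<open>x\<close> is at least \<open>2 powi (-53)\<close>, so the
    product with \<open>T\<close> cannot underflow.\<close>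
  have nxt: "normal0 (x * T)"
  proof (cases "x = 0")
    case False
    have "2 powi (-1000) \<le> 2 powi (-53) * (2::real) powi (-600)" by simp
    also have "\<dots> \<le> x * T" using x False T_bounds by (intro mult_mono) auto
    finally show ?thesis by (simp only: normal0_def simp_thms)
  qed simp
  have xT: "x * T \<le> T" using x T0 by simp
  have yf: "num x \<otimes> num T = num y"
    using finite_of_le_T[OF nxt] xT T0 by (simp add: num_mult y_def del: fmul.simps)
  have ye: "\<bar>y - x * T\<bar> \<le> E"
  proof -
    have "x * T \<le> 101/100 * T" using xT T0(1) by linarith
    note max_tiny_le[OF this]
    thus ?thesis using rnd_error[OF normal0_nonneg[OF nxt]] unfolding y_def E_def by linarith
  qed
  have A0: "0 \<le> A us" if "good_groups ml us" for us using fold_groups[OF that] normal0_nonneg by blast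
  have S0: "0 \<le> S ms1" using fold_moves[of ms1] gg normal0_nonneg by (auto simp: g)
  have yA: "A gs1 \<le> y" using ye lo S0 T0 unfolding E_def[symmetric] by linarith
  have yA': "y < A (gs1 @ [g])"
  proof -
    have "S (ms1 @ [m]) \<le> S g" using S_mono[of "ms1 @ [m]" ms2] gg by (simp add: g)
    thus ?thesis using A_step(2)[OF gp] ye hi unfolding E_def[symmetric] by linarith
  qed
  define d where "d = rnd (y - A gs1)"
  have uT: "uu * T \<le> E" using T0 unit_roundoff_bounds by (simp add: E_def)
  have uuT: "uu * (101/100 * T) \<le> 1/100 * T" using T0 by (simp add: unit_roundoff_def)
  have yb: "y \<le> 101/100 * T" using ye xT uuT unfolding E_def by linarith
  have "\<bar>d - (y - A gs1)\<bar> \<le> uu * max (y - A gs1) (2 powi (-1022))"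
    unfolding d_def by (rule rnd_error) (use yA in simp)
  also have "\<dots> \<le> uu * (101/100 * T)"
    using yb A0[OF gp1] by (intro max_tiny_le) auto
  finally have de: "\<bar>d - (y - A gs1)\<bar> \<le> E" by (simp add: E_def)
  have df: "num y \<ominus> num (A gs1) = num d"
  proof -
    have "d \<le> 2 * T" using de yb A0[OF gp1] uuT unfolding E_def by linarith
    also have "\<dots> \<le> 2 * 2 ^ 515" using T_bounds by simp
    also have "\<dots> < (2::real) ^ 1024" by simp
    finally have "\<bar>d\<bar> < 2 ^ 1024" using rnd_nonneg[of "y - A gs1"] yA by (simp add: d_def)
    thus ?thesis by (simp add: num_add round64_ereal d_def[symmetric] invalid_add_def)
  qed
  have fA: "fold (add_group sc k) us (num 0) = num (A us)" if "good_groups ml us" for us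
    using fold_groups[OF that] by simp
  \<comment> \<open>Earlier groups are passed over because the computed running sums are exactly
    monotone, hence at most \<open>A gs1 \<le> y\<close>.\<close>
  have f1: "find (\<lambda>(g, B, B'). fless (num y) B') (running_sums (add_group sc k) (num 0) (live_groups sc k)) =
      Some (g, fold (add_group sc k) gs1 (num 0), add_group sc k g (fold (add_group sc k) gs1 (num 0)))"
    unfolding live
  proof (rule find_running_sums)
    have "add_group sc k g (fold (add_group sc k) gs1 (num 0)) = num (A (gs1 @ [g]))" using fA[OF gp] by simp
    thus "case (g, fold (add_group sc k) gs1 (num 0), add_group sc k g (fold (add_group sc k) gs1 (num 0))) of
       (g, B, B') \<Rightarrow> fless (num y) B'" using yA' by simp
  next
    fix us u vs assume us: "gs1 = us @ u # vs"
    have "good_groups ml (us @ [u])" using good_groups_prefix[of ml "us @ [u]" vs] gp1 us by simp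
    hence "add_group sc k u (fold (add_group sc k) us (num 0)) = num (A (us @ [u]))" using fA[of "us @ [u]"] by simp
    moreover have "A (us @ [u]) \<le> y" using A_mono[of ml "us @ [u]" vs] gp1 us yA by simp
    ultimately show "\<not> (case (u, fold (add_group sc k) us (num 0), add_group sc k u (fold (add_group sc k) us (num 0))) of
       (g, B, B') \<Rightarrow> fless (num y) B')" by simp
  qed
  have fS: "fold (add_move sc k) us (num 0) = num (S us)" if "g = us @ vs" for us vs
    using fold_moves[of us] gg that by simp
  have f2: "find (\<lambda>(m, B, B'). fless (num d) B') (running_sums (add_move sc k) (num 0) g) =
      Some (m, fold (add_move sc k) ms1 (num 0), add_move sc k m (fold (add_move sc k) ms1 (num 0)))"
    unfolding g
  proof (rule find_running_sums)
    have "add_move sc k m (fold (add_move sc k) ms1 (num 0)) = num (S (ms1 @ [m]))" using fS[of "ms1 @ [m]" ms2] g by simp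
    moreover have "d < S (ms1 @ [m])" using de ye hi unfolding E_def[symmetric] by linarith
    ultimately show "case (m, fold (add_move sc k) ms1 (num 0), add_move sc k m (fold (add_move sc k) ms1 (num 0))) of
       (m, B, B') \<Rightarrow> fless (num d) B'" by simp
  next
    fix us u vs assume us: "ms1 = us @ u # vs"
    have "add_move sc k u (fold (add_move sc k) us (num 0)) = num (S (us @ [u]))"
      using fS[of "us @ [u]" "vs @ m # ms2"] g us by simp
    moreover have "S (us @ [u]) \<le> S ms1" using S_mono[of "us @ [u]" vs] gg us g by (simp add: Int_Un_distrib)
    moreover have "S ms1 \<le> d" using de ye lo unfolding E_def[symmetric] by linarith
    ultimately show "\<not> (case (u, fold (add_move sc k) us (num 0), add_move sc k u (fold (add_move sc k) us (num 0))) of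
       (m, B, B') \<Rightarrow> fless (num d) B')" by simp
  qed
  have "find_move sc k (num y) = Some m"
    unfolding find_move_def f1 using f2 fA[OF gp1] df by (simp del: fsub.simps)
  moreover have "stored_value R G k = num T" using stored_safe(1)[OF valid] by (simp add: T_def)
  ultimately show ?thesis unfolding choose_move_def using yf by (simp add: Let_def del: fmul.simps)
qed

end

section \<open>Letter choice probabilities\<close>

lemma pmf_replicate_pmf: "length xs = n \<Longrightarrow> pmf (replicate_pmf n p) xs = prod_list (map (pmf p) xs)"
proof (induction n arbitrary: xs)
  case (Suc n)
  then obtain y ys where xs: "xs = y # ys" "length ys = n" by (auto simp: length_Suc_conv)
  have "replicate_pmf (Suc n) p = map_pmf (\<lambda>(x, xs). x # xs) (pair_pmf p (replicate_pmf n p))"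
    by (simp add: pair_pmf_def map_bind_pmf bind_return_pmf bind_assoc_pmf map_pmf_def)
  also have "pmf \<dots> ((\<lambda>(x, xs). x # xs) (y, ys)) = pmf (pair_pmf p (replicate_pmf n p)) (y, ys)"
    by (rule pmf_map_inj') (auto simp: inj_on_def)
  finally show ?case using Suc.IH[OF xs(2)] by (simp add: pmf_pair xs(1))
qed simp

lemma prod_list_const: "prod_list (map (\<lambda>x. c) xs) = (c :: real) ^ length xs"
  by (induction xs) auto

lemma pmf_random_bits: "length bs = 53 \<Longrightarrow> pmf random_bits bs = 1 / 2 ^ 53"
proof -
  assume l: "length bs = 53"
  have "pmf (bernoulli_pmf (1/2)) = (\<lambda>x. 1/2 :: real)" by (auto simp: fun_eq_iff pmf_bernoulli_half)
  thus ?thesis unfolding random_bits_def pmf_replicate_pmf[OF l] using prod_list_const[of "1/2" bs] l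
    by (simp add: power_divide)
qed

lemma real_horner_sum: "horner_sum of_bool 2 bs = real (horner_sum of_bool 2 bs)"
  by (induction bs) auto

lemma uniform53_bits: "j < 2 ^ 53 \<Longrightarrow> uniform53 (map (bit j) [0..<53]) = real j / 2 ^ 53"
proof -
  assume "j < 2 ^ 53"
  hence "horner_sum of_bool 2 (map (bit j) [0..<53]) = j"
    by (simp add: horner_sum_bit_eq_take_bit take_bit_nat_eq_self)
  thus ?thesis unfolding uniform53_def real_horner_sum by simp
qed

lemma prob_random_bits_ge:
  fixes J :: "nat set"
  assumes "J \<subseteq> {..<2 ^ 53}" "\<And>j. j \<in> J \<Longrightarrow> P (map (bit j) [0..<53])"
  shows "real (card J) / 2 ^ 53 \<le> measure_pmf.prob random_bits {bs. P bs}"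
proof -
  let ?f = "\<lambda>j::nat. map (bit j) [0..<53]"
  have "inj_on ?f J"
  proof (rule inj_on_inverseI)
    fix j assume "j \<in> J"
    hence "j < 2 ^ 53" using assms(1) by auto
    thus "horner_sum of_bool 2 (?f j) = j"
      by (simp add: horner_sum_bit_eq_take_bit take_bit_nat_eq_self)
  qed
  have fin: "finite J" using assms(1) finite_subset by blast
  have "measure_pmf.prob random_bits (?f ` J) = (\<Sum>bs\<in>?f ` J. pmf random_bits bs)"
    by (rule measure_measure_pmf_finite) (use fin in simp)
  also have "\<dots> = (\<Sum>bs\<in>?f ` J. 1 / 2 ^ 53)"
    by (intro sum.cong refl pmf_random_bits) auto
  also have "\<dots> = real (card J) / 2 ^ 53" using card_image[OF \<open>inj_on ?f J\<close>] by simp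
  finally have e: "measure_pmf.prob random_bits (?f ` J) = real (card J) / 2 ^ 53" .
  have "?f ` J \<subseteq> {bs. P bs}" using assms(2) by auto
  from measure_pmf.finite_measure_mono[OF this, of random_bits] show ?thesis unfolding e by simp
qed

text \<open>At least \<open>2 ^ 53 * (\<beta> - \<alpha>) - 1\<close> multiples of
  \<open>1 / 2 ^ 53\<close> lie in the half-open interval from \<open>\<alpha>\<close> to
  \<open>\<beta>\<close>; the missing one costs \<open>u\<close>.\<close>

lemma prob_interval:
  assumes "0 \<le> \<alpha>" "\<beta> \<le> 1"
    and "\<And>j. j < 2 ^ 53 \<Longrightarrow> \<alpha> \<le> real j / 2 ^ 53 \<Longrightarrow> real j / 2 ^ 53 < \<beta> \<Longrightarrow> P (map (bit j) [0..<53])"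
  shows "\<beta> - \<alpha> - uu \<le> measure_pmf.prob random_bits {bs. P bs}"
proof -
  define a where "a = nat \<lceil>\<alpha> * 2 ^ 53\<rceil>"
  define b where "b = nat \<lceil>\<beta> * 2 ^ 53\<rceil>"
  have J: "j < 2 ^ 53 \<and> \<alpha> \<le> real j / 2 ^ 53 \<and> real j / 2 ^ 53 < \<beta>" if "j \<in> {a..<b}" for j
  proof -
    have 1: "\<alpha> * 2 ^ 53 \<le> real j" using that by (simp add: a_def nat_le_iff ceiling_le_iff)
    have "int j < \<lceil>\<beta> * 2 ^ 53\<rceil>" using that by (simp add: b_def zless_nat_eq_int_zless)
    hence 2: "real j < \<beta> * 2 ^ 53" by (simp add: less_ceiling_iff)
    also have "\<dots> \<le> 1 * 2 ^ 53" using assms by (intro mult_right_mono) auto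
    finally have "real j < real (2 ^ 53)" by simp
    hence "j < 2 ^ 53" by (simp only: of_nat_less_iff)
    with 1 2 show ?thesis by (simp add: field_simps)
  qed
  have "real (card {a..<b}) / 2 ^ 53 \<le> measure_pmf.prob random_bits {bs. P bs}"
    using J assms(3) by (intro prob_random_bits_ge) blast+
  moreover have "\<beta> * 2 ^ 53 - \<alpha> * 2 ^ 53 - 1 \<le> real (card {a..<b})"
  proof -
    have "\<beta> * 2 ^ 53 \<le> real b" unfolding b_def by linarith
    moreover have "0 \<le> \<lceil>\<alpha> * 2 ^ 53\<rceil>" using assms(1) by (metis ceiling_zero ceiling_mono mult_nonneg_nonneg zero_le_numeral zero_le_power)
    hence "real a = of_int \<lceil>\<alpha> * 2 ^ 53\<rceil>" unfolding a_def by simp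
    hence "real a \<le> \<alpha> * 2 ^ 53 + 1" by linarith
    moreover have "real b - real a \<le> real (card {a..<b})" by simp
    ultimately show ?thesis by linarith
  qed
  hence "(\<beta> * 2 ^ 53 - \<alpha> * 2 ^ 53 - 1) / 2 ^ 53 \<le> real (card {a..<b}) / 2 ^ 53"
    by (rule divide_right_mono) simp
  moreover have "(\<beta> * 2 ^ 53 - \<alpha> * 2 ^ 53 - 1) / 2 ^ 53 = \<beta> - \<alpha> - uu"
    by (simp add: unit_roundoff_def field_simps)
  ultimately show ?thesis by linarith
qed

section \<open>Loss of probability of a single move\<close>

context scan_state
begin

definition "choice_prob m =
  measure_pmf.prob random_bits {bs. choose_move sc k (stored_value R G k) (uniform53 bs) = Some m}"

definition "E = uu * (101/100 * T)"
definition "\<psi> z = max 0 (z - T)"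

lemma E_pos: "0 < E" using T_bounds unit_roundoff_bounds by (simp add: E_def)

text \<open>With \<open>a\<close> and \<open>b\<close> the computed sums before and after
  \<open>m\<close>, the move is chosen for \<open>x * T\<close> from \<open>a + 2 * E\<close> up to
  \<open>min (b - 2 * E) T\<close>. The fifth \<open>E\<close> is the error of \<open>b - a\<close>
  against the value of the move, and \<open>u\<close> is lost to the grid. Since
  \<open>min z T = z - \<psi> z\<close>, cutting at \<open>T\<close> costs an increment of
  \<open>\<psi>\<close>.\<close>

lemma choice_prob_ge:
  assumes live: "live_groups sc k = gs1 @ g # gs2" and g: "g = ms1 @ m # ms2"
    and good: "good_groups ml (live_groups sc k)"
  shows "v m * (1 - uu) ^ 3 / T - (\<psi> (A gs1 + S (ms1 @ [m])) - \<psi> (A gs1 + S ms1)) / T - 5 * E / T - uu \<le> choice_prob m"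
    and "\<psi> (A gs1 + S ms1) \<le> \<psi> (A gs1 + S (ms1 @ [m]))"
proof -
  define a where "a = A gs1 + S ms1"
  define b where "b = A gs1 + S (ms1 @ [m])"
  have T0: "0 < T" using T_bounds by simp
  have gp: "good_groups ml (gs1 @ [g])" using good live good_groups_prefix[of ml "gs1 @ [g]" gs2] by simp
  note gp1 = good_groups_prefix[OF gp]
  have gg: "distinct g" "set g \<subseteq> moves k" "length g \<le> 4000000" using gp by (auto simp: good_groups_def)
  have S: "S ms1 \<le> S (ms1 @ [m])" "S ms1 + v m * (1 - uu) ^ 3 - E \<le> S (ms1 @ [m])"
    using S_step[of ms1 m] gg by (auto simp: g E_def)
  have ab: "a \<le> b" "v m * (1 - uu) ^ 3 - E \<le> b - a" using S by (auto simp: a_def b_def)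
  thus "\<psi> (A gs1 + S ms1) \<le> \<psi> (A gs1 + S (ms1 @ [m]))" by (auto simp: a_def b_def \<psi>_def)
  have a0: "0 \<le> a" using fold_groups[OF gp1] fold_moves[of ms1] gg normal0_nonneg by (simp add: a_def g add_nonneg_nonneg)
  have "(min b T - min a T - 4 * E) / T - uu \<le> choice_prob m"
  proof (cases "a \<le> T")
    case False
    hence "(min b T - min a T - 4 * E) / T \<le> 0"
      using ab E_pos T0 by (intro divide_nonpos_pos) auto
    hence "(min b T - min a T - 4 * E) / T - uu \<le> 0" using unit_roundoff_bounds by linarith
    also have "0 \<le> choice_prob m" by (simp add: choice_prob_def)
    finally show ?thesis .
  next
    case True
    define \<alpha> where "\<alpha> = (a + 2 * E) / T"
    define \<beta> where "\<beta> = min (b - 2 * E) T / T"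
    have "\<beta> - \<alpha> - uu \<le> choice_prob m" unfolding choice_prob_def
    proof (rule prob_interval)
      show "0 \<le> \<alpha>" using a0 E_pos T0 by (simp add: \<alpha>_def)
      show "\<beta> \<le> 1" using T0 by (simp add: \<beta>_def)
      fix j :: nat assume j: "j < 2 ^ 53" "\<alpha> \<le> real j / 2 ^ 53" "real j / 2 ^ 53 < \<beta>"
      have u: "uniform53 (map (bit j) [0..<53]) = real j / 2 ^ 53" by (rule uniform53_bits[OF j(1)])
      show "choose_move sc k (stored_value R G k) (uniform53 (map (bit j) [0..<53])) = Some m" unfolding u
      proof (rule choose_move_if[OF live g good])
        show "real j / 2 ^ 53 = 0 \<or> 2 powi (-53) \<le> real j / 2 ^ 53"
          by (cases "j = 0") (auto simp: power_int_minus field_simps)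
        have "\<beta> \<le> 1" using T0 by (simp add: \<beta>_def)
        thus "real j / 2 ^ 53 < 1" using j(3) by linarith
        have "\<alpha> * T \<le> real j / 2 ^ 53 * T" using j(2) T0 by (intro mult_right_mono) auto
        thus "A gs1 + S ms1 + 2 * (uu * (101/100 * T)) \<le> real j / 2 ^ 53 * T"
          using T0 by (simp add: \<alpha>_def a_def E_def)
        have "real j / 2 ^ 53 * T < \<beta> * T" using j(3) T0 by (intro mult_strict_right_mono) auto
        also have "\<dots> \<le> b - 2 * E" using T0 by (simp add: \<beta>_def)
        finally show "real j / 2 ^ 53 * T < A gs1 + S (ms1 @ [m]) - 2 * (uu * (101/100 * T))"
          by (simp add: b_def E_def)
      qed
    qed
    moreover have "(min b T - min a T - 4 * E) / T \<le> \<beta> - \<alpha>"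
    proof -
      have "min b T - min a T - 4 * E \<le> min (b - 2 * E) T - (a + 2 * E)" using True E_pos by (auto simp: min_def)
      hence "(min b T - min a T - 4 * E) / T \<le> (min (b - 2 * E) T - (a + 2 * E)) / T"
        using T0 by (intro divide_right_mono) auto
      thus ?thesis by (simp add: \<alpha>_def \<beta>_def diff_divide_distrib)
    qed
    ultimately show ?thesis by linarith
  qed
  moreover have "min b T - min a T = (b - a) - (\<psi> b - \<psi> a)" by (auto simp: \<psi>_def min_def max_def)
  moreover have "(v m * (1 - uu) ^ 3 - (\<psi> b - \<psi> a) - 5 * E) / T \<le> ((b - a) - (\<psi> b - \<psi> a) - 4 * E) / T"
    using ab T0 by (intro divide_right_mono) auto
  ultimately show "v m * (1 - uu) ^ 3 / T - (\<psi> (A gs1 + S (ms1 @ [m])) - \<psi> (A gs1 + S ms1)) / T - 5 * E / T - uu \<le> choice_prob m"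
    unfolding a_def[symmetric] b_def[symmetric] by (simp add: diff_divide_distrib)
qed

definition "ideal_prob m = weight exact k m / exact k"
definition "loss m = max 0 (ideal_prob m - choice_prob m)"
text \<open>The part of the loss that does not telescope: the shortfall of the rounded value
  relative to \<open>T\<close>, and the fixed price of the margins and of the grid.\<close>

definition "base_loss m = max 0 (ideal_prob m - v m * (1 - uu) ^ 3 / T) + (5 * E / T + uu)"

lemma loss_group:
  assumes live: "live_groups sc k = gs1 @ g # gs2" and good: "good_groups ml (live_groups sc k)"
    and "g = ms @ ms'"
  shows "sum_list (map loss ms) \<le> sum_list (map base_loss ms) + (\<psi> (A gs1 + S ms) - \<psi> (A gs1)) / T"
  using assms(3)
proof (induction ms arbitrary: ms' rule: rev_induct)
  case Nil
  show ?case by (simp add: S_def)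
next
  case (snoc m ms)
  have g: "g = ms @ m # ms'" using snoc.prems by simp
  note cp = choice_prob_ge[OF live g good]
  have "0 \<le> (\<psi> (A gs1 + S (ms @ [m])) - \<psi> (A gs1 + S ms)) / T"
    using cp(2) T_bounds(1) by (intro divide_nonneg_nonneg) auto
  moreover have "0 \<le> 5 * E / T + uu" using E_pos T_bounds(1) unit_roundoff_bounds by (intro add_nonneg_nonneg divide_nonneg_nonneg) auto
  ultimately have "loss m \<le> base_loss m + (\<psi> (A gs1 + S (ms @ [m])) - \<psi> (A gs1 + S ms)) / T"
    using cp(1) unfolding loss_def base_loss_def by (auto simp: max_def)
  moreover have "sum_list (map loss ms) \<le> sum_list (map base_loss ms) + (\<psi> (A gs1 + S ms) - \<psi> (A gs1)) / T"
    using snoc.IH[OF g] .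
  ultimately show ?case by (simp add: diff_divide_distrib)
qed

text \<open>The part of the scan beyond the stored value \<open>T\<close> cannot be reached; its total length \<open>\<psi>\<close> is
  telescoped over the groups.\<close>

lemma loss_groups:
  assumes "live_groups sc k = gs @ gs'" and good: "good_groups ml (live_groups sc k)"
  shows "sum_list (map loss (concat gs)) \<le> sum_list (map base_loss (concat gs)) + \<psi> (A gs) / T + real (length gs) * (E / T)"
  using assms(1)
proof (induction gs arbitrary: gs' rule: rev_induct)
  case Nil
  show ?case using T_bounds(1) by (simp add: A_def \<psi>_def)
next
  case (snoc g gs)
  have live: "live_groups sc k = gs @ g # gs'" using snoc.prems by simp
  have gp: "good_groups ml (gs @ [g])" using good live good_groups_prefix[of ml "gs @ [g]" gs'] by simp
  \<comment> \<open>A group ends at \<open>A gs + S g\<close>, while the next one starts at the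
    rounded sum; this gap costs one \<open>E\<close> per group.\<close>
  have "\<psi> (A gs + S g) \<le> \<psi> (A (gs @ [g])) + E" using A_step(2)[OF gp] E_pos unfolding \<psi>_def E_def by linarith
  hence "\<psi> (A gs + S g) / T \<le> \<psi> (A (gs @ [g])) / T + E / T"
    using T_bounds(1) by (simp add: divide_right_mono flip: add_divide_distrib)
  moreover have "sum_list (map loss g) \<le> sum_list (map base_loss g) + (\<psi> (A gs + S g) - \<psi> (A gs)) / T"
    using loss_group[OF live good, of g "[]"] by simp
  moreover note snoc.IH[OF live]
  ultimately show ?case by (simp add: diff_divide_distrib add_divide_distrib distrib_right)
qed

section \<open>The candidates that remain when zeros are skipped\<close>

lemma live_concat:
  "concat (live_groups sc k) = filter (\<lambda>m. fst (scan_factors sc k m) \<otimes> snd (scan_factors sc k m) \<noteq> num 0) (concat (scan_order sc k))"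
proof -
  have "concat (filter (\<lambda>g. g \<noteq> []) xs) = concat xs" for xs :: "move list list" by (induction xs) auto
  thus ?thesis unfolding live_groups_def by (simp add: filter_concat)
qed

lemma order_concat: "distinct (concat (scan_order sc k))" "set (concat (scan_order sc k)) = moves k"
proof -
  have "set ` set (scan_order sc k) = groups k" and d: "distinct (concat (scan_order sc k))"
    using scan unfolding valid_scan_def by blast+
  thus "set (concat (scan_order sc k)) = moves k" by (simp add: moves_def)
  show "distinct (concat (scan_order sc k))" by (rule d)
qed

lemma live_set: "distinct (concat (live_groups sc k))" "set (concat (live_groups sc k)) \<subseteq> moves k"
  unfolding live_concat using order_concat by auto

text \<open>A nonzero stored weight is normal, so its rounded product cannot be zero; skipping zeros
  therefore removes no move of positive exact weight.\<close>

lemma positive_live: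
  assumes "m \<in> moves k" "0 < weight exact k m" shows "m \<in> set (concat (live_groups sc k))"
proof -
  have "scan_factors sc k m \<in> factorings (move_value R G k m)" using scan unfolding valid_scan_def by blast
  from pair_fin_move[OF valid supp assms(1) weight_rel(2)[OF valid supp assms(1)] this]
  have p: "pair_ok 2 (v m) (scan_factors sc k m)" by (simp add: v_def pair_finD)
  have "v m \<noteq> 0" using weight_rel(1)[OF valid supp assms(1)] assms(2) by (auto simp: v_def)
  moreover have "v m = 0" if "fst (scan_factors sc k m) \<otimes> snd (scan_factors sc k m) = num 0"
    using pair_ok_mult[OF p] unfolding that by (auto simp: approx_inf_def approx_def)
  ultimately show ?thesis unfolding live_concat using assms(1) order_concat(2) by auto
qed

lemma length_live:
  "length (concat (live_groups sc k)) \<le> card (moves k)"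
  "length (live_groups sc k) \<le> length (concat (live_groups sc k))"
  "g \<in> set (live_groups sc k) \<Longrightarrow> length g \<le> length (concat (live_groups sc k))"
proof -
  show "length (concat (live_groups sc k)) \<le> card (moves k)"
    using card_mono[OF finite_moves live_set(2)] distinct_card[OF live_set(1)] by simp
  have "length xs \<le> length (concat xs)" if "[] \<notin> set xs" for xs :: "move list list"
    using that
  proof (induction xs)
    case (Cons x xs)
    hence "1 \<le> length x" by (cases x) auto
    thus ?case using Cons by auto
  qed simp
  moreover have "[] \<notin> set (live_groups sc k)" by (auto simp: live_groups_def)
  ultimately show "length (live_groups sc k) \<le> length (concat (live_groups sc k))" by blast
  show "length g \<le> length (concat (live_groups sc k))" if "g \<in> set (live_groups sc k)"
    using that by (auto simp: length_concat member_le_sum_list)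
qed

lemma length_live_Free:
  assumes "k = Free p q"
  shows "length (live_groups sc k) \<le> 22801" "g \<in> set (live_groups sc k) \<Longrightarrow> length g \<le> 301"
proof -
  have pq: "p + q \<le> 300" using valid assms by simp
  define xs where "xs = scan_order sc k"
  have d: "distinct (concat xs)" and gr: "set ` set xs = groups k"
    using scan unfolding valid_scan_def xs_def by blast+
  have "length (filter (\<lambda>g. g \<noteq> []) (map (filter P) ys)) \<le> length (removeAll [] ys)" for P and ys :: "move list list"
    by (induction ys) auto
  hence "length (live_groups sc k) \<le> length (removeAll [] xs)" by (simp add: live_groups_def xs_def)
  \<comment> \<open>Distinctness of the concatenation makes the nonempty groups pairwise disjoint;
    it would not prevent an empty list from occurring twice.\<close>
  also have "\<dots> = card (set (removeAll [] xs))" using d unfolding distinct_concat_iff by (metis distinct_card)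
  also have "\<dots> \<le> card (groups k)"
  proof (rule card_inj_on_le[where f = set])
    show "inj_on set (set (removeAll [] xs))"
    proof (rule inj_onI)
      fix a b assume ab: "a \<in> set (removeAll [] xs)" "b \<in> set (removeAll [] xs)" "set a = set b"
      show "a = b"
      proof (rule ccontr)
        assume "a \<noteq> b"
        with ab d have "set a \<inter> set b = {}" unfolding distinct_concat_iff set_removeAll by blast
        with ab show False by auto
      qed
    qed
    show "set ` set (removeAll [] xs) \<subseteq> groups k" unfolding gr[symmetric] by auto
    show "finite (groups k)" unfolding gr[symmetric] by simp
  qed
  also have "\<dots> \<le> 22801"
  proof -
    define B where "B = (\<lambda>(h, c). {Cut_Band1 h c t | t. in_support (q - 1 - h) (p - c) h t}) ` ({..<q - 1} \<times> {..p})"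
    have "groups k \<subseteq> (\<lambda>h. {Read_Band0 h}) ` {..<p} \<union> {{Read_Greatest_Band1}} \<union> B" (is "_ \<subseteq> ?A \<union> ?C \<union> B")
      by (auto simp: assms B_def image_iff split: if_splits)
    hence "card (groups k) \<le> card (?A \<union> ?C \<union> B)" by (intro card_mono) (auto simp: B_def)
    also have "\<dots> \<le> card ?A + card ?C + card B" by (intro order.trans[OF card_Un_le] add_mono order.refl)
    also have "card ?A \<le> p" using card_image_le[of "{..<p}"] by simp
    also have "card B \<le> (q - 1) * (p + 1)" unfolding B_def by (rule order.trans[OF card_image_le]) auto
    \<comment> \<open>Three kinds of groups: at most 300 for band 0, one for the greatest value of
      band 1, and at most 22500 pairs \<open>(h, c)\<close>.\<close>
    finally show ?thesis using pairs_bound[OF pq] pq by simp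
  qed
  finally show "length (live_groups sc k) \<le> 22801" .
  assume "g \<in> set (live_groups sc k)"
  then obtain P x where x: "x \<in> set xs" "g = filter P x" by (auto simp: live_groups_def xs_def)
  have "length g \<le> card (set x)" using x d by (auto simp: distinct_concat_iff distinct_card)
  also have "\<dots> \<le> 301"
  proof -
    have "set x \<in> groups k" using x gr by auto
    then consider h where "set x = {Read_Band0 h}" | "set x = {Read_Greatest_Band1}"
      | h c where "h + 2 \<le> q" "c \<le> p" "set x = {Cut_Band1 h c t | t. in_support (q - 1 - h) (p - c) h t}"
      by (auto simp: assms split: if_splits)
    thus ?thesis
    proof cases
      case (3 h c)
      hence "set x \<subseteq> Cut_Band1 h c ` {..300}" using pq by (auto dest!: in_support_le)
      from card_mono[OF _ this] show ?thesis using card_image_le[of "{..300}" "Cut_Band1 h c"] by simp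
    qed auto
  qed
  finally show "length g \<le> 301" .
qed

end

text \<open>Errors in the numerators and in the normalization contribute
  \<open>\<gamma> * X / F\<close> each to the \<open>L1\<close> distance. The differences sum to
  zero, so the positive part is half of that distance, and
  \<open>X / F \<le> 1 / (1 - \<gamma>)\<close>.\<close>

lemma normalized_loss:
  fixes w v :: "'a \<Rightarrow> real"
  assumes "finite I" and w: "\<And>i. i \<in> I \<Longrightarrow> 0 \<le> w i"
    and X: "X = sum w I" "0 < X" and F: "F = sum v I" "0 < F" and \<gamma>: "0 \<le> \<gamma>" "\<gamma> < 1"
    and err: "\<And>i. i \<in> I \<Longrightarrow> \<bar>v i - w i\<bar> \<le> \<gamma> * w i"
  shows "(\<Sum>i\<in>I. max 0 (w i / X - v i / F)) \<le> \<gamma> / (1 - \<gamma>)"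
proof -
  define z where "z = (\<lambda>i. w i / X - v i / F)"
  have FX: "\<bar>F - X\<bar> \<le> \<gamma> * X"
  proof -
    have "\<bar>F - X\<bar> = \<bar>\<Sum>i\<in>I. v i - w i\<bar>" by (simp add: X F sum_subtractf)
    also have "\<dots> \<le> (\<Sum>i\<in>I. \<bar>v i - w i\<bar>)" by (rule sum_abs)
    also have "\<dots> \<le> (\<Sum>i\<in>I. \<gamma> * w i)" by (intro sum_mono err)
    finally show ?thesis by (simp add: X sum_distrib_left)
  qed
  have z0: "sum z I = 0" using X F by (simp add: z_def sum_subtractf flip: sum_divide_distrib)
  have "\<bar>z i\<bar> \<le> \<gamma> * w i / F + w i * \<bar>1 / X - 1 / F\<bar>" if i: "i \<in> I" for i
  proof -
    have "z i = (w i - v i) / F + w i * (1 / X - 1 / F)" using X F by (simp add: z_def field_simps)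
    also have "\<bar>\<dots>\<bar> \<le> \<bar>(w i - v i) / F\<bar> + \<bar>w i * (1 / X - 1 / F)\<bar>" by (rule abs_triangle_ineq)
    also have "\<bar>(w i - v i) / F\<bar> = \<bar>v i - w i\<bar> / F" using F by (simp add: abs_minus_commute)
    also have "\<dots> \<le> \<gamma> * w i / F" using err[OF i] F by (intro divide_right_mono) auto
    finally show ?thesis using w[OF i] by (simp add: abs_mult)
  qed
  hence "(\<Sum>i\<in>I. \<bar>z i\<bar>) \<le> (\<Sum>i\<in>I. \<gamma> * w i / F + w i * \<bar>1 / X - 1 / F\<bar>)" by (intro sum_mono)
  also have "\<dots> = \<gamma> * X / F + X * \<bar>1 / X - 1 / F\<bar>"
    by (simp add: sum.distrib X(1) sum_distrib_left sum_distrib_right sum_divide_distrib)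
  also have "X * \<bar>1 / X - 1 / F\<bar> = \<bar>F - X\<bar> / F"
  proof -
    have "X * \<bar>1 / X - 1 / F\<bar> = \<bar>X * (1 / X - 1 / F)\<bar>" using X by (simp add: abs_mult)
    also have "X * (1 / X - 1 / F) = (F - X) / F" using X F by (simp add: field_simps)
    finally show ?thesis using F by simp
  qed
  also have "\<dots> \<le> \<gamma> * X / F" using FX F by (intro divide_right_mono) auto
  also have "\<gamma> * X / F + \<gamma> * X / F = 2 * (\<gamma> * (X / F))" by simp
  finally have 1: "(\<Sum>i\<in>I. \<bar>z i\<bar>) \<le> 2 * (\<gamma> * (X / F))" by simp
  have "(1 - \<gamma>) * X \<le> F" using FX by (simp add: algebra_simps)
  hence "X / F \<le> 1 / (1 - \<gamma>)" using F \<gamma> by (simp add: field_simps)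
  hence 2: "\<gamma> * (X / F) \<le> \<gamma> / (1 - \<gamma>)" using \<gamma>(1) mult_left_mono by fastforce
  have "(\<Sum>i\<in>I. max 0 (z i)) = (\<Sum>i\<in>I. (\<bar>z i\<bar> + z i) / 2)" by (intro sum.cong) (auto simp: max_def)
  also have "\<dots> = (\<Sum>i\<in>I. \<bar>z i\<bar>) / 2" using z0 by (simp add: sum.distrib flip: sum_divide_distrib)
  finally show ?thesis using 1 2 unfolding z_def by linarith
qed

lemma nu_300: "real (\<nu> * 300) * uu < 1 / 8000000"
  by (simp add: \<nu>_def unit_roundoff_def)

text \<open>By Bernoulli the factor of \<open>rel\<close> is at least \<open>1 - z\<close> with
  \<open>z = \<nu> * 300 * u\<close>. The upward deviation \<open>z / (1 - z)\<close> dominates the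
  downward deviation \<open>z\<close>, and it is exactly \<open>gamma_err\<close>.\<close>

lemma rel_gamma:
  assumes "rel j w v" "j \<le> \<nu> * 300" shows "\<bar>v - w\<bar> \<le> gamma_err (\<nu> * 300) * w"
proof -
  define z where "z = real (\<nu> * 300) * uu"
  have z: "0 \<le> z" "z < 1" using nu_300 unit_roundoff_bounds by (auto simp: z_def)
  have "real j * uu \<le> z" unfolding z_def using assms(2) unit_roundoff_bounds by (intro mult_right_mono) auto
  hence p: "1 - z \<le> (1 - uu) ^ j" using uu_pow_ge[of j] by linarith
  have w: "0 \<le> w" "0 \<le> v" using assms by (auto simp: rel_def)
  have "w * (1 - z) \<le> v" "v * (1 - z) \<le> w"
    using assms(1) mult_left_mono[OF p w(1)] mult_left_mono[OF p w(2)] by (auto simp: rel_def)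
  hence "w - v \<le> z * w" "v \<le> w / (1 - z)" using z by (auto simp: field_simps)
  moreover have "w / (1 - z) - w = z / (1 - z) * w" using z by (simp add: field_simps)
  moreover have "z * w \<le> z / (1 - z) * w"
  proof (rule mult_right_mono[OF _ w(1)])
    have "z * (1 - z) \<le> z * 1" using z by (intro mult_left_mono) auto
    thus "z \<le> z / (1 - z)" using z by (simp add: field_simps)
  qed
  ultimately have "v - w \<le> z / (1 - z) * w" "w - v \<le> z / (1 - z) * w" by linarith+
  thus ?thesis unfolding gamma_err_def z_def[symmetric] by (simp only: abs_le_iff minus_diff_eq)
qed

section \<open>Total loss of a letter choice\<close>

context scan_state
begin

lemma ideal_loss: "(\<Sum>m\<in>moves k. max 0 (ideal_prob m - v m / F)) \<le> gamma_err (\<nu> * 300) / (1 - gamma_err (\<nu> * 300))"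
  unfolding ideal_prob_def
proof (rule normalized_loss)
  show "exact k = sum (weight exact k) (moves k)" using exact_sum supp not_final by blast
  show "F = sum v (moves k)" by (simp add: F_def candidate_sum_def v_def)
  define z where "z = real (\<nu> * 300) * uu"
  have z: "0 \<le> z" "z < 1/2" using nu_300 unit_roundoff_bounds by (auto simp: z_def)
  have "gamma_err (\<nu> * 300) = z / (1 - z)" unfolding gamma_err_def z_def ..
  moreover have "0 \<le> z / (1 - z)" "z / (1 - z) < 1" using z by (auto simp: field_simps)
  ultimately show "0 \<le> gamma_err (\<nu> * 300)" "gamma_err (\<nu> * 300) < 1" by auto
  show "\<bar>v m - weight exact k m\<bar> \<le> gamma_err (\<nu> * 300) * weight exact k m" if "m \<in> moves k" for m
    unfolding v_def
  proof (rule rel_gamma[OF weight_rel(1)[OF valid supp that]])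
    show "\<nu> * (unread_letters k - 1) \<le> \<nu> * 300" using unread_le[OF valid] by (intro mult_le_mono2) simp
  qed
qed (use finite_moves positive F_pos exact_nonneg in \<open>auto intro: weight_nonneg\<close>)

text \<open>The running sum is at most \<open>T / (1 - z)\<close>, and for
  \<open>z \<le> 1/100\<close> this is at most \<open>(1 + 1.02 * z) * T\<close>.\<close>

lemma overshoot:
  assumes "good_groups ml gs" shows "\<psi> (A gs) / T \<le> 102/100 * (real (K0 + 3 + ml + length gs) * uu)"
proof -
  define z where "z = real (K0 + 3 + ml + length gs) * uu"
  have b: "K0 + 3 + ml + length gs \<le> 20000000" using assms K0_le by (simp add: good_groups_def)
  have "z \<le> 20000000 * uu" unfolding z_def using b unit_roundoff_bounds by (intro mult_right_mono) auto
  hence z: "0 \<le> z" "z \<le> 1/100" using unit_roundoff_bounds by (auto simp: z_def unit_roundoff_def)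
  have r: "rel (3 + ml + length gs) (sum_list (map v (concat gs))) (A gs)" and A0: "0 \<le> A gs"
    using fold_groups[OF assms] normal0_nonneg by auto
  have "sum_list (map v (concat gs)) \<le> F" using sum_v_le(1) assms by (simp add: good_groups_def)
  hence "A gs * (1 - uu) ^ (3 + ml + length gs) \<le> F" using r by (simp add: rel_def)
  hence "A gs * (1 - uu) ^ (3 + ml + length gs) * (1 - uu) ^ K0 \<le> F * (1 - uu) ^ K0"
    by (intro mult_right_mono) (use one_minus_uu in auto)
  also have "\<dots> \<le> T" using F_T by (simp add: rel_def)
  finally have "A gs * (1 - uu) ^ (K0 + 3 + ml + length gs) \<le> T" by (simp add: power_add mult_ac)
  moreover have "A gs * (1 - z) \<le> A gs * (1 - uu) ^ (K0 + 3 + ml + length gs)"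
    unfolding z_def using A0 by (intro mult_left_mono uu_pow_ge)
  ultimately have 1: "A gs * (1 - z) \<le> T" by linarith
  have "1 \<le> (1 + 102/100 * z) * (1 - z)"
  proof -
    have "(1 + 102/100 * z) * (1 - z) = 1 + z * (2/100 - 102/100 * z)" by (simp add: field_simps)
    thus ?thesis using z by simp
  qed
  hence "T * 1 \<le> T * ((1 + 102/100 * z) * (1 - z))" using T_bounds by (intro mult_left_mono) auto
  hence "A gs * (1 - z) \<le> T * (1 + 102/100 * z) * (1 - z)" using 1 by (simp add: mult.assoc)
  hence "A gs \<le> T * (1 + 102/100 * z)" using z by simp
  hence "A gs - T \<le> 102/100 * z * T" by (simp add: field_simps)
  moreover have "0 \<le> 102/100 * z * T" using z(1) T_bounds(1) by simp
  ultimately have "\<psi> (A gs) \<le> 102/100 * z * T" unfolding \<psi>_def by (rule max.boundedI[rotated])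
  thus ?thesis using T_bounds by (simp add: divide_le_eq z_def)
qed

text \<open>The price of dividing by \<open>T\<close> instead of \<open>F\<close> is proportional to
  \<open>v m / F\<close> and so adds up to \<open>(K0 + 3) * u\<close> over all moves. Only
  \<open>5 * E / T + u\<close>, that is \<open>6.05 * u\<close>, is paid for each candidate.\<close>

lemma base_loss_sum:
  defines "L \<equiv> concat (live_groups sc k)"
  shows "sum_list (map base_loss L) \<le> gamma_err (\<nu> * 300) / (1 - gamma_err (\<nu> * 300)) + real (K0 + 3) * uu + real (length L) * (605/100 * uu)"
proof -
  have c: "5 * E / T + uu = 605/100 * uu" using T_bounds(1) by (simp add: E_def field_simps)
  have K: "v m / F - v m * (1 - uu) ^ 3 / T \<le> real (K0 + 3) * uu * (v m / F)" if "m \<in> moves k" for m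
  proof -
    have FT: "F * (1 - uu) ^ K0 \<le> T" "T * (1 - uu) ^ K0 \<le> F" using F_T by (auto simp: rel_def)
    have v0: "0 \<le> v m" using v_nonneg that .
    have "v m * (1 - uu) ^ 3 * (T * (1 - uu) ^ K0) \<le> v m * (1 - uu) ^ 3 * F"
      using FT v0 one_minus_uu by (intro mult_left_mono) auto
    hence "v m * (1 - uu) ^ (K0 + 3) / F \<le> v m * (1 - uu) ^ 3 / T"
      using F_pos T_bounds(1) by (simp add: field_simps power_add)
    moreover have "(1 - real (K0 + 3) * uu) * (v m / F) \<le> (1 - uu) ^ (K0 + 3) * (v m / F)"
      using uu_pow_ge[of "K0 + 3"] v0 F_pos by (intro mult_right_mono) auto
    ultimately show ?thesis by (simp add: algebra_simps)
  qed
  have "max 0 (ideal_prob m - v m * (1 - uu) ^ 3 / T) \<le> max 0 (ideal_prob m - v m / F) + real (K0 + 3) * uu * (v m / F)" if "m \<in> moves k" for m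
  proof -
    have "0 \<le> real (K0 + 3) * uu * (v m / F)" using v_nonneg[OF that] F_pos unit_roundoff_bounds by simp
    thus ?thesis using K[OF that] by linarith
  qed
  hence "base_loss m \<le> max 0 (ideal_prob m - v m / F) + real (K0 + 3) * uu * (v m / F) + 605/100 * uu" if "m \<in> moves k" for m
    unfolding base_loss_def c using that by simp
  hence "sum_list (map base_loss L) \<le> (\<Sum>m\<leftarrow>L. max 0 (ideal_prob m - v m / F) + real (K0 + 3) * uu * (v m / F) + 605/100 * uu)"
    using live_set(2) unfolding L_def by (intro sum_list_mono) auto
  also have "\<dots> = (\<Sum>m\<leftarrow>L. max 0 (ideal_prob m - v m / F)) + real (K0 + 3) * uu * (sum_list (map v L) / F) + real (length L) * (605/100 * uu)"
    by (induction L) (auto simp: algebra_simps add_divide_distrib)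
  also have "(\<Sum>m\<leftarrow>L. max 0 (ideal_prob m - v m / F)) = (\<Sum>m\<in>set L. max 0 (ideal_prob m - v m / F))"
    using live_set(1) unfolding L_def by (rule sum_list_distinct_conv_sum_set)
  also have "\<dots> \<le> (\<Sum>m\<in>moves k. max 0 (ideal_prob m - v m / F))"
    using live_set(2) finite_moves unfolding L_def by (intro sum_mono2) auto
  also note ideal_loss
  also have "real (K0 + 3) * uu * (sum_list (map v L) / F) \<le> real (K0 + 3) * uu * 1"
    using sum_v_le[OF live_set] F_pos unit_roundoff_bounds unfolding L_def by (intro mult_left_mono) auto
  finally show ?thesis by simp
qed

text \<open>The coefficients are in units of \<open>u / 100\<close>: the interval of a move loses \<open>5E / T\<close> to the rounding of
  its end points and \<open>u\<close> to the grid of \<open>x\<close>, with \<open>E / T = 1.01u\<close>.\<close>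

lemma step_loss_if:
  assumes good: "good_groups ml (live_groups sc k)"
    and n: "100 * (K0 + 3) + 605 * length (concat (live_groups sc k))
      + 102 * (K0 + 3 + ml + length (live_groups sc k)) + 101 * length (live_groups sc k) \<le> 700 * \<nu>"
  shows "(\<Sum>m | m \<in> moves k \<and> 0 < weight exact k m. loss m)
    \<le> gamma_err (\<nu> * 300) / (1 - gamma_err (\<nu> * 300)) + 7 * real \<nu> * uu"
proof -
  define L where "L = concat (live_groups sc k)"
  define g where "g = length (live_groups sc k)"
  have ET: "E / T = 101/100 * uu" using T_bounds(1) by (simp add: E_def)
  have "(\<Sum>m | m \<in> moves k \<and> 0 < weight exact k m. loss m) \<le> sum loss (set L)"
    unfolding L_def by (intro sum_mono2) (auto simp: loss_def intro: positive_live[simplified])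
  also have "\<dots> = sum_list (map loss L)" unfolding L_def using live_set(1) by (rule sum_list_distinct_conv_sum_set[symmetric])
  also have "\<dots> \<le> sum_list (map base_loss L) + \<psi> (A (live_groups sc k)) / T + real g * (E / T)"
    unfolding L_def g_def by (rule loss_groups[OF _ good, of _ "[]"]) simp
  also have "\<dots> \<le> (gamma_err (\<nu> * 300) / (1 - gamma_err (\<nu> * 300)) + real (K0 + 3) * uu + real (length L) * (605/100 * uu))
     + 102/100 * (real (K0 + 3 + ml + g) * uu) + real g * (101/100 * uu)"
    unfolding ET L_def g_def by (intro add_mono base_loss_sum overshoot[OF good] order.refl)
  also have "\<dots> = gamma_err (\<nu> * 300) / (1 - gamma_err (\<nu> * 300))
     + real (100 * (K0 + 3) + 605 * length L + 102 * (K0 + 3 + ml + g) + 101 * g) * (uu / 100)"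
    by (simp add: field_simps)
  also have "real (100 * (K0 + 3) + 605 * length L + 102 * (K0 + 3 + ml + g) + 101 * g) * (uu / 100) \<le> real (700 * \<nu>) * (uu / 100)"
    unfolding L_def g_def by (intro mult_right_mono of_nat_mono n) (use unit_roundoff_bounds in simp)
  finally show ?thesis by (simp add: mult_ac)
qed

text \<open>A free state has more candidates, but its running sums pass through few additions: 301
  in a group and 22801 among the groups. For an exposing state group lengths and number of groups
  are both bounded by the number of candidates, which is smaller. In units of \<open>u / 100\<close>
  the losses beside the \<open>\<gamma>\<close> term come to about 2.05 and 2.22 billion, against
  about 2.35 billion for \<open>700 * \<nu>\<close>.\<close>

lemma step_loss:
  "(\<Sum>m | m \<in> moves k \<and> 0 < weight exact k m. loss m)
    \<le> gamma_err (\<nu> * 300) / (1 - gamma_err (\<nu> * 300)) + 7 * real \<nu> * uu"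
proof (cases k)
  case (Free p q)
  have K0: "K0 = 24000" unfolding K0_def by (simp add: Free)
  have M: "length (concat (live_groups sc k)) \<le> 3375301" using length_live(1) card_moves[OF valid] Free by simp
  show ?thesis
  proof (rule step_loss_if)
    show "good_groups 301 (live_groups sc k)" unfolding good_groups_def
      using live_set length_live_Free[OF Free] by auto
    show "100 * (K0 + 3) + 605 * length (concat (live_groups sc k))
      + 102 * (K0 + 3 + 301 + length (live_groups sc k)) + 101 * length (live_groups sc k) \<le> 700 * \<nu>"
      unfolding K0 using M length_live_Free(1)[OF Free] by (simp add: \<nu>_def)
  qed
next
  case (Exposing l a q t)
  have K0: "K0 = 2000310" unfolding K0_def by (simp add: Exposing)
  have M: "length (concat (live_groups sc k)) \<le> 2000302" using length_live(1) card_moves[OF valid] Exposing by simp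
  show ?thesis
  proof (rule step_loss_if)
    show "good_groups 2000302 (live_groups sc k)" unfolding good_groups_def
      using live_set length_live M by fastforce
    show "100 * (K0 + 3) + 605 * length (concat (live_groups sc k))
      + 102 * (K0 + 3 + 2000302 + length (live_groups sc k)) + 101 * length (live_groups sc k) \<le> 700 * \<nu>"
      unfolding K0 using M length_live(2) by (simp add: \<nu>_def)
  qed
qed

end

section \<open>Completions of a sampler state\<close>

lemma subseq_imp_set: "subseq xs ys \<Longrightarrow> set xs \<subseteq> set ys"
  by (induction rule: list_emb.induct) auto

definition avoids_12453 :: "nat list \<Rightarrow> bool" where
  "avoids_12453 w \<longleftrightarrow> (\<forall>a b c d e. a < b \<and> b < c \<and> c < d \<and> d < e \<longrightarrow> \<not> subseq [a, b, d, e, c] w)"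

text \<open>Letters are named by size: \<open>a < b < c < d < e\<close> are the values 1 to 5 of the
  pattern 12453, so the reading order is \<open>a, b, d, e, c\<close>. The set \<open>X\<close>
  contains the values whose preceding part of the pattern has been read already.\<close>

definition avoids_1342 :: "nat set \<Rightarrow> nat list \<Rightarrow> bool" where
  "avoids_1342 X w \<longleftrightarrow> (\<forall>b c d e. b \<in> X \<and> b < c \<and> c < d \<and> d < e \<longrightarrow> \<not> subseq [b, d, e, c] w)"

definition avoids_231 :: "nat set \<Rightarrow> nat list \<Rightarrow> bool" where
  "avoids_231 X w \<longleftrightarrow> (\<forall>c d e. c \<in> X \<and> c < d \<and> d < e \<longrightarrow> \<not> subseq [d, e, c] w)"

text \<open>What is left of the pattern after 124: a letter of a later block followed by one of an
  earlier block would be the 5 and the 3. Blocks must therefore be read one after the other.\<close>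

definition blocks_ordered :: "nat set list \<Rightarrow> nat list \<Rightarrow> bool" where
  "blocks_ordered Hs w \<longleftrightarrow> sorted_wrt (\<lambda>H H'. \<forall>z\<in>H. \<forall>y\<in>H'. \<not> subseq [y, z] w) Hs"

definition separated :: "nat set \<Rightarrow> nat set \<Rightarrow> nat set list \<Rightarrow> bool" where
  "separated B0 B1 Hs \<longleftrightarrow> (\<forall>x\<in>B0. \<forall>y\<in>B1 \<union> \<Union> (set Hs). x < y) \<and> (\<forall>x\<in>B1. \<forall>y\<in>\<Union> (set Hs). x < y) \<and>
     sorted_wrt (\<lambda>X X'. \<forall>x\<in>X. \<forall>x'\<in>X'. x < x') Hs \<and> finite B0 \<and> finite B1 \<and> (\<forall>H\<in>set Hs. finite H \<and> H \<noteq> {})"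

text \<open>With the letters already read, a letter of band 1 is preceded by a smaller letter, so it may play the
  role of the 2 in 12453; a letter of a block is above an earlier ascent 12; and between two blocks there
  is a letter that plays the role of the 4.\<close>

definition completes :: "nat set \<Rightarrow> nat set \<Rightarrow> nat set list \<Rightarrow> nat list \<Rightarrow> bool" where
  "completes B0 B1 Hs w \<longleftrightarrow> distinct w \<and> set w = B0 \<union> B1 \<union> \<Union> (set Hs) \<and>
     avoids_12453 w \<and> avoids_1342 (B1 \<union> \<Union> (set Hs)) w \<and> avoids_231 (\<Union> (set Hs)) w \<and> blocks_ordered Hs w"

section \<open>Effect of a letter on the avoidance conditions\<close>

lemma avoids_12453_Cons: "avoids_12453 (v # w) \<longleftrightarrow> avoids_12453 w \<and> avoids_1342 {b. v < b} w"
proof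
  assume a: "avoids_12453 (v # w)"
  show "avoids_12453 w \<and> avoids_1342 {b. v < b} w"
  proof
    show "avoids_12453 w" using a unfolding avoids_12453_def by (meson list_emb_Cons)
    show "avoids_1342 {b. v < b} w" unfolding avoids_1342_def
    proof (intro allI impI)
      fix b c d e :: nat assume "b \<in> {b. v < b} \<and> b < c \<and> c < d \<and> d < e"
      hence "\<not> subseq [v, b, d, e, c] (v # w)" using a unfolding avoids_12453_def by blast
      thus "\<not> subseq [b, d, e, c] w" by simp
    qed
  qed
next
  assume a: "avoids_12453 w \<and> avoids_1342 {b. v < b} w"
  show "avoids_12453 (v # w)" unfolding avoids_12453_def
  proof (intro allI impI)
    fix a b c d e :: nat assume h: "a < b \<and> b < c \<and> c < d \<and> d < e"
    hence "\<not> subseq [a, b, d, e, c] w" "a = v \<Longrightarrow> \<not> subseq [b, d, e, c] w"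
      using a unfolding avoids_12453_def avoids_1342_def by blast+
    thus "\<not> subseq [a, b, d, e, c] (v # w)" by simp
  qed
qed

lemma avoids_1342_Cons: "avoids_1342 X (v # w) \<longleftrightarrow> avoids_1342 X w \<and> (v \<in> X \<longrightarrow> avoids_231 {c. v < c} w)"
proof
  assume a: "avoids_1342 X (v # w)"
  show "avoids_1342 X w \<and> (v \<in> X \<longrightarrow> avoids_231 {c. v < c} w)"
  proof (intro conjI impI)
    show "avoids_1342 X w" using a unfolding avoids_1342_def by (meson list_emb_Cons)
    assume v: "v \<in> X"
    show "avoids_231 {c. v < c} w" unfolding avoids_231_def
    proof (intro allI impI)
      fix c d e :: nat assume "c \<in> {c. v < c} \<and> c < d \<and> d < e"
      hence "\<not> subseq [v, d, e, c] (v # w)" using a v unfolding avoids_1342_def by blast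
      thus "\<not> subseq [d, e, c] w" by simp
    qed
  qed
next
  assume a: "avoids_1342 X w \<and> (v \<in> X \<longrightarrow> avoids_231 {c. v < c} w)"
  show "avoids_1342 X (v # w)" unfolding avoids_1342_def
  proof (intro allI impI)
    fix b c d e :: nat assume h: "b \<in> X \<and> b < c \<and> c < d \<and> d < e"
    hence "\<not> subseq [b, d, e, c] w" "b = v \<Longrightarrow> \<not> subseq [d, e, c] w"
      using a unfolding avoids_1342_def avoids_231_def by blast+
    thus "\<not> subseq [b, d, e, c] (v # w)" by simp
  qed
qed

lemma avoids_231_Cons: "avoids_231 X (v # w) \<longleftrightarrow> avoids_231 X w \<and> (\<forall>c\<in>X. \<forall>e. c < v \<and> v < e \<longrightarrow> \<not> subseq [e, c] w)"
proof
  assume a: "avoids_231 X (v # w)"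
  show "avoids_231 X w \<and> (\<forall>c\<in>X. \<forall>e. c < v \<and> v < e \<longrightarrow> \<not> subseq [e, c] w)"
  proof (intro conjI ballI allI impI)
    show "avoids_231 X w" using a unfolding avoids_231_def by (meson list_emb_Cons)
    fix c e :: nat assume "c \<in> X" "c < v \<and> v < e"
    hence "\<not> subseq [v, e, c] (v # w)" using a unfolding avoids_231_def by blast
    thus "\<not> subseq [e, c] w" by simp
  qed
next
  assume a: "avoids_231 X w \<and> (\<forall>c\<in>X. \<forall>e. c < v \<and> v < e \<longrightarrow> \<not> subseq [e, c] w)"
  show "avoids_231 X (v # w)" unfolding avoids_231_def
  proof (intro allI impI)
    fix c d e :: nat assume h: "c \<in> X \<and> c < d \<and> d < e"
    hence "\<not> subseq [d, e, c] w" "d = v \<Longrightarrow> \<not> subseq [e, c] w"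
      using a unfolding avoids_231_def by blast+
    thus "\<not> subseq [d, e, c] (v # w)" by simp
  qed
qed

lemma subseq2_Cons: "subseq [y, z] (v # w) \<longleftrightarrow> (if y = v then z \<in> set w else subseq [y, z] w)"
  by (simp add: subseq_singleton_left)

lemma avoids_1342_mono: "avoids_1342 X w \<Longrightarrow> X' \<inter> set w \<subseteq> X \<Longrightarrow> avoids_1342 X' w"
proof -
  assume a: "avoids_1342 X w" "X' \<inter> set w \<subseteq> X"
  show ?thesis unfolding avoids_1342_def
  proof (intro allI impI notI)
    fix b c d e :: nat assume h: "b \<in> X' \<and> b < c \<and> c < d \<and> d < e" and s: "subseq [b, d, e, c] w"
    have "b \<in> X" using subseq_imp_set[OF s] h a(2) by auto
    thus False using a(1) h s unfolding avoids_1342_def by blast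
  qed
qed

lemma avoids_231_mono: "avoids_231 X w \<Longrightarrow> X' \<inter> set w \<subseteq> X \<Longrightarrow> avoids_231 X' w"
proof -
  assume a: "avoids_231 X w" "X' \<inter> set w \<subseteq> X"
  show ?thesis unfolding avoids_231_def
  proof (intro allI impI notI)
    fix c d e :: nat assume h: "c \<in> X' \<and> c < d \<and> d < e" and s: "subseq [d, e, c] w"
    have "c \<in> X" using subseq_imp_set[OF s] h a(2) by auto
    thus False using a(1) h s unfolding avoids_231_def by blast
  qed
qed

lemma avoids_231_imp_1342: "avoids_231 {c. v < c} w \<Longrightarrow> avoids_1342 {c. v < c} w"
  unfolding avoids_1342_def avoids_231_def
proof (intro allI impI notI)
  fix b c d e
  assume a: "\<forall>c d e. c \<in> {c. v < c} \<and> c < d \<and> d < e \<longrightarrow> \<not> subseq [d, e, c] w"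
    and h: "b \<in> {c. v < c} \<and> b < c \<and> c < d \<and> d < e" and s: "subseq [b, d, e, c] w"
  have "subseq [d, e, c] w" by (rule subseq_Cons'[OF s])
  moreover have "c \<in> {c. v < c}" using h by auto
  ultimately show False using a h by blast
qed

text \<open>Produces a 231 across two blocks: a letter \<open>b\<close> of the lower block that does
  not follow \<open>y\<close> must precede it.\<close>

lemma subseq_insert_before:
  assumes "distinct w" "subseq [y, z] w" "b \<in> set w" "b \<noteq> y" "\<not> subseq [y, b] w"
  shows "subseq [b, y, z] w"
  using assms
proof (induction w)
  case (Cons x w)
  show ?case
  proof (cases "x = y")
    case True
    thus ?thesis using Cons.prems by (auto simp: subseq_singleton_left)
  next
    case False
    hence s: "subseq [y, z] w" using Cons.prems(2) by simp
    have nb: "\<not> subseq [y, b] w" using Cons.prems(5) list_emb_Cons by blast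
    show ?thesis
    proof (cases "x = b")
      case True thus ?thesis using s by simp
    next
      case f: False
      have "subseq [b, y, z] w" by (rule Cons.IH[OF _ s _ _ nb]) (use Cons.prems f in auto)
      thus ?thesis by (rule list_emb_Cons)
    qed
  qed
qed simp

lemma blocks_ordered_Cons_notin: "(\<And>H. H \<in> set Hs \<Longrightarrow> v \<notin> H) \<Longrightarrow> blocks_ordered Hs (v # w) \<longleftrightarrow> blocks_ordered Hs w"
  unfolding blocks_ordered_def by (induction Hs) (auto simp: subseq2_Cons simp del: subseq_Cons2_iff)

lemma separatedD:
  assumes "separated B0 B1 Hs"
  shows "a \<in> B0 \<Longrightarrow> b \<in> B1 \<Longrightarrow> a < b" "a \<in> B0 \<Longrightarrow> H \<in> set Hs \<Longrightarrow> b \<in> H \<Longrightarrow> a < b"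
    "a \<in> B1 \<Longrightarrow> H \<in> set Hs \<Longrightarrow> b \<in> H \<Longrightarrow> a < b"
  using assms by (auto simp: separated_def)

lemma separated_head:
  assumes "separated B0 B1 (H # Hs)"
  shows "a \<in> H \<Longrightarrow> H' \<in> set Hs \<Longrightarrow> b \<in> H' \<Longrightarrow> a < b"
  using assms by (auto simp: separated_def)

lemma set_Cons_iff: "v \<in> X \<Longrightarrow> distinct (v # w) \<and> set (v # w) = X \<longleftrightarrow> distinct w \<and> set w = X - {v}"
  by auto

text \<open>Every value above \<open>v\<close> now has a smaller letter before it and so belongs to
  band 1 or higher. Blocks lie above \<open>v\<close>, hence no 231 with its 3 in a block starts
  with \<open>v\<close>.\<close>

lemma completes_band0:
  assumes sep: "separated B0 B1 Hs" and v: "v \<in> B0"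
  shows "completes B0 B1 Hs (v # w) \<longleftrightarrow> completes (below B0 v) (B1 \<union> above B0 v) Hs w"
proof -
  let ?U = "\<Union> (set Hs)"
  note D = separatedD[OF sep]
  have vU: "v \<notin> B1 \<union> ?U" using D(1)[OF v] D(2)[OF v] less_irrefl by blast
  hence bl: "below B0 v \<union> (B1 \<union> above B0 v) \<union> ?U = B0 \<union> B1 \<union> ?U - {v}"
    using v by (auto simp: below_def above_def)
  show ?thesis
  proof (cases "distinct w \<and> set w = B0 \<union> B1 \<union> ?U - {v}")
    case False
    thus ?thesis unfolding completes_def bl using set_Cons_iff[of v "B0 \<union> B1 \<union> ?U" w] v by blast
  next
    case True
    have dv: "distinct (v # w) \<and> set (v # w) = B0 \<union> B1 \<union> ?U" using True v by auto
    have up: "{b. v < b} \<inter> set w \<subseteq> B1 \<union> above B0 v \<union> ?U" using True v by (auto simp: above_def)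
    have up': "(B1 \<union> above B0 v \<union> ?U) \<inter> set w \<subseteq> {b. v < b}" using v D by (auto simp: above_def)
    have A: "avoids_12453 (v # w) \<longleftrightarrow> avoids_12453 w \<and> avoids_1342 (B1 \<union> above B0 v \<union> ?U) w"
      unfolding avoids_12453_Cons using avoids_1342_mono[OF _ up] avoids_1342_mono[OF _ up'] by blast
    have B: "avoids_1342 (B1 \<union> above B0 v \<union> ?U) w \<Longrightarrow> avoids_1342 (B1 \<union> ?U) (v # w)"
      unfolding avoids_1342_Cons using vU by (auto intro: avoids_1342_mono)
    have C: "avoids_231 ?U (v # w) \<longleftrightarrow> avoids_231 ?U w"
      unfolding avoids_231_Cons using v D(2) by fastforce
    have O: "blocks_ordered Hs (v # w) \<longleftrightarrow> blocks_ordered Hs w"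
      using vU by (intro blocks_ordered_Cons_notin) auto
    show ?thesis unfolding completes_def bl using True dv A B C O by blast
  qed
qed

lemma blocks_ordered_append:
  "blocks_ordered (Gs @ Hs) w \<longleftrightarrow> blocks_ordered Gs w \<and> blocks_ordered Hs w \<and>
     (\<forall>z\<in>\<Union> (set Gs). \<forall>y\<in>\<Union> (set Hs). \<not> subseq [y, z] w)"
  unfolding blocks_ordered_def sorted_wrt_append by blast

definition nonempty :: "nat set list \<Rightarrow> nat set list" where
  "nonempty = filter (\<lambda>X. X \<noteq> {})"

text \<open>Values freed from band 1 are absorbed by an existing head because no letter separates
  them from it as a 4. States contain nonempty blocks only, so an empty set starts no block.\<close>

definition raise_head :: "nat set \<Rightarrow> nat set list \<Rightarrow> nat set list" where
  "raise_head X Hs = (case Hs of [] \<Rightarrow> nonempty [X] | H # r \<Rightarrow> (H \<union> X) # r)"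

lemma raise_head_Union: "\<Union> (set (raise_head X Hs)) = X \<union> \<Union> (set Hs)"
  by (auto simp: raise_head_def nonempty_def split: list.splits)

text \<open>\<open>v\<close> serves as the 2 of an earlier ascent, so the values above it come under
  the 231 condition. That they may be merged with the head, although the order of blocks then
  demands more, follows from this condition itself.\<close>

lemma completes_band1:
  assumes sep: "separated B0 B1 Hs" and v: "v \<in> B1"
  shows "completes B0 B1 Hs (v # w) \<longleftrightarrow> completes B0 (below B1 v) (raise_head (above B1 v) Hs) w"
proof -
  let ?U = "\<Union> (set Hs)" and ?Z = "above B1 v"
  note D = separatedD[OF sep]
  have bl: "B0 \<union> below B1 v \<union> (?Z \<union> ?U) = B0 \<union> B1 \<union> ?U - {v}"
    using v D by (fastforce simp: below_def above_def)
  have vU: "v \<notin> ?U" using D(3)[OF v] less_irrefl by blast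
  show ?thesis
  proof (cases "distinct w \<and> set w = B0 \<union> B1 \<union> ?U - {v}")
    case False
    thus ?thesis unfolding completes_def raise_head_Union bl using set_Cons_iff[of v "B0 \<union> B1 \<union> ?U" w] v by blast
  next
    case True
    have dv: "distinct (v # w) \<and> set (v # w) = B0 \<union> B1 \<union> ?U" using True v by auto
    have up: "{b. v < b} \<inter> set w \<subseteq> ?Z \<union> ?U" using True v D(1) by (fastforce simp: above_def)
    have up': "(?Z \<union> ?U) \<inter> set w \<subseteq> {b. v < b}" using v D by (auto simp: above_def)
    have AB: "avoids_12453 (v # w) \<and> avoids_1342 (B1 \<union> ?U) (v # w) \<longleftrightarrow> avoids_12453 w \<and> avoids_1342 (B1 \<union> ?U) w \<and> avoids_231 {c. v < c} w"
      unfolding avoids_12453_Cons avoids_1342_Cons using v avoids_231_imp_1342 by blast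
    have C': "avoids_231 {c. v < c} w \<longleftrightarrow> avoids_231 (?Z \<union> ?U) w"
      using avoids_231_mono[OF _ up] avoids_231_mono[OF _ up'] by blast
    have B': "avoids_1342 (B1 \<union> ?U) w \<longleftrightarrow> avoids_1342 (below B1 v \<union> (?Z \<union> ?U)) w"
    proof -
      have "(B1 \<union> ?U) \<inter> set w \<subseteq> below B1 v \<union> (?Z \<union> ?U)" "(below B1 v \<union> (?Z \<union> ?U)) \<inter> set w \<subseteq> B1 \<union> ?U"
        using True by (auto simp: below_def above_def)
      thus ?thesis using avoids_1342_mono by blast
    qed
    have C: "avoids_231 ?U (v # w) \<longleftrightarrow> avoids_231 ?U w"
      unfolding avoids_231_Cons using v D(3) by fastforce
    have C2: "avoids_231 (?Z \<union> ?U) w \<Longrightarrow> avoids_231 ?U w" by (erule avoids_231_mono) auto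
    have O: "blocks_ordered Hs (v # w) \<longleftrightarrow> blocks_ordered Hs w"
      using vU by (intro blocks_ordered_Cons_notin) auto
    have O': "blocks_ordered Hs w \<longleftrightarrow> blocks_ordered (raise_head ?Z Hs) w" if c: "avoids_231 (?Z \<union> ?U) w"
    proof (cases Hs)
      case Nil
      thus ?thesis by (simp add: raise_head_def nonempty_def blocks_ordered_def)
    next
      case (Cons H r)
      have "H \<noteq> {}" using sep by (auto simp: separated_def Cons)
      then obtain b where b: "b \<in> H" by blast
      have bw: "b \<in> set w" using b Cons True vU by auto
      \<comment> \<open>If \<open>y\<close> of a later block preceded \<open>z\<close>, then some
        \<open>b\<close> of the head would precede \<open>y\<close>, and \<open>b, y, z\<close> with
        \<open>z < b < y\<close> would be a forbidden 231.\<close>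
      have "\<not> subseq [y, z] w" if o: "blocks_ordered (H # r) w" and z: "z \<in> ?Z" and y: "H' \<in> set r" "y \<in> H'" for y z H'
      proof
        assume s: "subseq [y, z] w"
        have "\<not> subseq [y, b] w" using o b y by (auto simp: blocks_ordered_def)
        moreover have "b < y" using separated_head[OF sep[unfolded Cons]] b y by blast
        ultimately have "subseq [b, y, z] w" using subseq_insert_before[OF _ s bw] True by simp
        moreover have "z < b" using D(3)[of z H b] z b Cons by (auto simp: above_def)
        ultimately show False using c z \<open>b < y\<close> unfolding avoids_231_def by blast
      qed
      thus ?thesis unfolding Cons raise_head_def by (auto simp: blocks_ordered_def)
    qed
    show ?thesis unfolding completes_def raise_head_Union bl using True dv AB B' C C' C2 O O' by blast
  qed
qed

lemma nonempty_Union: "\<Union> (set (nonempty Hs)) = \<Union> (set Hs)"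
  by (auto simp: nonempty_def)

text \<open>Here \<open>v\<close> plays the 4 over an earlier ascent: no larger letter may precede a
  smaller letter of the head, so the lower part of the head must be read before its upper
  part.\<close>

lemma completes_head:
  assumes sep: "separated B0 B1 (H # r)" and v: "v \<in> H"
  shows "completes B0 B1 (H # r) (v # w) \<longleftrightarrow> completes B0 B1 (nonempty [below H v, above H v] @ r) w"
proof -
  let ?U = "\<Union> (set (H # r))" and ?V = "below H v \<union> above H v \<union> \<Union> (set r)"
  note D = separatedD[OF sep] and D' = separated_head[OF sep]
  have un: "\<Union> (set (nonempty [below H v, above H v] @ r)) = ?V"
    by (auto simp: nonempty_def)
  have vr: "v \<notin> B0 \<union> B1 \<union> \<Union> (set r)" 
    using D(2)[of v H v] D(3)[of v H v] D'[OF v, of _ v] v by auto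
  have vU: "v \<in> ?U" using v by simp
  have V: "?V = ?U - {v}" using v vr by (auto simp: below_def above_def)
  hence bl: "B0 \<union> B1 \<union> ?V = B0 \<union> B1 \<union> ?U - {v}" using vr by blast
  show ?thesis
  proof (cases "distinct w \<and> set w = B0 \<union> B1 \<union> ?U - {v}")
    case False
    thus ?thesis unfolding completes_def un bl using set_Cons_iff[of v "B0 \<union> B1 \<union> ?U" w, OF UnI2[OF vU]] by blast
  next
    case True
    have dv: "distinct (v # w) \<and> set (v # w) = B0 \<union> B1 \<union> ?U" using True v by auto
    have up: "{b. v < b} \<inter> set w \<subseteq> ?V" 
    proof
      fix x assume x: "x \<in> {b. v < b} \<inter> set w"
      have "x \<notin> B0" "x \<notin> B1" using D(2)[of x H v] D(3)[of x H v] v x by auto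
      moreover have "x \<in> B0 \<union> B1 \<union> ?U - {v}" using x True by blast
      ultimately show "x \<in> ?V" unfolding V by blast
    qed
    have C': "avoids_231 ?U w \<longleftrightarrow> avoids_231 ?V w"
    proof -
      have "?U \<inter> set w \<subseteq> ?V" "?V \<inter> set w \<subseteq> ?U" using True V by auto
      thus ?thesis using avoids_231_mono by blast
    qed
    have B': "avoids_1342 (B1 \<union> ?U) w \<longleftrightarrow> avoids_1342 (B1 \<union> ?V) w"
    proof -
      have "(B1 \<union> ?U) \<inter> set w \<subseteq> B1 \<union> ?V" "(B1 \<union> ?V) \<inter> set w \<subseteq> B1 \<union> ?U" using True V by auto
      thus ?thesis using avoids_1342_mono by blast
    qed
    have AB: "avoids_231 ?V w \<Longrightarrow> avoids_12453 (v # w) \<and> avoids_1342 (B1 \<union> ?U) (v # w) \<longleftrightarrow> avoids_12453 w \<and> avoids_1342 (B1 \<union> ?U) w"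
      unfolding avoids_12453_Cons avoids_1342_Cons using avoids_231_imp_1342 avoids_231_mono[OF _ up] by blast
    have O: "blocks_ordered (H # r) (v # w) \<longleftrightarrow> blocks_ordered (H # r) w"
    proof -
      have "y \<noteq> v" if "H' \<in> set r" "y \<in> H'" for H' y using that vr by auto
      hence "(\<forall>z\<in>H. \<forall>y\<in>H'. \<not> subseq [y, z] (v # w)) \<longleftrightarrow> (\<forall>z\<in>H. \<forall>y\<in>H'. \<not> subseq [y, z] w)" if "H' \<in> set r" for H'
        using that by (auto simp: subseq2_Cons simp del: subseq_Cons2_iff)
      moreover have "blocks_ordered r (v # w) \<longleftrightarrow> blocks_ordered r w"
        using vr by (intro blocks_ordered_Cons_notin) auto
      ultimately show ?thesis by (simp add: blocks_ordered_def)
    qed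
    have C: "avoids_231 ?U (v # w) \<and> blocks_ordered (H # r) w \<longleftrightarrow>
       avoids_231 ?U w \<and> (\<forall>z\<in>below H v. \<forall>y\<in>above H v. \<not> subseq [y, z] w) \<and> blocks_ordered (H # r) w"
    proof -
      \<comment> \<open>A larger letter from a later block is excluded by the existing order of
        blocks, so only the two parts of the head yield a new condition.\<close>
      have "\<not> subseq [e, c] w" if o: "blocks_ordered (H # r) w" and q: "\<forall>z\<in>below H v. \<forall>y\<in>above H v. \<not> subseq [y, z] w"
        and c: "c \<in> ?U" "c < v" "v < e" for c e
      proof
        assume s: "subseq [e, c] w"
        have "e \<in> ?V" using up c subseq_imp_set[OF s] by auto
        moreover have cH: "c \<in> below H v" using c D'[OF v] by (fastforce simp: below_def)
        ultimately have "e \<in> \<Union> (set r)" using q s c(3) by (auto simp: below_def)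
        moreover have "c \<in> H" using cH by (simp add: below_def)
        ultimately show False using o s by (auto simp: blocks_ordered_def)
      qed
      moreover have "\<not> subseq [y, z] w" if "avoids_231 ?U (v # w)" "z \<in> below H v" "y \<in> above H v" for y z
        using that unfolding avoids_231_Cons by (auto simp: below_def above_def)
      ultimately show ?thesis unfolding avoids_231_Cons by blast
    qed
    have O': "(\<forall>z\<in>below H v. \<forall>y\<in>above H v. \<not> subseq [y, z] w) \<and> blocks_ordered (H # r) w \<longleftrightarrow>
        blocks_ordered (nonempty [below H v, above H v] @ r) w"
    proof -
      have vw: "v \<notin> set w" using True by simp
      have nv: "\<not> subseq [y, v] w" for y using vw subseq_imp_set[of "[y, v]" w] by auto
      have bq: "(\<forall>z\<in>H. Q z) \<longleftrightarrow> (\<forall>z\<in>below H v \<union> above H v. Q z)" if "Q v" for Q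
      proof -
        have iff: "z \<in> H \<longleftrightarrow> z = v \<or> z \<in> below H v \<union> above H v" for z using v by (auto simp: below_def above_def)
        show ?thesis unfolding Ball_def iff using that by blast
      qed
      have "blocks_ordered (H # r) w \<longleftrightarrow> blocks_ordered r w \<and> (\<forall>z\<in>H. \<forall>y\<in>\<Union> (set r). \<not> subseq [y, z] w)"
        unfolding blocks_ordered_def sorted_wrt.simps by auto
      also have "(\<forall>z\<in>H. \<forall>y\<in>\<Union> (set r). \<not> subseq [y, z] w) \<longleftrightarrow>
          (\<forall>z\<in>below H v \<union> above H v. \<forall>y\<in>\<Union> (set r). \<not> subseq [y, z] w)"
        by (rule bq) (use nv in blast)
      finally have h: "blocks_ordered (H # r) w \<longleftrightarrow> blocks_ordered r w \<and> (\<forall>z\<in>below H v \<union> above H v. \<forall>y\<in>\<Union> (set r). \<not> subseq [y, z] w)" .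
      have "blocks_ordered (nonempty [below H v, above H v]) w \<longleftrightarrow> (\<forall>z\<in>below H v. \<forall>y\<in>above H v. \<not> subseq [y, z] w)"
        by (auto simp: blocks_ordered_def nonempty_def)
      thus ?thesis unfolding blocks_ordered_append nonempty_Union h by auto
    qed
    show ?thesis unfolding completes_def un bl using True dv AB B' C C' O O' by blast
  qed
qed

text \<open>A letter beyond the head would precede some value of the nonempty head, against the
  order of blocks.\<close>

lemma completes_first_letter:
  assumes sep: "separated B0 B1 Hs" and c: "completes B0 B1 Hs (v # w)"
  shows "v \<in> B0 \<or> v \<in> B1 \<or> (\<exists>H r. Hs = H # r \<and> v \<in> H)"
proof (rule ccontr)
  assume n: "\<not> ?thesis"
  have "v \<in> B0 \<union> B1 \<union> \<Union> (set Hs)" using c unfolding completes_def by auto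
  with n obtain H r H' where H: "Hs = H # r" "H' \<in> set r" "v \<in> H'" "v \<notin> H" by (cases Hs) auto
  then obtain z where z: "z \<in> H" using sep by (auto simp: separated_def)
  have "z \<in> set (v # w)" using c z H unfolding completes_def by auto
  hence "z \<in> set w" using z H by auto
  hence "subseq [v, z] (v # w)" by (simp add: subseq_singleton_left)
  moreover have "blocks_ordered (H # r) (v # w)" using c H by (simp add: completes_def)
  hence "\<not> subseq [v, z] (v # w)" unfolding blocks_ordered_def sorted_wrt.simps using H z by blast
  ultimately show False by blast
qed

section \<open>Separation of bands and blocks after reading a letter\<close>

lemma below_above_subset: "below B v \<subseteq> B" "above B v \<subseteq> B" "finite B \<Longrightarrow> finite (below B v)" "finite B \<Longrightarrow> finite (above B v)"
  by (auto simp: below_def above_def)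

lemma below_above_less: "x \<in> below B v \<Longrightarrow> y \<in> above B v \<Longrightarrow> x < y"
  by (auto simp: below_def above_def)

lemma separated_band0:
  assumes "separated B0 B1 Hs" shows "separated (below B0 v) (B1 \<union> above B0 v) Hs"
  unfolding separated_def
proof (intro conjI ballI)
  note sep = assms[unfolded separated_def]
  show "x < y" if "x \<in> below B0 v" "y \<in> B1 \<union> above B0 v \<union> \<Union> (set Hs)" for x y
    using that sep below_above_subset(1)[of B0 v] below_above_less[of x B0 v y] by blast
  show "x < y" if "x \<in> B1 \<union> above B0 v" "y \<in> \<Union> (set Hs)" for x y
    using that sep below_above_subset(2)[of B0 v] by blast
qed (use assms[unfolded separated_def] below_above_subset in auto)

lemma separated_band1:
  assumes "separated B0 B1 Hs" shows "separated B0 (below B1 v) (raise_head (above B1 v) Hs)"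
  unfolding separated_def raise_head_Union
proof (intro conjI ballI)
  note sep = assms[unfolded separated_def]
  show "x < y" if "x \<in> B0" "y \<in> below B1 v \<union> (above B1 v \<union> \<Union> (set Hs))" for x y
  proof -
    have "y \<in> B1 \<union> \<Union> (set Hs)" using that(2) below_above_subset[of B1 v] by auto
    thus ?thesis using sep that(1) by blast
  qed
  show "x < y" if "x \<in> below B1 v" "y \<in> above B1 v \<union> \<Union> (set Hs)" for x y
    using that sep below_above_subset[of B1 v] below_above_less[of x B1 v y] by blast
  show "sorted_wrt (\<lambda>X X'. \<forall>x\<in>X. \<forall>x'\<in>X'. x < x') (raise_head (above B1 v) Hs)"
  proof (cases Hs)
    case Nil
    show ?thesis by (simp add: Nil raise_head_def nonempty_def)
  next
    case (Cons H r)
    have "x < y" if "x \<in> H \<union> above B1 v" "H' \<in> set r" "y \<in> H'" for x y H'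
    proof -
      have "x \<in> H \<or> x \<in> B1" using that(1) below_above_subset(2)[of B1 v] by auto
      thus ?thesis using sep that(2,3) unfolding Cons by auto
    qed
    thus ?thesis using sep unfolding Cons raise_head_def by auto
  qed
  show "finite H" if "H \<in> set (raise_head (above B1 v) Hs)" for H
    using that sep below_above_subset(4)[of B1 v] by (cases Hs) (auto simp: raise_head_def nonempty_def split: if_splits)
  show "H \<noteq> {}" if "H \<in> set (raise_head (above B1 v) Hs)" for H
    using that sep by (cases Hs) (auto simp: raise_head_def nonempty_def split: if_splits)
qed (use assms[unfolded separated_def] below_above_subset in auto)

lemma separated_head_read:
  assumes "separated B0 B1 (H # r)"
  shows "separated B0 B1 (nonempty [below H v, above H v] @ r)"
proof -
  note sep = assms[unfolded separated_def]
  have un: "\<Union> (set (nonempty [below H v, above H v] @ r)) \<subseteq> \<Union> (set (H # r))"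
    using below_above_subset[of H v] by (auto simp: nonempty_def)
  show ?thesis unfolding separated_def
  proof (intro conjI ballI)
    show "x < y" if "x \<in> B0" "y \<in> B1 \<union> \<Union> (set (nonempty [below H v, above H v] @ r))" for x y
    proof -
      have "y \<in> B1 \<union> \<Union> (set (H # r))" using that(2) un by auto
      thus ?thesis using sep that(1) by blast
    qed
    show "x < y" if "x \<in> B1" "y \<in> \<Union> (set (nonempty [below H v, above H v] @ r))" for x y
    proof -
      have "y \<in> \<Union> (set (H # r))" using that(2) un by auto
      thus ?thesis using sep that(1) by blast
    qed
    have "x < y" if "x \<in> \<Union> (set (nonempty [below H v, above H v]))" "H' \<in> set r" "y \<in> H'" for x y H'
    proof -
      have "x \<in> below H v \<union> above H v" using that(1) unfolding nonempty_Union by simp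
      hence "x \<in> H" using below_above_subset[of H v] by auto
      thus ?thesis using sep that by auto
    qed
    moreover have "sorted_wrt (\<lambda>X X'. \<forall>x\<in>X. \<forall>x'\<in>X'. x < x') (nonempty [below H v, above H v])"
      using below_above_less[of _ H v] by (auto simp: nonempty_def)
    ultimately show "sorted_wrt (\<lambda>X X'. \<forall>x\<in>X. \<forall>x'\<in>X'. x < x') (nonempty [below H v, above H v] @ r)"
      using sep unfolding sorted_wrt_append by auto
    show "finite X" if "X \<in> set (nonempty [below H v, above H v] @ r)" for X
      using that sep below_above_subset[of H v] by (auto simp: nonempty_def split: if_splits)
    show "X \<noteq> {}" if "X \<in> set (nonempty [below H v, above H v] @ r)" for X
      using that sep by (auto simp: nonempty_def split: if_splits)
  qed (use sep in auto)
qed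

section \<open>Moves and completions\<close>

text \<open>The controls at which the blocks of a state become exhausted when the word is read.\<close>

primrec exposures :: "nat list \<Rightarrow> nat set \<Rightarrow> nat set \<Rightarrow> nat set list \<Rightarrow> (nat \<times> nat) list" where
  "exposures [] B0 B1 Hs = []"
| "exposures (v # w) B0 B1 Hs =
     (if v \<in> B0 then exposures w (below B0 v) (B1 \<union> above B0 v) Hs
      else case Hs of [] \<Rightarrow> [] | H # r \<Rightarrow>
        if v \<in> B1 then exposures w B0 (below B1 v) ((H \<union> above B1 v) # r)
        else (let es = exposures w B0 B1 (nonempty [below H v, above H v] @ r) in
          if below H v = {} \<and> above H v = {} then (card B0, card B1) # es
          else if below H v = {} \<or> above H v = {} then es else tl es))"

text \<open>Possible later band sizes: band 0 never grows, the total never grows, and a loss in band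
  0 means that a letter has been read. With \<open>a = p - c\<close> this is the support condition
  of the tables.\<close>

definition reaches :: "nat \<Rightarrow> nat \<Rightarrow> nat \<Rightarrow> nat \<Rightarrow> bool" where
  "reaches p q c t \<longleftrightarrow> c \<le> p \<and> c + t \<le> p + q \<and> (c < p \<longrightarrow> c + t < p + q)"

fun reach_chain :: "nat \<Rightarrow> nat \<Rightarrow> (nat \<times> nat) list \<Rightarrow> bool" where
  "reach_chain p q [] = True"
| "reach_chain p q ((c, t) # es) = (reaches p q c t \<and> reach_chain c t es)"

lemma reach_chain_trans: "reaches p q p' q' \<Longrightarrow> reach_chain p' q' es \<Longrightarrow> reach_chain p q es"
  by (cases es) (auto simp: reaches_def)

lemma reaches_support: "reaches p q c t \<Longrightarrow> 1 \<le> l \<Longrightarrow> in_support l (p - c) q t"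
  by (auto simp: reaches_def in_support_def)

text \<open>Only blocks present at the start are tracked; a block cut off later receives its target
  when it is formed.\<close>

lemma exposures_Nil: "exposures w B0 B1 [] = []"
  by (induction w arbitrary: B0 B1) auto

lemma card_below_above:
  assumes "finite B" "v \<in> B" shows "card (below B v) + card (above B v) + 1 = card B"
proof -
  have B: "B = insert v (below B v \<union> above B v)" using assms(2) by (auto simp: below_def above_def)
  have "card (insert v (below B v \<union> above B v)) = Suc (card (below B v \<union> above B v))"
    using assms(1) by (intro card_insert_disjoint) (auto simp: below_def above_def)
  also have "card (below B v \<union> above B v) = card (below B v) + card (above B v)"
    using assms(1) by (intro card_Un_disjoint) (auto simp: below_def above_def)
  finally show ?thesis using B by simp
qed

lemma card_band1_join:
  assumes "separated B0 B1 Hs" shows "card (B1 \<union> above B0 v) = card B1 + card (above B0 v)"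
proof (rule card_Un_disjoint)
  show "B1 \<inter> above B0 v = {}"
  proof (rule equals0I)
    fix x assume "x \<in> B1 \<inter> above B0 v"
    hence "x \<in> B1" "x \<in> B0" by (auto simp: above_def)
    thus False using separatedD(1)[OF assms, of x x] by simp
  qed
qed (use assms below_above_subset in \<open>auto simp: separated_def\<close>)

lemma separated_notin:
  assumes "separated B0 B1 Hs"
  shows "v \<in> B1 \<Longrightarrow> v \<notin> B0" "H \<in> set Hs \<Longrightarrow> v \<in> H \<Longrightarrow> v \<notin> B0 \<and> v \<notin> B1"
  using separatedD(1)[OF assms, of v v] separatedD(2,3)[OF assms, of v H v] by auto

text \<open>Ensures that the targets realized by a completion lie in the support, so that the move
  belonging to a completion is among the candidates.\<close>

lemma exposures_chain:
  assumes "separated B0 B1 Hs" "completes B0 B1 Hs w"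
  shows "length (exposures w B0 B1 Hs) = length Hs \<and> reach_chain (card B0) (card B1) (exposures w B0 B1 Hs)"
  using assms
proof (induction w arbitrary: B0 B1 Hs)
  case Nil
  hence "\<Union> (set Hs) = {}" by (simp add: completes_def)
  hence "Hs = []" using Nil.prems(1) by (cases Hs) (auto simp: separated_def)
  thus ?case by simp
next
  case (Cons v w)
  note sep = Cons.prems(1)
  have fin: "finite B0" "finite B1" using sep by (auto simp: separated_def)
  show ?case
  proof (cases "v \<in> B0")
    case True
    have "completes (below B0 v) (B1 \<union> above B0 v) Hs w" using completes_band0[OF sep True] Cons.prems(2) by blast
    note IH = Cons.IH[OF separated_band0[OF sep] this]
    have "reaches (card B0) (card B1) (card (below B0 v)) (card (B1 \<union> above B0 v))"
      using card_below_above[OF fin(1) True] card_band1_join[OF sep, of v] by (simp add: reaches_def)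
    thus ?thesis using IH True reach_chain_trans by auto
  next
    case F0: False
    show ?thesis
    proof (cases Hs)
      case Nil
      thus ?thesis using F0 by simp
    next
      case H: (Cons H r)
      show ?thesis
      proof (cases "v \<in> B1")
        case True
        have "completes B0 (below B1 v) (raise_head (above B1 v) Hs) w" using completes_band1[OF sep True] Cons.prems(2) by blast
        note IH = Cons.IH[OF separated_band1[OF sep] this]
        have "reaches (card B0) (card B1) (card B0) (card (below B1 v))"
          using card_below_above[OF fin(2) True] by (simp add: reaches_def)
        thus ?thesis using IH True F0 reach_chain_trans by (auto simp: H raise_head_def)
      next
        case False
        hence v: "v \<in> H" using completes_first_letter[OF sep Cons.prems(2)] F0 H by auto
        have "completes B0 B1 (nonempty [below H v, above H v] @ r) w"
          using completes_head[OF sep[unfolded H] v] Cons.prems(2) H by blast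
        note IH = Cons.IH[OF separated_head_read[OF sep[unfolded H]] this]
        define es where "es = exposures w B0 B1 (nonempty [below H v, above H v] @ r)"
        \<comment> \<open>When the head splits into two nonempty parts, the recursion reports the
          lower part first. The old head is exhausted only with its upper part, so that first entry
          is dropped.\<close>
        have tl: "reach_chain p q (tl es)" if "reach_chain p q es" for p q
          using that by (cases es) (auto intro: reach_chain_trans)
        have r: "reaches p q p q" for p q by (simp add: reaches_def)
        show ?thesis using IH F0 False r tl
          by (cases "below H v = {}"; cases "above H v = {}") (simp_all add: H es_def Let_def nonempty_def)
      qed
    qed
  qed
qed

subsection \<open>The states reached by the sampler\<close>

text \<open>Nothing is demanded of \<open>t\<close>: moves may lead to a control outside the
  support. Such a state has no completion and weight zero.\<close>

fun target_chain :: "nat \<Rightarrow> (nat set \<times> nat \<times> nat) list \<Rightarrow> bool" where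
  "target_chain p [] = True"
| "target_chain p ((H, c, t) # bs) = (c \<le> p \<and> target_chain c bs)"

definition good_state :: "state \<Rightarrow> bool" where
  "good_state st \<longleftrightarrow> separated (band0 st) (band1 st) (map fst (blocks st)) \<and> target_chain (card (band0 st)) (blocks st)"

definition completion :: "state \<Rightarrow> nat list \<Rightarrow> bool" where
  "completion st w \<longleftrightarrow> completes (band0 st) (band1 st) (map fst (blocks st)) w \<and>
     exposures w (band0 st) (band1 st) (map fst (blocks st)) = map snd (blocks st)"

text \<open>This excludes exactly the reading of the last head value at a control other than the
  target.\<close>

definition legal :: "control \<Rightarrow> move set" where
  "legal k = {m \<in> moves k. coef k m \<noteq> 0}"

definition moved :: "state \<Rightarrow> state \<Rightarrow> nat \<Rightarrow> nat set \<Rightarrow> nat set \<Rightarrow> (nat set \<times> nat \<times> nat) list \<Rightarrow> bool" where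
  "moved st st' v B0 B1 bs \<longleftrightarrow> band0 st' = B0 \<and> band1 st' = B1 \<and> blocks st' = bs \<and> letters st' = letters st @ [v]"

section \<open>Moves in terms of the letters they read\<close>

lemma below_nth_least:
  assumes "finite B" "i < card B"
  shows "nth_least B i \<in> B" "card (below B (nth_least B i)) = i"
proof -
  define xs where "xs = sorted_list_of_set B"
  have xs: "sorted_wrt (<) xs" "set xs = B" "length xs = card B" "distinct xs"
    using assms(1) by (auto simp: xs_def strict_sorted_list_of_set)
  show "nth_least B i \<in> B" using assms xs by (metis nth_least_def nth_mem xs_def)
  have "below B (nth_least B i) = (!) xs ` {..<i}"
  proof (intro set_eqI iffI)
    fix x assume "x \<in> below B (nth_least B i)"
    hence x: "x \<in> set xs" "x < xs ! i" by (auto simp: below_def nth_least_def xs_def[symmetric] xs)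
    then obtain j where j: "j < length xs" "x = xs ! j" by (metis in_set_conv_nth)
    have "j < i"
    proof (rule ccontr)
      assume "\<not> j < i"
      hence "xs ! i \<le> xs ! j" using xs(1) j by (metis le_neq_implies_less less_imp_le not_less order_refl sorted_wrt_nth_less)
      thus False using x j by simp
    qed
    thus "x \<in> (!) xs ` {..<i}" using j by blast
  next
    fix x assume "x \<in> (!) xs ` {..<i}"
    then obtain j where "j < i" "x = xs ! j" by blast
    thus "x \<in> below B (nth_least B i)"
      using assms xs sorted_wrt_nth_less[OF xs(1), of j i] by (auto simp: below_def nth_least_def xs_def[symmetric])
  qed
  also have "card \<dots> = i"
    using xs assms by (subst card_image) (auto intro!: inj_onI simp: nth_eq_iff_index_eq)
  finally show "card (below B (nth_least B i)) = i" .
qed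

lemma card_below_inj:
  assumes "finite B" "v \<in> B" "v' \<in> B" "card (below B v) = card (below B v')" shows "v = v'"
proof -
  have "card (below B x) < card (below B y)" if "x < y" "x \<in> B" for x y
    using that assms(1) by (intro psubset_card_mono) (auto simp: below_def)
  thus ?thesis using assms by (metis less_irrefl linorder_neqE_nat)
qed

text \<open>A case rule that translates the indices of the sampler into the letter \<open>v\<close>
  and the sets \<open>below\<close> and \<open>above\<close>, the form in which completions are
  described.\<close>

lemma free_move:
  assumes g: "good_state st" and b: "blocks st = []" and m: "m \<in> legal (control_of st)"
  obtains (Band0) v h where "m = Read_Band0 h" "v \<in> band0 st" "h = card (below (band0 st) v)"
      "moved st (apply_move st m) v (below (band0 st) v) (band1 st \<union> above (band0 st) v) []"
  | (Band1) v where "m = Read_Greatest_Band1" "v \<in> band1 st" "above (band1 st) v = {}"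
      "moved st (apply_move st m) v (band0 st) (below (band1 st) v) []"
  | (Cut) v h c t where "m = Cut_Band1 h c t" "v \<in> band1 st" "h = card (below (band1 st) v)" "above (band1 st) v \<noteq> {}"
      "c \<le> card (band0 st)"
      "moved st (apply_move st m) v (band0 st) (below (band1 st) v) [(above (band1 st) v, c, t)]"
proof -
  have fin: "finite (band0 st)" "finite (band1 st)" using g by (auto simp: good_state_def separated_def)
  have "m \<in> moves (Free (card (band0 st)) (card (band1 st)))" using m b by (simp add: legal_def)
  then consider h where "m = Read_Band0 h" "h < card (band0 st)"
    | "m = Read_Greatest_Band1" "card (band1 st) \<ge> 1"
    | h c t where "m = Cut_Band1 h c t" "h + 2 \<le> card (band1 st)" "c \<le> card (band0 st)"
    unfolding moves_Free by (auto simp: cut_indices_def split: if_splits)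
  thus ?thesis
  proof cases
    case (1 h)
    note n = below_nth_least[OF fin(1) 1(2)]
    show ?thesis
    proof (rule Band0[OF 1(1) n(1) n(2)[symmetric]])
      show "moved st (apply_move st m) (nth_least (band0 st) h) (below (band0 st) (nth_least (band0 st) h))
        (band1 st \<union> above (band0 st) (nth_least (band0 st) h)) []"
        by (simp add: moved_def apply_move_def 1(1) b read_letter_def case_prod_unfold Let_def)
    qed
  next
    case 2
    hence ne: "band1 st \<noteq> {}" by auto
    have a: "above (band1 st) (Max (band1 st)) = {}" using Max_ge[OF fin(2)] by (auto simp: above_def not_less)
    have bl: "below (band1 st) (Max (band1 st)) = band1 st - {Max (band1 st)}"
      using Max_ge[OF fin(2)] by (auto simp: below_def order_less_le)
    show ?thesis
    proof (rule Band1[OF 2(1) Max_in[OF fin(2) ne] a])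
      show "moved st (apply_move st m) (Max (band1 st)) (band0 st) (below (band1 st) (Max (band1 st))) []"
        unfolding bl by (simp add: moved_def apply_move_def 2(1) b read_letter_def case_prod_unfold Let_def)
    qed
  next
    case (3 h c t)
    have h: "h < card (band1 st)" using 3 by simp
    note n = below_nth_least[OF fin(2) h]
    have "card (above (band1 st) (nth_least (band1 st) h)) \<noteq> 0"
      using card_below_above[OF fin(2) n(1)] n(2) 3(2) by simp
    hence a: "above (band1 st) (nth_least (band1 st) h) \<noteq> {}" by auto
    show ?thesis
    proof (rule Cut[OF 3(1) n(1) n(2)[symmetric] a 3(3)])
      show "moved st (apply_move st m) (nth_least (band1 st) h) (band0 st) (below (band1 st) (nth_least (band1 st) h))
        [(above (band1 st) (nth_least (band1 st) h), c, t)]"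
        by (simp add: moved_def apply_move_def 3(1) b read_letter_def case_prod_unfold Let_def)
    qed
  qed
qed

lemma exposing_move:
  assumes g: "good_state st" and b: "blocks st = (H, c, t) # bs" and m: "m \<in> legal (control_of st)"
  obtains (Band0) v h where "m = Read_Band0 h" "v \<in> band0 st" "c + h = card (below (band0 st) v)"
      "moved st (apply_move st m) v (below (band0 st) v) (band1 st \<union> above (band0 st) v) ((H, c, t) # bs)"
  | (Join) v r where "m = Join_Band1 r" "v \<in> band1 st" "r = card (below (band1 st) v)"
      "moved st (apply_move st m) v (band0 st) (below (band1 st) v) ((H \<union> above (band1 st) v, c, t) # bs)"
  | (Only) v where "m = Read_Only" "v \<in> H" "below H v = {}" "above H v = {}" "c = card (band0 st)" "t = card (band1 st)"
      "moved st (apply_move st m) v (band0 st) (band1 st) bs"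
  | (Least) v where "m = Read_Least" "v \<in> H" "below H v = {}" "above H v \<noteq> {}"
      "moved st (apply_move st m) v (band0 st) (band1 st) ((above H v, c, t) # bs)"
  | (Greatest) v where "m = Read_Greatest" "v \<in> H" "below H v \<noteq> {}" "above H v = {}"
      "moved st (apply_move st m) v (band0 st) (band1 st) ((below H v, c, t) # bs)"
  | (Split) v l1 l2 a1 a2 m' where "m = Split_Head l1 l2 a1 a2 m'" "v \<in> H" "below H v \<noteq> {}" "above H v \<noteq> {}"
      "l1 = card (below H v)" "l2 = card (above H v)" "a1 + a2 = card (band0 st) - c"
      "moved st (apply_move st m) v (band0 st) (band1 st) ((below H v, c + a2, m') # (above H v, c, t) # bs)"
proof -
  have fin: "finite (band0 st)" "finite (band1 st)" "finite H" "H \<noteq> {}" and c: "c \<le> card (band0 st)"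
    using g by (auto simp: good_state_def separated_def b)
  have "m \<in> moves (Exposing (card H) (card (band0 st) - c) (card (band1 st)) t)"
    and "coef (Exposing (card H) (card (band0 st) - c) (card (band1 st)) t) m \<noteq> 0" using m b by (simp_all add: legal_def)
  then consider h where "m = Read_Band0 h" "h < card (band0 st) - c"
    | r where "m = Join_Band1 r" "r < card (band1 st)"
    | "m = Read_Only" "card H = 1" "card (band0 st) - c = 0" "card (band1 st) = t"
    | "m = Read_Least" "card H \<ge> 2"
    | "m = Read_Greatest" "card H \<ge> 2"
    | l1 l2 a1 a2 m' where "m = Split_Head l1 l2 a1 a2 m'" "1 \<le> l1" "1 \<le> l2" "l1 + l2 + 1 = card H" "a1 + a2 = card (band0 st) - c"
    unfolding moves_Exposing by (auto simp: split_indices_def split: if_splits)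
  thus ?thesis
  proof cases
    case (1 h)
    have h: "c + h < card (band0 st)" using 1 c by simp
    note n = below_nth_least[OF fin(1) h]
    show ?thesis
    proof (rule Band0[OF 1(1) n(1) n(2)[symmetric]])
      show "moved st (apply_move st m) (nth_least (band0 st) (c + h)) (below (band0 st) (nth_least (band0 st) (c + h)))
        (band1 st \<union> above (band0 st) (nth_least (band0 st) (c + h))) ((H, c, t) # bs)"
        by (simp add: moved_def apply_move_def 1(1) b read_letter_def Let_def)
    qed
  next
    case (2 r)
    note n = below_nth_least[OF fin(2) 2(2)]
    show ?thesis
    proof (rule Join[OF 2(1) n(1) n(2)[symmetric]])
      show "moved st (apply_move st m) (nth_least (band1 st) r) (band0 st) (below (band1 st) (nth_least (band1 st) r))
        ((H \<union> above (band1 st) (nth_least (band1 st) r), c, t) # bs)"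
        by (simp add: moved_def apply_move_def 2(1) b read_letter_def Let_def)
    qed
  next
    case 3
    then obtain v where v: "H = {v}" by (metis card_1_singletonE)
    show ?thesis
    proof (rule Only[OF 3(1), of v])
      show "moved st (apply_move st m) v (band0 st) (band1 st) bs"
        by (simp add: moved_def apply_move_def 3(1) b read_letter_def Let_def v)
    qed (use v 3 c in \<open>auto simp: below_def above_def\<close>)
  next
    case 4
    have bl: "below H (Min H) = {}" using Min_le[OF fin(3)] by (auto simp: below_def not_less)
    have ab: "above H (Min H) = H - {Min H}" using Min_le[OF fin(3)] by (auto simp: above_def order_less_le)
    have "card (above H (Min H)) \<noteq> 0" using card_below_above[OF fin(3) Min_in[OF fin(3,4)]] bl 4 by simp
    hence ne: "above H (Min H) \<noteq> {}" by auto
    show ?thesis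
    proof (rule Least[OF 4(1) Min_in[OF fin(3,4)] bl ne])
      show "moved st (apply_move st m) (Min H) (band0 st) (band1 st) ((above H (Min H), c, t) # bs)"
        unfolding ab by (simp add: moved_def apply_move_def 4(1) b read_letter_def Let_def)
    qed
  next
    case 5
    have ab: "above H (Max H) = {}" using Max_ge[OF fin(3)] by (auto simp: above_def not_less)
    have bl: "below H (Max H) = H - {Max H}" using Max_ge[OF fin(3)] by (auto simp: below_def order_less_le)
    have "card (below H (Max H)) \<noteq> 0" using card_below_above[OF fin(3) Max_in[OF fin(3,4)]] ab 5 by simp
    hence ne: "below H (Max H) \<noteq> {}" by auto
    show ?thesis
    proof (rule Greatest[OF 5(1) Max_in[OF fin(3,4)] ne ab])
      show "moved st (apply_move st m) (Max H) (band0 st) (band1 st) ((below H (Max H), c, t) # bs)"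
        unfolding bl by (simp add: moved_def apply_move_def 5(1) b read_letter_def Let_def)
    qed
  next
    case (6 l1 l2 a1 a2 m')
    have l: "l1 < card H" using 6 by simp
    note n = below_nth_least[OF fin(3) l]
    have l2: "card (above H (nth_least H l1)) = l2" using card_below_above[OF fin(3) n(1)] n(2) 6 by simp
    have ne: "below H (nth_least H l1) \<noteq> {}" "above H (nth_least H l1) \<noteq> {}" using n(2) l2 6 by auto
    show ?thesis
    proof (rule Split[OF 6(1) n(1) ne n(2)[symmetric] l2[symmetric] 6(5)])
      show "moved st (apply_move st m) (nth_least H l1) (band0 st) (band1 st)
        ((below H (nth_least H l1), c + a2, m') # (above H (nth_least H l1), c, t) # bs)"
        by (simp add: moved_def apply_move_def 6(1) b read_letter_def Let_def)
    qed
  qed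
qed

definition next_letter :: "state \<Rightarrow> move \<Rightarrow> nat" where
  "next_letter st m = last (letters (apply_move st m))"

lemma moved_letter: "moved st (apply_move st m) v B0 B1 bs \<Longrightarrow> next_letter st m = v"
  by (simp add: moved_def next_letter_def)

text \<open>The letter alone does not reveal the target of a new block; it is read off the rest of
  the word by \<open>exposures\<close>. The move is thus a function of the whole completion.\<close>

definition move_reading :: "state \<Rightarrow> nat \<Rightarrow> nat list \<Rightarrow> move" where
  "move_reading st v w = (let B0 = band0 st; B1 = band1 st in case blocks st of
     [] \<Rightarrow> if v \<in> B0 then Read_Band0 (card (below B0 v))
       else if above B1 v = {} then Read_Greatest_Band1
       else (case hd (exposures w B0 (below B1 v) [above B1 v]) of (c, t) \<Rightarrow> Cut_Band1 (card (below B1 v)) c t)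
   | (H, c, t) # bs \<Rightarrow> if v \<in> B0 then Read_Band0 (card (below B0 v) - c)
       else if v \<in> B1 then Join_Band1 (card (below B1 v))
       else if below H v = {} \<and> above H v = {} then Read_Only
       else if below H v = {} then Read_Least
       else if above H v = {} then Read_Greatest
       else (case hd (exposures w B0 B1 (below H v # above H v # map fst bs)) of (c', t') \<Rightarrow>
         Split_Head (card (below H v)) (card (above H v)) (card B0 - c') (c' - c) t'))"

text \<open>The entry of the head is scaled for \<open>l + a + q\<close> letters, but only
  \<open>l + a + q - t\<close> of them are read before the exposure; \<open>4 ^ t\<close> corrects
  this. As a result \<open>4 ^ n\<close> times the weight is a product of unscaled entries.\<close>

fun state_weight :: "nat \<Rightarrow> nat \<Rightarrow> (nat set \<times> nat \<times> nat) list \<Rightarrow> real" where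
  "state_weight p q [] = exact (Free p q)"
| "state_weight p q ((H, c, t) # bs) = exact (Exposing (card H) (p - c) q t) * 4 ^ t * state_weight c t bs"

definition weight_of :: "state \<Rightarrow> real" where
  "weight_of st = state_weight (card (band0 st)) (card (band1 st)) (blocks st)"

lemma four_powi: "4 * (4::real) powi (int m - 1) = 4 ^ m"
  by (simp add: power_int_diff)

text \<open>The factor 4 compensates for the letter read, since the count belonging to a weight
  carries \<open>4 ^ n\<close> with \<open>n\<close> unread letters. The last conjunct makes the
  move recoverable from the word, which later gives disjointness.\<close>

lemma free_move_props:
  assumes g: "good_state st" and b: "blocks st = []" and m: "m \<in> legal (control_of st)"
  shows "good_state (apply_move st m) \<and> letters (apply_move st m) = letters st @ [next_letter st m] \<and>
    weight_of (apply_move st m) = 4 * weight exact (control_of st) m \<and>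
    (completion (apply_move st m) w \<longrightarrow> completion st (next_letter st m # w) \<and> m = move_reading st (next_letter st m) w)"
proof -
  define B0 where "B0 = band0 st"
  define B1 where "B1 = band1 st"
  have sep: "separated B0 B1 []" using g by (simp add: good_state_def b B0_def B1_def)
  have fin: "finite B0" "finite B1" using sep by (auto simp: separated_def)
  have k: "control_of st = Free (card B0) (card B1)" by (simp add: b B0_def B1_def)
  show ?thesis
  proof (rule free_move[OF g b m, folded B0_def B1_def])
    fix v h assume mm: "m = Read_Band0 h" and v: "v \<in> B0" and h: "h = card (below B0 v)"
      and mv: "moved st (apply_move st m) v (below B0 v) (B1 \<union> above B0 v) []"
    note l = moved_letter[OF mv]
    have c: "card (B1 \<union> above B0 v) = card B0 + card B1 - 1 - h"
      using card_band1_join[OF sep, of v] card_below_above[OF fin(1) v] h by simp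
    have "good_state (apply_move st m)" using mv separated_band0[OF sep, of v] by (simp add: moved_def good_state_def)
    moreover have "weight_of (apply_move st m) = 4 * weight exact (control_of st) m"
      using mv c h unfolding k by (simp add: moved_def weight_of_def mm weight_def)
    moreover have "completion (apply_move st m) w \<longrightarrow> completion st (v # w)"
      using mv completes_band0[OF sep v, of w] by (simp add: moved_def completion_def b B0_def B1_def exposures_Nil)
    moreover have "m = move_reading st v w" using v h by (simp add: move_reading_def b B0_def mm)
    ultimately show ?thesis using l mv by (simp add: moved_def)
  next
    fix v assume mm: "m = Read_Greatest_Band1" and v: "v \<in> B1" and a: "above B1 v = {}"
      and mv: "moved st (apply_move st m) v B0 (below B1 v) []"
    note l = moved_letter[OF mv]
    have nv: "v \<notin> B0" using separated_notin(1)[OF sep v] .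
    have c: "card (below B1 v) = card B1 - 1" using card_below_above[OF fin(2) v] a by simp
    have r: "raise_head (above B1 v) [] = []" by (simp add: raise_head_def nonempty_def a)
    have "good_state (apply_move st m)" using mv separated_band1[OF sep, of v] r by (simp add: moved_def good_state_def)
    moreover have "weight_of (apply_move st m) = 4 * weight exact (control_of st) m"
      using mv c unfolding k by (simp add: moved_def weight_of_def mm weight_def)
    moreover have "completion (apply_move st m) w \<longrightarrow> completion st (v # w)"
      using mv completes_band1[OF sep v, of w] r by (simp add: moved_def completion_def b B0_def B1_def exposures_Nil)
    moreover have "m = move_reading st v w" using nv a by (simp add: move_reading_def b B0_def B1_def mm)
    ultimately show ?thesis using l mv by (simp add: moved_def)
  next
    fix v h c t assume mm: "m = Cut_Band1 h c t" and v: "v \<in> B1" and h: "h = card (below B1 v)" and a: "above B1 v \<noteq> {}"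
      and ct: "c \<le> card B0" and mv: "moved st (apply_move st m) v B0 (below B1 v) [(above B1 v, c, t)]"
    note l = moved_letter[OF mv]
    have nv: "v \<notin> B0" using separated_notin(1)[OF sep v] .
    have r: "raise_head (above B1 v) [] = [above B1 v]" using a by (simp add: raise_head_def nonempty_def)
    have q: "card (above B1 v) = card B1 - 1 - h" using card_below_above[OF fin(2) v] h by simp
    have "good_state (apply_move st m)" using mv separated_band1[OF sep, of v] r ct by (simp add: moved_def good_state_def)
    moreover have "weight_of (apply_move st m) = 4 * weight exact (control_of st) m"
    proof -
      have "weight_of (apply_move st m) = exact (Exposing (card B1 - 1 - h) (card B0 - c) h t) * 4 ^ t * exact (Free c t)"
        using mv q h by (simp add: moved_def weight_of_def)
      also have "\<dots> = 4 * weight exact (control_of st) m"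
        unfolding k mm weight_def four_powi[of t, symmetric] by simp
      finally show ?thesis .
    qed
    moreover have "completion st (v # w) \<and> m = move_reading st v w" if "completion (apply_move st m) w"
    proof
      have e: "completes B0 (below B1 v) [above B1 v] w" "exposures w B0 (below B1 v) [above B1 v] = [(c, t)]"
        using that mv by (simp_all add: moved_def completion_def)
      thus "completion st (v # w)"
        using completes_band1[OF sep v, of w] r by (simp add: completion_def b B0_def B1_def exposures_Nil del: exposures.simps)
      show "m = move_reading st v w" using nv a e h by (simp add: move_reading_def b B0_def B1_def mm)
    qed
    ultimately show ?thesis using l mv by (simp add: moved_def)
  qed
qed

lemma exposing_move_props:
  assumes g: "good_state st" and b: "blocks st = (H, c, t) # bs" and m: "m \<in> legal (control_of st)"
  shows "good_state (apply_move st m) \<and> letters (apply_move st m) = letters st @ [next_letter st m] \<and>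
    weight_of (apply_move st m) = 4 * weight exact (control_of st) m * (4 ^ t * state_weight c t bs) \<and>
    (completion (apply_move st m) w \<longrightarrow> completion st (next_letter st m # w) \<and> m = move_reading st (next_letter st m) w)"
proof -
  define B0 where "B0 = band0 st"
  define B1 where "B1 = band1 st"
  define r where "r = map fst bs"
  have sep: "separated B0 B1 (H # r)" and tc: "c \<le> card B0" "target_chain c bs"
    using g by (simp_all add: good_state_def b B0_def B1_def r_def)
  have fin: "finite B0" "finite B1" "finite H" using sep by (auto simp: separated_def)
  have k: "control_of st = Exposing (card H) (card B0 - c) (card B1) t" by (simp add: b B0_def B1_def)
  have cst: "completion st (v # w) \<longleftrightarrow> completes B0 B1 (H # r) (v # w) \<and> exposures (v # w) B0 B1 (H # r) = (c, t) # map snd bs" for v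
    by (simp add: completion_def b B0_def B1_def r_def del: exposures.simps)
  show ?thesis
  proof (rule exposing_move[OF g b m, folded B0_def B1_def])
    fix v h assume mm: "m = Read_Band0 h" and v: "v \<in> B0" and h: "c + h = card (below B0 v)"
      and mv: "moved st (apply_move st m) v (below B0 v) (B1 \<union> above B0 v) ((H, c, t) # bs)"
    note l = moved_letter[OF mv]
    have cd: "card (B1 \<union> above B0 v) = (card B0 - c) + card B1 - h - 1" "card (below B0 v) - c = h"
      using card_band1_join[OF sep, of v] card_below_above[OF fin(1) v] h by simp_all
    have "good_state (apply_move st m)" using mv separated_band0[OF sep, of v] tc h by (simp add: moved_def good_state_def r_def)
    moreover have "weight_of (apply_move st m) = 4 * weight exact (control_of st) m * (4 ^ t * state_weight c t bs)"
      using mv cd unfolding k by (simp add: moved_def weight_of_def mm weight_def)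
    moreover have "completion (apply_move st m) w \<longrightarrow> completion st (v # w)"
      unfolding cst using mv completes_band0[OF sep v, of w] v by (simp add: moved_def completion_def r_def)
    moreover have "m = move_reading st v w" using v cd by (simp add: move_reading_def b B0_def mm)
    ultimately show ?thesis using l mv by (simp add: moved_def)
  next
    fix v q assume mm: "m = Join_Band1 q" and v: "v \<in> B1" and q: "q = card (below B1 v)"
      and mv: "moved st (apply_move st m) v B0 (below B1 v) ((H \<union> above B1 v, c, t) # bs)"
    note l = moved_letter[OF mv]
    have nv: "v \<notin> B0" using separated_notin(1)[OF sep v] .
    have rh: "raise_head (above B1 v) (H # r) = (H \<union> above B1 v) # r" by (simp add: raise_head_def)
    have "H \<inter> above B1 v = {}" using separated_notin(2)[OF sep, of H] by (auto simp: above_def)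
    hence "card (H \<union> above B1 v) = card H + card (above B1 v)"
      using fin below_above_subset(4)[of B1 v] by (intro card_Un_disjoint) auto
    hence cd: "card (H \<union> above B1 v) = card H + card B1 - q - 1"
      using card_below_above[OF fin(2) v] q by simp
    have "good_state (apply_move st m)" using mv separated_band1[OF sep, of v] tc rh by (simp add: moved_def good_state_def r_def)
    moreover have "weight_of (apply_move st m) = 4 * weight exact (control_of st) m * (4 ^ t * state_weight c t bs)"
      using mv cd q unfolding k by (simp add: moved_def weight_of_def mm weight_def)
    moreover have "completion (apply_move st m) w \<longrightarrow> completion st (v # w)"
      unfolding cst using mv completes_band1[OF sep v, of w] v nv rh by (simp add: moved_def completion_def r_def)
    moreover have "m = move_reading st v w" using v nv q by (simp add: move_reading_def b B0_def B1_def mm)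
    ultimately show ?thesis using l mv by (simp add: moved_def)
  next
    fix v assume mm: "m = Read_Only" and v: "v \<in> H" and e: "below H v = {}" "above H v = {}"
      and ct: "c = card B0" "t = card B1" and mv: "moved st (apply_move st m) v B0 B1 bs"
    note l = moved_letter[OF mv]
    have nv: "v \<notin> B0 \<and> v \<notin> B1" using separated_notin(2)[OF sep _ v] by simp
    have ne: "nonempty [below H v, above H v] = []" by (simp add: nonempty_def e)
    have h1: "card H = 1" using card_below_above[OF fin(3) v] e by simp
    have "good_state (apply_move st m)" using mv separated_head_read[OF sep, of v] tc ne ct by (simp add: moved_def good_state_def r_def)
    moreover have "weight_of (apply_move st m) = 4 * weight exact (control_of st) m * (4 ^ t * state_weight c t bs)"
    proof -
      \<comment> \<open>The closing entry is \<open>4 powi (- (1 + t))\<close>; the factor 4 for the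
        letter and \<open>4 ^ t\<close> for the target cancel it, so the head leaves the weight
        without a trace.\<close>
      have "4 * weight exact (control_of st) m * 4 ^ t = 4 * (2::real) powi (- 2 * int (1 + t)) * 4 ^ t"
        unfolding k h1 mm weight_def using ct by simp
      also have "\<dots> = 4 * 4 powi (- int (1 + t)) * 4 powi (int t)" unfolding powi4 by (simp add: power_int_mult)
      also have "\<dots> = 1" by (simp add: power_int_diff power_int_minus power_int_add field_simps)
      finally have 1: "4 * weight exact (control_of st) m * 4 ^ t = 1" .
      have "weight_of (apply_move st m) = state_weight c t bs" using mv ct by (simp add: moved_def weight_of_def)
      also have "\<dots> = (4 * weight exact (control_of st) m * 4 ^ t) * state_weight c t bs" unfolding 1 by simp
      finally show ?thesis by (simp only: mult.assoc)
    qed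
    moreover have "completion (apply_move st m) w \<longrightarrow> completion st (v # w)"
      unfolding cst using mv completes_head[OF sep v, of w] ne nv e ct by (simp add: moved_def completion_def r_def)
    moreover have "m = move_reading st v w" using nv e by (simp add: move_reading_def b B0_def B1_def mm)
    ultimately show ?thesis using l mv by (simp add: moved_def)
  next
    fix v assume mm: "m = Read_Least" and v: "v \<in> H" and e: "below H v = {}" "above H v \<noteq> {}"
      and mv: "moved st (apply_move st m) v B0 B1 ((above H v, c, t) # bs)"
    note l = moved_letter[OF mv]
    have nv: "v \<notin> B0 \<and> v \<notin> B1" using separated_notin(2)[OF sep _ v] by simp
    have ne: "nonempty [below H v, above H v] = [above H v]" using e by (simp add: nonempty_def)
    have h1: "card (above H v) = card H - 1" using card_below_above[OF fin(3) v] e by simp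
    have "good_state (apply_move st m)" using mv separated_head_read[OF sep, of v] tc ne by (simp add: moved_def good_state_def r_def)
    moreover have "weight_of (apply_move st m) = 4 * weight exact (control_of st) m * (4 ^ t * state_weight c t bs)"
      using mv h1 unfolding k by (simp add: moved_def weight_of_def mm weight_def)
    moreover have "completion (apply_move st m) w \<longrightarrow> completion st (v # w)"
      unfolding cst using mv completes_head[OF sep v, of w] ne nv e by (simp add: moved_def completion_def r_def)
    moreover have "m = move_reading st v w" using nv e by (simp add: move_reading_def b B0_def B1_def mm)
    ultimately show ?thesis using l mv by (simp add: moved_def)
  next
    fix v assume mm: "m = Read_Greatest" and v: "v \<in> H" and e: "below H v \<noteq> {}" "above H v = {}"
      and mv: "moved st (apply_move st m) v B0 B1 ((below H v, c, t) # bs)"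
    note l = moved_letter[OF mv]
    have nv: "v \<notin> B0 \<and> v \<notin> B1" using separated_notin(2)[OF sep _ v] by simp
    have ne: "nonempty [below H v, above H v] = [below H v]" using e by (simp add: nonempty_def)
    have h1: "card (below H v) = card H - 1" using card_below_above[OF fin(3) v] e by simp
    have "good_state (apply_move st m)" using mv separated_head_read[OF sep, of v] tc ne by (simp add: moved_def good_state_def r_def)
    moreover have "weight_of (apply_move st m) = 4 * weight exact (control_of st) m * (4 ^ t * state_weight c t bs)"
      using mv h1 unfolding k by (simp add: moved_def weight_of_def mm weight_def)
    moreover have "completion (apply_move st m) w \<longrightarrow> completion st (v # w)"
      unfolding cst using mv completes_head[OF sep v, of w] ne nv e by (simp add: moved_def completion_def r_def)
    moreover have "m = move_reading st v w" using nv e by (simp add: move_reading_def b B0_def B1_def mm)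
    ultimately show ?thesis using l mv by (simp add: moved_def)
  next
    fix v l1 l2 a1 a2 m'
    assume mm: "m = Split_Head l1 l2 a1 a2 m'" and v: "v \<in> H" and e: "below H v \<noteq> {}" "above H v \<noteq> {}"
      and ll: "l1 = card (below H v)" "l2 = card (above H v)" and aa: "a1 + a2 = card B0 - c"
      and mv: "moved st (apply_move st m) v B0 B1 ((below H v, c + a2, m') # (above H v, c, t) # bs)"
    note l = moved_letter[OF mv]
    have nv: "v \<notin> B0 \<and> v \<notin> B1" using separated_notin(2)[OF sep _ v] by simp
    have ne: "nonempty [below H v, above H v] = [below H v, above H v]" using e by (simp add: nonempty_def)
    have a: "card B0 - (c + a2) = a1" "c + a2 \<le> card B0" using aa tc by simp_all
    have "good_state (apply_move st m)" using mv separated_head_read[OF sep, of v] tc a ne by (simp add: moved_def good_state_def r_def)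
    moreover have "weight_of (apply_move st m) = 4 * weight exact (control_of st) m * (4 ^ t * state_weight c t bs)"
    proof -
      have "weight_of (apply_move st m) = exact (Exposing l1 a1 (card B1) m') * 4 ^ m' *
          (exact (Exposing l2 a2 m' t) * 4 ^ t * state_weight c t bs)"
        using mv a ll by (simp add: moved_def weight_of_def)
      also have "\<dots> = 4 * weight exact (control_of st) m * (4 ^ t * state_weight c t bs)"
        unfolding k mm weight_def four_powi[of m', symmetric] by simp
      finally show ?thesis .
    qed
    moreover have "completion st (v # w) \<and> m = move_reading st v w" if "completion (apply_move st m) w"
    proof
      have x: "completes B0 B1 (below H v # above H v # r) w"
        "exposures w B0 B1 (below H v # above H v # r) = (c + a2, m') # (c, t) # map snd bs"
        using that mv by (simp_all add: moved_def completion_def r_def)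
      thus "completion st (v # w)"
        unfolding cst using completes_head[OF sep v, of w] ne nv e by simp
      show "m = move_reading st v w" using nv e x ll a unfolding r_def by (simp add: move_reading_def b B0_def B1_def mm)
    qed
    ultimately show ?thesis using l mv by (simp add: moved_def)
  qed
qed

text \<open>No completion is lost: the target that it attains is in the support, so the move that it
  determines is a candidate.\<close>

lemma free_move_exists:
  assumes g: "good_state st" and b: "blocks st = []" and cp: "completion st (v # w)"
  defines "m \<equiv> move_reading st v w"
  shows "m \<in> legal (control_of st) \<and> next_letter st m = v \<and> completion (apply_move st m) w"
proof -
  define B0 where "B0 = band0 st"
  define B1 where "B1 = band1 st"
  have sep: "separated B0 B1 []" using g by (simp add: good_state_def b B0_def B1_def)
  have fin: "finite B0" "finite B1" using sep by (auto simp: separated_def)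
  have k: "control_of st = Free (card B0) (card B1)" by (simp add: b B0_def B1_def)
  have co: "completes B0 B1 [] (v # w)" using cp by (simp add: completion_def b B0_def B1_def)
  consider "v \<in> B0" | "v \<in> B1" "above B1 v = {}" | "v \<in> B1" "above B1 v \<noteq> {}"
    using completes_first_letter[OF sep co] by auto
  thus ?thesis
  proof cases
    case 1
    have m: "m = Read_Band0 (card (below B0 v))" using 1 by (simp add: m_def move_reading_def b B0_def)
    have lg: "m \<in> legal (control_of st)" unfolding k legal_def moves_Free m
      using card_below_above[OF fin(1) 1] by auto
    show ?thesis
    proof (rule free_move[OF g b lg, folded B0_def B1_def])
      fix v' h assume x: "m = Read_Band0 h" "v' \<in> B0" "h = card (below B0 v')"
        and mv: "moved st (apply_move st m) v' (below B0 v') (B1 \<union> above B0 v') []"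
      have "v' = v" using card_below_inj[OF fin(1) x(2) 1] x m by simp
      thus ?thesis using lg moved_letter[OF mv] mv completes_band0[OF sep 1, of w] co
        by (simp add: moved_def completion_def exposures_Nil)
    qed (simp_all add: m)
  next
    case 2
    have nv: "v \<notin> B0" using separated_notin(1)[OF sep 2(1)] .
    have m: "m = Read_Greatest_Band1" using nv 2 by (simp add: m_def move_reading_def b B0_def B1_def)
    have lg: "m \<in> legal (control_of st)" unfolding k legal_def moves_Free m
      using card_below_above[OF fin(2) 2(1)] by auto
    show ?thesis
    proof (rule free_move[OF g b lg, folded B0_def B1_def])
      fix v' assume x: "m = Read_Greatest_Band1" "v' \<in> B1" "above B1 v' = {}"
        and mv: "moved st (apply_move st m) v' B0 (below B1 v') []"
      have "v' = v" using x(2,3) 2 by (auto simp: above_def not_less intro: order.antisym)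
      thus ?thesis using lg moved_letter[OF mv] mv completes_band1[OF sep 2(1), of w] co 2
        by (simp add: moved_def completion_def exposures_Nil raise_head_def nonempty_def)
    qed (simp_all add: m)
  next
    case 3
    have nv: "v \<notin> B0" using separated_notin(1)[OF sep 3(1)] .
    have r: "raise_head (above B1 v) [] = [above B1 v]" using 3 by (simp add: raise_head_def nonempty_def)
    have c1: "completes B0 (below B1 v) [above B1 v] w" using completes_band1[OF sep 3(1), of w] co r by simp
    have s1: "separated B0 (below B1 v) [above B1 v]" using separated_band1[OF sep, of v] r by simp
    from exposures_chain[OF s1 c1] obtain c t where ct: "exposures w B0 (below B1 v) [above B1 v] = [(c, t)]"
      "reaches (card B0) (card (below B1 v)) c t"
      by (auto simp: length_Suc_conv)
    have m: "m = Cut_Band1 (card (below B1 v)) c t" using nv 3 ct(1) by (simp add: m_def move_reading_def b B0_def B1_def)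
    have ca: "card (above B1 v) = card B1 - 1 - card (below B1 v)" "1 \<le> card (above B1 v)"
      using card_below_above[OF fin(2) 3(1)] 3(2) below_above_subset(4)[OF fin(2), of v]
      by (auto simp: Suc_le_eq card_gt_0_iff)
    have "(card (below B1 v), c, t) \<in> cut_indices (card B0) (card B1)"
      using ca reaches_support[OF ct(2), of "card (above B1 v)"] ct(2) by (auto simp: cut_indices_def reaches_def)
    hence lg: "m \<in> legal (control_of st)" unfolding k legal_def moves_Free m by force
    show ?thesis
    proof (rule free_move[OF g b lg, folded B0_def B1_def])
      fix v' h c' t' assume x: "m = Cut_Band1 h c' t'" "v' \<in> B1" "h = card (below B1 v')"
        and mv: "moved st (apply_move st m) v' B0 (below B1 v') [(above B1 v', c', t')]"
      have "v' = v" using card_below_inj[OF fin(2) x(2) 3(1)] x m by simp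
      moreover have "c' = c" "t' = t" using x(1) m by simp_all
      ultimately show ?thesis using lg moved_letter[OF mv] mv c1 ct(1)
        by (simp add: moved_def completion_def)
    qed (simp_all add: m)
  qed
qed

lemma exposing_move_exists:
  assumes g: "good_state st" and b: "blocks st = (H, c, t) # bs" and cp: "completion st (v # w)"
  defines "m \<equiv> move_reading st v w"
  shows "m \<in> legal (control_of st) \<and> next_letter st m = v \<and> completion (apply_move st m) w"
proof -
  define B0 where "B0 = band0 st"
  define B1 where "B1 = band1 st"
  define r where "r = map fst bs"
  have sep: "separated B0 B1 (H # r)" and tc: "c \<le> card B0" "target_chain c bs"
    using g by (simp_all add: good_state_def b B0_def B1_def r_def)
  have fin: "finite B0" "finite B1" "finite H" using sep by (auto simp: separated_def)
  have k: "control_of st = Exposing (card H) (card B0 - c) (card B1) t" by (simp add: b B0_def B1_def)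
  have co: "completes B0 B1 (H # r) (v # w)" and ex: "exposures (v # w) B0 B1 (H # r) = (c, t) # map snd bs"
    using cp by (simp_all add: completion_def b B0_def B1_def r_def)
  consider "v \<in> B0" | "v \<in> B1" | "v \<in> H" using completes_first_letter[OF sep co] by auto
  thus ?thesis
  proof cases
    case 1
    have m: "m = Read_Band0 (card (below B0 v) - c)" using 1 by (simp add: m_def move_reading_def b B0_def)
    have c1: "completes (below B0 v) (B1 \<union> above B0 v) (H # r) w" using completes_band0[OF sep 1] co by blast
    have e1: "exposures w (below B0 v) (B1 \<union> above B0 v) (H # r) = (c, t) # map snd bs" using ex 1 by simp
    \<comment> \<open>Band 0 never grows, so a letter with fewer than \<open>c\<close> smaller
      values in band 0 would make the target unreachable.\<close>
    have cb: "c \<le> card (below B0 v)"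
      using exposures_chain[OF separated_band0[OF sep, of v] c1] e1 by (simp add: reaches_def)
    have lg: "m \<in> legal (control_of st)" unfolding k legal_def moves_Exposing m
      using card_below_above[OF fin(1) 1] cb by auto
    show ?thesis
    proof (rule exposing_move[OF g b lg, folded B0_def B1_def])
      fix v' h assume x: "m = Read_Band0 h" "v' \<in> B0" "c + h = card (below B0 v')"
        and mv: "moved st (apply_move st m) v' (below B0 v') (B1 \<union> above B0 v') ((H, c, t) # bs)"
      have "v' = v" using card_below_inj[OF fin(1) x(2) 1] x m cb by simp
      thus ?thesis using lg moved_letter[OF mv] mv c1 e1 by (simp add: moved_def completion_def r_def)
    qed (simp_all add: m)
  next
    case 2
    have nv: "v \<notin> B0" using separated_notin(1)[OF sep 2] .
    have m: "m = Join_Band1 (card (below B1 v))" using nv 2 by (simp add: m_def move_reading_def b B0_def B1_def)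
    have lg: "m \<in> legal (control_of st)" unfolding k legal_def moves_Exposing m
      using card_below_above[OF fin(2) 2] by auto
    show ?thesis
    proof (rule exposing_move[OF g b lg, folded B0_def B1_def])
      fix v' q assume x: "m = Join_Band1 q" "v' \<in> B1" "q = card (below B1 v')"
        and mv: "moved st (apply_move st m) v' B0 (below B1 v') ((H \<union> above B1 v', c, t) # bs)"
      have "v' = v" using card_below_inj[OF fin(2) x(2) 2] x m by simp
      thus ?thesis using lg moved_letter[OF mv] mv completes_band1[OF sep 2, of w] co ex nv 2
        by (simp add: moved_def completion_def r_def raise_head_def)
    qed (simp_all add: m)
  next
    case 3
    have nv: "v \<notin> B0" "v \<notin> B1" using separated_notin(2)[OF sep _ 3] by simp_all
    have c1: "completes B0 B1 (nonempty [below H v, above H v] @ r) w" using completes_head[OF sep 3] co by blast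
    note ch = exposures_chain[OF separated_head_read[OF sep, of v] c1]
    have ba: "card (below H v) + card (above H v) + 1 = card H" using card_below_above[OF fin(3) 3] .
    have fba: "finite (below H v)" "finite (above H v)" using below_above_subset fin by auto
    consider "below H v = {}" "above H v = {}" | "below H v = {}" "above H v \<noteq> {}"
      | "below H v \<noteq> {}" "above H v = {}" | "below H v \<noteq> {}" "above H v \<noteq> {}" by blast
    thus ?thesis
    proof cases
      case 1
      have m: "m = Read_Only" using nv 1 by (simp add: m_def move_reading_def b B0_def B1_def)
      have e1: "card B0 = c" "card B1 = t" "exposures w B0 B1 r = map snd bs"
        using ex nv 1 by (simp_all add: nonempty_def)
      have lg: "m \<in> legal (control_of st)" unfolding k legal_def moves_Exposing m using e1 ba 1 by simp
      show ?thesis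
      proof (rule exposing_move[OF g b lg, folded B0_def B1_def])
        fix v' assume x: "m = Read_Only" "v' \<in> H" "below H v' = {}" "above H v' = {}"
          and mv: "moved st (apply_move st m) v' B0 B1 bs"
        have "v' = v" using card_below_inj[OF fin(3) x(2) 3] x 1 by simp
        thus ?thesis using lg moved_letter[OF mv] mv c1 e1 1 by (simp add: moved_def completion_def r_def nonempty_def)
      qed (simp_all add: m)
    next
      case 2
      have m: "m = Read_Least" using nv 2 by (simp add: m_def move_reading_def b B0_def B1_def)
      have ca: "1 \<le> card (above H v)" using 2 fba by (simp add: Suc_le_eq card_gt_0_iff)
      have lg: "m \<in> legal (control_of st)" unfolding k legal_def moves_Exposing m using ba 2 ca by simp
      show ?thesis
      proof (rule exposing_move[OF g b lg, folded B0_def B1_def])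
        fix v' assume x: "m = Read_Least" "v' \<in> H" "below H v' = {}"
          and mv: "moved st (apply_move st m) v' B0 B1 ((above H v', c, t) # bs)"
        have "v' = v" using card_below_inj[OF fin(3) x(2) 3] x 2 by simp
        thus ?thesis using lg moved_letter[OF mv] mv c1 ex nv 2
          by (simp add: moved_def completion_def r_def nonempty_def)
      qed (simp_all add: m)
    next
      case c3: 3
      have m: "m = Read_Greatest" using nv c3 by (simp add: m_def move_reading_def b B0_def B1_def)
      have ca: "1 \<le> card (below H v)" using c3 fba by (simp add: Suc_le_eq card_gt_0_iff)
      have lg: "m \<in> legal (control_of st)" unfolding k legal_def moves_Exposing m using ba c3 ca by simp
      show ?thesis
      proof (rule exposing_move[OF g b lg, folded B0_def B1_def])
        fix v' assume x: "m = Read_Greatest" "v' \<in> H" "above H v' = {}"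
          and mv: "moved st (apply_move st m) v' B0 B1 ((below H v', c, t) # bs)"
        have "v' = v"
          using card_below_inj[OF fin(3) x(2) 3] card_below_above[OF fin(3) x(2)] x(3) ba c3 by simp
        thus ?thesis using lg moved_letter[OF mv] mv c1 ex nv c3
          by (simp add: moved_def completion_def r_def nonempty_def)
      qed (simp_all add: m)
    next
      case 4
      have ne: "nonempty [below H v, above H v] @ r = below H v # above H v # r" using 4 by (simp add: nonempty_def)
      \<comment> \<open>The given targets fix only the tail; the dropped entry
        \<open>(c', t')\<close> is the target which the split has to choose for the lower
        part.\<close>
      have "tl (exposures w B0 B1 (below H v # above H v # r)) = (c, t) # map snd bs"
        using ex nv 4 ne by (simp add: Let_def)
      then obtain c' t' where e1: "exposures w B0 B1 (below H v # above H v # r) = (c', t') # (c, t) # map snd bs"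
        using ch unfolding ne by (cases "exposures w B0 B1 (below H v # above H v # r)") auto
      have re: "reaches (card B0) (card B1) c' t'" "reaches c' t' c t" using ch unfolding ne e1 by simp_all
      have cc: "c \<le> c'" "c' \<le> card B0" using re by (auto simp: reaches_def)
      have m: "m = Split_Head (card (below H v)) (card (above H v)) (card B0 - c') (c' - c) t'"
        using nv 4 e1 unfolding r_def by (simp add: m_def move_reading_def b B0_def B1_def)
      have ca: "1 \<le> card (below H v)" "1 \<le> card (above H v)" using 4 fba by (simp_all add: Suc_le_eq card_gt_0_iff)
      have "(card (below H v), card (above H v), card B0 - c', c' - c, t') \<in> split_indices (card H) (card B0 - c) (card B1) t"
        using ca cc ba reaches_support[OF re(1) ca(1)] reaches_support[OF re(2) ca(2)] by (simp add: split_indices_def)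
      hence lg: "m \<in> legal (control_of st)" unfolding k legal_def moves_Exposing m by force
      show ?thesis
      proof (rule exposing_move[OF g b lg, folded B0_def B1_def])
        fix v' l1 l2 a1 a2 m' assume x: "m = Split_Head l1 l2 a1 a2 m'" "v' \<in> H" "l1 = card (below H v')"
          and mv: "moved st (apply_move st m) v' B0 B1 ((below H v', c + a2, m') # (above H v', c, t) # bs)"
        have "v' = v" using card_below_inj[OF fin(3) x(2) 3] x m by simp
        moreover have "a2 = c' - c" "m' = t'" using x(1) m by simp_all
        moreover from this have "c + a2 = c'" using cc by simp
        ultimately show ?thesis using lg moved_letter[OF mv] mv c1 e1 unfolding ne
          by (simp add: moved_def completion_def r_def)
      qed (simp_all add: m)
    qed
  qed
qed

definition unread :: "state \<Rightarrow> nat" where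
  "unread st = card (band0 st) + card (band1 st) + sum_list (map (\<lambda>(H, c, t). card H) (blocks st))"

lemma unread_move:
  assumes g: "good_state st" and m: "m \<in> legal (control_of st)"
  shows "unread st = Suc (unread (apply_move st m))"
proof (cases "blocks st")
  case Nil
  have sep: "separated (band0 st) (band1 st) []" using g by (simp add: good_state_def Nil)
  hence fin: "finite (band0 st)" "finite (band1 st)" by (auto simp: separated_def)
  show ?thesis
    using free_move[OF g Nil m] card_below_above[OF fin(1)] card_below_above[OF fin(2)] card_band1_join[OF sep]
    by cases (force simp: moved_def unread_def Nil)+
next
  case (Cons B bs)
  obtain H c t where B: "B = (H, c, t)" by (cases B)
  have sep: "separated (band0 st) (band1 st) (H # map fst bs)" using g by (simp add: good_state_def Cons B)
  hence fin: "finite (band0 st)" "finite (band1 st)" "finite H" by (auto simp: separated_def)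
  have "H \<inter> above (band1 st) v = {}" for v using separated_notin(2)[OF sep, of H] by (auto simp: above_def)
  hence j: "card (H \<union> above (band1 st) v) = card H + card (above (band1 st) v)" for v
    using fin below_above_subset(4)[of "band1 st" v] by (intro card_Un_disjoint) auto
  show ?thesis
    using exposing_move[OF g Cons[unfolded B] m] card_below_above[OF fin(1)] card_below_above[OF fin(2)] card_below_above[OF fin(3)]
      card_band1_join[OF sep] j
    by cases (force simp: moved_def unread_def Cons B)+
qed

subsection \<open>Counting completions\<close>

lemma exact_le_child:
  assumes "supported k" "k \<noteq> Free 0 0" "m \<in> moves k" shows "weight exact k m \<le> exact k"
  unfolding exact_sum[OF assms(1,2)] using assms(3) finite_moves weight_nonneg[of exact k] exact_nonneg
  by (intro member_le_sum) auto

lemma exact_Free_pos: "0 < exact (Free p q)"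
proof (induction "p + q" arbitrary: p q rule: less_induct)
  case less
  consider "p = 0" "q = 0" | "0 < p" | "p = 0" "0 < q" by auto
  thus ?case
  proof cases
    case 1 thus ?thesis by (simp add: exact_Free_0)
  next
    case 2
    have "0 < exact (Free 0 (p + q - 1))" using less 2 by simp
    also have "\<dots> / 4 = weight exact (Free p q) (Read_Band0 0)" by (simp add: weight_def)
    also have "\<dots> \<le> exact (Free p q)" using 2 by (intro exact_le_child) (auto simp: moves_Free)
    finally show ?thesis by simp
  next
    case 3
    have "0 < exact (Free p (q - 1))" using less 3 by simp
    also have "\<dots> / 4 = weight exact (Free p q) Read_Greatest_Band1" by (simp add: weight_def)
    also have "\<dots> \<le> exact (Free p q)" using 3 by (intro exact_le_child) (auto simp: moves_Free)
    finally show ?thesis by simp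
  qed
qed

text \<open>\<open>A\<close> is an event of the sampler, which may fail; hence the option
  type.\<close>

definition completions :: "nat list option set \<Rightarrow> state \<Rightarrow> nat list set" where
  "completions A st = {w. completion st w \<and> Some (letters st @ w) \<in> A}"

lemma card_union_blocks:
  assumes "separated B0 B1 Hs"
  shows "finite (B0 \<union> B1 \<union> \<Union> (set Hs)) \<and> card (B0 \<union> B1 \<union> \<Union> (set Hs)) = card B0 + card B1 + sum_list (map card Hs)"
proof -
  note sep = assms[unfolded separated_def]
  have "finite (\<Union> (set Hs)) \<and> card (\<Union> (set Hs)) = sum_list (map card Hs)"
    using sep[THEN conjunct2, THEN conjunct2] 
  proof (induction Hs)
    case (Cons H Hs)
    have "H \<inter> \<Union> (set Hs) = {}"
    proof (rule equals0I)
      fix x assume "x \<in> H \<inter> \<Union> (set Hs)"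
      then obtain H' where "x \<in> H" "H' \<in> set Hs" "x \<in> H'" by blast
      with Cons.prems have "x < x" unfolding sorted_wrt.simps by blast
      thus False by simp
    qed
    thus ?case using Cons by (simp add: card_Un_disjoint)
  qed simp
  moreover have "(B0 \<union> B1) \<inter> \<Union> (set Hs) = {}"
  proof (rule equals0I)
    fix x assume x: "x \<in> (B0 \<union> B1) \<inter> \<Union> (set Hs)"
    hence "x < x" using sep by blast
    thus False by simp
  qed
  moreover have "B0 \<inter> B1 = {}"
  proof (rule equals0I)
    fix x assume "x \<in> B0 \<inter> B1"
    hence "x < x" using sep by blast
    thus False by simp
  qed
  ultimately show ?thesis using sep by (simp add: card_Un_disjoint)
qed

lemma completion_length:
  assumes "good_state st" "completion st w"
  shows "length w = unread st" "set w = band0 st \<union> band1 st \<union> \<Union> (set (map fst (blocks st)))"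
proof -
  have "distinct w" and w: "set w = band0 st \<union> band1 st \<union> \<Union> (set (map fst (blocks st)))"
    using assms(2) by (auto simp: completion_def completes_def)
  hence "length w = card (band0 st \<union> band1 st \<union> \<Union> (set (map fst (blocks st))))" by (metis distinct_card)
  also have "\<dots> = unread st"
    using card_union_blocks[of "band0 st" "band1 st" "map fst (blocks st)"] assms(1)
    by (simp add: good_state_def unread_def comp_def case_prod_unfold)
  finally show "length w = unread st" .
  show "set w = band0 st \<union> band1 st \<union> \<Union> (set (map fst (blocks st)))" by (rule w)
qed

lemma finite_completions: "good_state st \<Longrightarrow> finite (completions A st)"
proof -
  assume g: "good_state st"
  have "completions A st \<subseteq> {w. set w \<subseteq> band0 st \<union> band1 st \<union> \<Union> (set (map fst (blocks st))) \<and> length w = unread st}"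
    using completion_length[OF g] unfolding completions_def by blast
  moreover have "finite \<dots>"
    using card_union_blocks[of "band0 st" "band1 st" "map fst (blocks st)"] g
    by (intro finite_lists_length_eq) (simp add: good_state_def)
  ultimately show ?thesis by (rule finite_subset)
qed

text \<open>The weights are related in product form because the exact value of the control may
  vanish.\<close>

lemma move_props:
  assumes g: "good_state st" and m: "m \<in> legal (control_of st)"
  shows "good_state (apply_move st m)" "letters (apply_move st m) = letters st @ [next_letter st m]"
    "weight_of (apply_move st m) * exact (control_of st) = 4 * weight exact (control_of st) m * weight_of st"
    "completion (apply_move st m) w \<Longrightarrow> completion st (next_letter st m # w) \<and> m = move_reading st (next_letter st m) w"
proof -
  have "good_state (apply_move st m) \<and> letters (apply_move st m) = letters st @ [next_letter st m] \<and>
    weight_of (apply_move st m) * exact (control_of st) = 4 * weight exact (control_of st) m * weight_of st \<and>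
    (completion (apply_move st m) w \<longrightarrow> completion st (next_letter st m # w) \<and> m = move_reading st (next_letter st m) w)" for w
  proof (cases "blocks st")
    case Nil
    show ?thesis using free_move_props[OF g Nil m, of w] by (simp add: weight_of_def[of st] Nil)
  next
    case (Cons B bs)
    obtain H c t where B: "B = (H, c, t)" by (cases B)
    show ?thesis using exposing_move_props[OF g Cons[unfolded B] m, of w] by (simp add: weight_of_def[of st] Cons B)
  qed
  thus "good_state (apply_move st m)" "letters (apply_move st m) = letters st @ [next_letter st m]"
    "weight_of (apply_move st m) * exact (control_of st) = 4 * weight exact (control_of st) m * weight_of st"
    "completion (apply_move st m) w \<Longrightarrow> completion st (next_letter st m # w) \<and> m = move_reading st (next_letter st m) w"
    by blast+
qed

lemma move_exists:
  assumes "good_state st" "completion st (v # w)"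
  shows "move_reading st v w \<in> legal (control_of st) \<and> next_letter st (move_reading st v w) = v \<and>
    completion (apply_move st (move_reading st v w)) w"
proof (cases "blocks st")
  case Nil
  show ?thesis by (rule free_move_exists[OF assms(1) Nil assms(2)])
next
  case (Cons B bs)
  obtain H c t where B: "B = (H, c, t)" by (cases B)
  show ?thesis by (rule exposing_move_exists[OF assms(1) Cons[unfolded B] assms(2)])
qed

lemma finite_legal: "finite (legal k)"
  by (rule finite_subset[OF _ finite_moves[of k]]) (auto simp: legal_def)

text \<open>Moves that read the same letter but choose different targets have disjoint completions,
  because a word realizes its targets uniquely. This is why targets are part of the state.\<close>

lemma card_completions_Suc:
  assumes g: "good_state st" and u: "unread st = Suc n"
  shows "card (completions A st) = (\<Sum>m\<in>legal (control_of st). card (completions A (apply_move st m)))"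
proof -
  let ?f = "\<lambda>m. (#) (next_letter st m) ` completions A (apply_move st m)"
  have "completions A st = (\<Union>m\<in>legal (control_of st). ?f m)"
  proof (intro set_eqI iffI)
    fix x assume x: "x \<in> completions A st"
    hence c: "completion st x" by (simp add: completions_def)
    then obtain v w where vw: "x = v # w" using completion_length(1)[OF g c] u by (cases x) auto
    define m where "m = move_reading st v w"
    have m: "m \<in> legal (control_of st)" "next_letter st m = v" "completion (apply_move st m) w"
      using move_exists[OF g c[unfolded vw]] by (auto simp: m_def)
    have "w \<in> completions A (apply_move st m)" using x m move_props(2)[OF g m(1)] by (simp add: completions_def vw)
    thus "x \<in> (\<Union>m\<in>legal (control_of st). ?f m)" using m(1,2) vw by blast
  next
    fix x assume "x \<in> (\<Union>m\<in>legal (control_of st). ?f m)"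
    then obtain m w where m: "m \<in> legal (control_of st)" "x = next_letter st m # w" "w \<in> completions A (apply_move st m)" by blast
    thus "x \<in> completions A st" using move_props(2,4)[OF g m(1)] by (simp add: completions_def)
  qed
  also have "card \<dots> = (\<Sum>m\<in>legal (control_of st). card (?f m))"
  proof (rule card_UN_disjoint)
    show "\<forall>m\<in>legal (control_of st). \<forall>m'\<in>legal (control_of st). m \<noteq> m' \<longrightarrow> ?f m \<inter> ?f m' = {}"
    proof (intro ballI impI, rule ccontr)
      fix m m' assume m: "m \<in> legal (control_of st)" "m' \<in> legal (control_of st)" "m \<noteq> m'" "?f m \<inter> ?f m' \<noteq> {}"
      then obtain w where w: "next_letter st m = next_letter st m'" "completion (apply_move st m) w" "completion (apply_move st m') w"
        by (auto simp: completions_def)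
      have "m = m'" using move_props(4)[OF g m(1) w(2)] move_props(4)[OF g m(2) w(3)] w(1) by metis
      thus False using m(3) by simp
    qed
  qed (use finite_legal finite_completions move_props(1)[OF g] in auto)
  also have "\<dots> = (\<Sum>m\<in>legal (control_of st). card (completions A (apply_move st m)))"
    by (intro sum.cong refl card_image) (auto simp: inj_on_def)
  finally show ?thesis .
qed

lemma control_unread:
  assumes g: "good_state st" and u: "unread st = Suc n"
  shows "control_of st \<noteq> Free 0 0" "Suc n \<le> 300 \<Longrightarrow> valid_control (control_of st)"
    "\<not> supported (control_of st) \<Longrightarrow> \<not> completion st w"
proof -
  have "control_of st \<noteq> Free 0 0 \<and> (Suc n \<le> 300 \<longrightarrow> valid_control (control_of st)) \<and>
    (\<not> supported (control_of st) \<longrightarrow> \<not> completion st w)"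
  proof (cases "blocks st")
    case Nil
    thus ?thesis using u by (auto simp: unread_def)
  next
    case (Cons B bs)
    obtain H c t where B: "B = (H, c, t)" by (cases B)
    have sep: "separated (band0 st) (band1 st) (H # map fst bs)" using g by (simp add: good_state_def Cons B)
    hence "1 \<le> card H" by (simp add: separated_def Suc_le_eq card_gt_0_iff)
    moreover have "supported (control_of st)" if c: "completion st w"
    proof -
      have "completes (band0 st) (band1 st) (H # map fst bs) w"
        "exposures w (band0 st) (band1 st) (H # map fst bs) = (c, t) # map snd bs"
        using c by (simp_all add: completion_def Cons B)
      with exposures_chain[OF sep] have "reaches (card (band0 st)) (card (band1 st)) c t" by fastforce
      from reaches_support[OF this \<open>1 \<le> card H\<close>] show ?thesis by (simp add: Cons B)
    qed
    moreover have "card H + (card (band0 st) - c) + card (band1 st) \<le> Suc n" using u by (simp add: unread_def Cons B)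
    ultimately show ?thesis by (auto simp: Cons B)
  qed
  thus "control_of st \<noteq> Free 0 0" "Suc n \<le> 300 \<Longrightarrow> valid_control (control_of st)"
    "\<not> supported (control_of st) \<Longrightarrow> \<not> completion st w" by blast+
qed

lemma weight_of_factor: obtains z where "weight_of st = exact (control_of st) * z"
proof (cases "blocks st")
  case Nil
  thus ?thesis using that[of 1] by (simp add: weight_of_def)
next
  case (Cons B bs)
  obtain H c t where "B = (H, c, t)" by (cases B)
  thus ?thesis using that[of "4 ^ t * state_weight c t bs"] Cons by (simp add: weight_of_def)
qed

lemma weight_illegal: "m \<in> moves k - legal k \<Longrightarrow> weight exact k m = 0"
  by (auto simp: legal_def weight_def)

lemma unread_0: "good_state st \<Longrightarrow> unread st = 0 \<Longrightarrow> band0 st = {} \<and> band1 st = {} \<and> blocks st = []"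
proof -
  assume g: "good_state st" "unread st = 0"
  have "blocks st = []"
  proof (cases "blocks st")
    case (Cons B bs)
    thus ?thesis using g by (cases B) (auto simp: good_state_def separated_def unread_def)
  qed simp
  thus ?thesis using g by (auto simp: good_state_def separated_def unread_def)
qed

text \<open>The recurrence of \<open>exact\<close> matches the decomposition by moves term by term.
  Controls of value zero are treated apart, as the proportion cannot be formed by division
  there.\<close>

lemma card_completions:
  assumes "good_state st" "unread st = n"
  shows "real (card (completions UNIV st)) = 4 ^ n * weight_of st"
  using assms
proof (induction n arbitrary: st)
  case 0
  note e = unread_0[OF 0]
  have "completions UNIV st = {[]}"
    using e by (auto simp: completions_def completion_def completes_def avoids_12453_def avoids_1342_def avoids_231_def blocks_ordered_def)
  thus ?case using e by (simp add: weight_of_def exact_Free_0)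
next
  case (Suc n)
  note g = Suc.prems(1)
  obtain z where z: "weight_of st = exact (control_of st) * z" using weight_of_factor .
  show ?case
  proof (cases "supported (control_of st) \<and> exact (control_of st) \<noteq> 0")
    case True
    let ?k = "control_of st"
    have "real (card (completions UNIV st)) = (\<Sum>m\<in>legal ?k. real (card (completions UNIV (apply_move st m))))"
      unfolding card_completions_Suc[OF Suc.prems] by simp
    also have "\<dots> = (\<Sum>m\<in>legal ?k. 4 ^ n * weight_of (apply_move st m))"
      using move_props(1)[OF g] unread_move[OF g] Suc.prems(2) by (intro sum.cong refl Suc.IH) auto
    also have "\<dots> = (\<Sum>m\<in>legal ?k. 4 ^ Suc n * weight_of st / exact ?k * weight exact ?k m)"
    proof (intro sum.cong refl)
      fix m assume "m \<in> legal ?k"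
      from move_props(3)[OF g this] have "weight_of (apply_move st m) = 4 * weight exact ?k m * weight_of st / exact ?k"
        using True by (simp add: eq_divide_eq)
      thus "4 ^ n * weight_of (apply_move st m) = 4 ^ Suc n * weight_of st / exact ?k * weight exact ?k m" by simp
    qed
    also have "\<dots> = 4 ^ Suc n * weight_of st / exact ?k * (\<Sum>m\<in>legal ?k. weight exact ?k m)"
      by (simp only: sum_distrib_left)
    also have "(\<Sum>m\<in>legal ?k. weight exact ?k m) = (\<Sum>m\<in>moves ?k. weight exact ?k m)"
      using finite_moves weight_illegal by (intro sum.mono_neutral_left) (auto simp: legal_def weight_def)
    also have "\<dots> = exact ?k" using exact_sum True control_unread(1)[OF Suc.prems] by simp
    finally show ?thesis using True by simp
  next
    case False
    show ?thesis
    proof (cases "supported (control_of st)")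
      case F: False
      hence "completions UNIV st = {}" using control_unread(3)[OF Suc.prems] by (auto simp: completions_def)
      thus ?thesis using z exact_unsupported[OF F] by simp
    next
      case True
      hence e0: "exact (control_of st) = 0" using False by simp
      have "card (completions UNIV (apply_move st m)) = 0" if m: "m \<in> legal (control_of st)" for m
      proof -
        have w0: "weight exact (control_of st) m = 0"
          using exact_le_child[OF True control_unread(1)[OF Suc.prems], of m] weight_nonneg[of exact "control_of st" m] exact_nonneg m e0
          by (simp add: legal_def order.antisym)
        have "weight_of (apply_move st m) = 0"
        proof (cases "blocks st")
          case Nil
          show ?thesis using free_move_props[OF g Nil m] w0 by simp
        next
          case (Cons B bs)
          obtain H c t where B: "B = (H, c, t)" by (cases B)
          show ?thesis using exposing_move_props[OF g Cons[unfolded B] m] w0 by simp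
        qed
        moreover have "unread (apply_move st m) = n" using unread_move[OF g m] Suc.prems(2) by simp
        ultimately show ?thesis using Suc.IH[OF move_props(1)[OF g m]] by simp
      qed
      hence "card (completions UNIV st) = 0" unfolding card_completions_Suc[OF Suc.prems] by simp
      thus ?thesis using z e0 by simp
    qed
  qed
qed

section \<open>Total variation\<close>

text \<open>All intermediate results outside \<open>S\<close> are dropped, among them failure and
  moves of exact weight zero.\<close>

lemma prob_bind_pmf_ge:
  assumes "finite S"
  shows "(\<Sum>x\<in>S. pmf M x * measure_pmf.prob (f x) A) \<le> measure_pmf.prob (bind_pmf M f) A"
proof -
  have "ennreal (\<Sum>x\<in>S. pmf M x * measure_pmf.prob (f x) A) = (\<Sum>x\<in>S. emeasure (f x) A * pmf M x)"
    by (subst sum_ennreal[symmetric]) (auto simp: measure_pmf.emeasure_eq_measure ennreal_mult mult.commute intro!: sum.cong)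
  also have "\<dots> = (\<Sum>x\<in>S. (emeasure (f x) A * indicator S x) * pmf M x)"
    by (intro sum.cong) auto
  also have "\<dots> = (\<integral>\<^sup>+x. emeasure (f x) A * indicator S x \<partial>M)"
    using assms by (intro nn_integral_measure_pmf_support[symmetric]) auto
  also have "\<dots> \<le> (\<integral>\<^sup>+x. emeasure (f x) A \<partial>M)"
    by (intro nn_integral_mono) (auto split: split_indicator)
  also have "\<dots> = ennreal (measure_pmf.prob (bind_pmf M f) A)"
    by (simp flip: measure_pmf.emeasure_eq_measure)
  finally show ?thesis by simp
qed

text \<open>A one-sided bound for every event suffices, as the complement of \<open>A\<close>
  supplies the other side.\<close>

lemma tv_dist_le:
  assumes "\<And>A. measure_pmf.prob Q A - \<epsilon> \<le> measure_pmf.prob P A"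
  shows "tv_dist P Q \<le> \<epsilon>"
  unfolding tv_dist_def
proof (rule cSUP_least)
  fix A
  have "measure_pmf.prob P (- A) = 1 - measure_pmf.prob P A" "measure_pmf.prob Q (- A) = 1 - measure_pmf.prob Q A"
    using measure_pmf.prob_compl[of A P] measure_pmf.prob_compl[of A Q] by (simp_all add: Compl_eq_Diff_UNIV)
  thus "\<bar>measure_pmf.prob P A - measure_pmf.prob Q A\<bar> \<le> \<epsilon>" using assms[of A] assms[of "- A"] by linarith
qed simp

definition step_error :: real where
  "step_error = gamma_err (\<nu> * 300) / (1 - gamma_err (\<nu> * 300)) + 7 * real \<nu> * uu"

locale sampler_300 = stored_tables_300 +
  fixes sc :: scan
  assumes scan: "valid_scan R G sc"
begin

text \<open>Only moves of positive exact weight are needed in the lower bound, so no distribution of the ideal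
  sampler has to be constructed.\<close>

lemma run_sampler_ge:
  assumes "good_state st" "unread st = n" "n \<le> 300" "0 < weight_of st"
  shows "real (card (completions A st)) / real (card (completions UNIV st)) - real n * step_error
    \<le> measure_pmf.prob (run_sampler R G sc n st) A"
  using assms
proof (induction n arbitrary: st)
  case 0
  note e = unread_0[OF 0(1,2)]
  have c: "completion st w \<longleftrightarrow> w = []" for w
    using e by (auto simp: completion_def completes_def avoids_12453_def avoids_1342_def avoids_231_def blocks_ordered_def)
  show ?case
    by (cases "Some (letters st) \<in> A") (auto simp: completions_def c measure_return_pmf Collect_conv_if)
next
  case (Suc n)
  note g = Suc.prems(1)
  define k where "k = control_of st"
  obtain z where z: "weight_of st = exact k * z" using weight_of_factor unfolding k_def .
  have pos: "0 < exact k" using z Suc.prems(4) exact_nonneg[of k] by (cases "exact k = 0") auto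
  have supp: "supported k" using pos exact_unsupported by fastforce
  note cu = control_unread(1,2)[OF Suc.prems(1,2), folded k_def]
  interpret scan_state R G sc k
    by unfold_locales (use scan cu Suc.prems(3) supp pos in auto)
  define I where "I = {m \<in> moves k. 0 < weight exact k m}"
  have fI: "finite I" using finite_moves by (simp add: I_def)
  have Il: "I \<subseteq> legal k" by (auto simp: I_def legal_def weight_def)
  have Sc2: "real (card (completions UNIV st)) = 4 ^ Suc n * weight_of st" by (rule card_completions[OF g Suc.prems(2)])
  have "0 < real (card (completions UNIV st))" unfolding Sc2 using Suc.prems(4) by simp
  note Sc = less_imp_neq[OF this, symmetric] Sc2
  let ?C = "real (card (completions UNIV st))"
  let ?run = "\<lambda>m. measure_pmf.prob (run_sampler R G sc n (apply_move st m)) A"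
  have nx: "good_state (apply_move st m)" "unread (apply_move st m) = n"
      "weight_of (apply_move st m) = 4 * ideal_prob m * weight_of st" if "m \<in> legal k" for m
    using move_props(1,3)[OF g, of m, folded k_def, OF that] unread_move[OF g, of m, folded k_def, OF that] Suc.prems(2) pos
    by (auto simp: ideal_prob_def field_simps)
  \<comment> \<open>A move of ideal probability \<open>ideal_prob m\<close> leaves just this
    fraction of the completions, so ideal choices preserve uniformity.\<close>
  have ratio: "ideal_prob m * (real (card (completions A (apply_move st m))) / real (card (completions UNIV (apply_move st m))))
      = real (card (completions A (apply_move st m))) / ?C" if m: "m \<in> I" for m
  proof -
    have ml: "m \<in> legal k" using m Il by blast
    have ip: "0 < ideal_prob m" using m pos by (simp add: I_def ideal_prob_def)
    have "real (card (completions UNIV (apply_move st m))) = ideal_prob m * ?C"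
      using card_completions[OF nx(1,2)[OF ml]] nx(3)[OF ml] Sc(2) by simp
    thus ?thesis using ip Sc by (simp add: divide_simps)
  qed
  have run_le: "0 \<le> ?run m" "?run m \<le> 1" for m by auto
  have IH: "real (card (completions A (apply_move st m))) / real (card (completions UNIV (apply_move st m))) - real n * step_error \<le> ?run m"
    if m: "m \<in> I" for m
  proof (rule Suc.IH)
    have ml: "m \<in> legal k" using m Il by blast
    show "good_state (apply_move st m)" "unread (apply_move st m) = n" using nx[OF ml] by auto
    have "0 < ideal_prob m" using m pos by (simp add: I_def ideal_prob_def)
    thus "0 < weight_of (apply_move st m)" using nx(3)[OF ml] Suc.prems(4) by simp
  qed (use Suc.prems in simp)
  have ideal_nonneg: "0 \<le> ideal_prob m" for m
    using weight_nonneg[of exact k m] exact_nonneg by (simp add: ideal_prob_def)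
  have ideal_sum: "(\<Sum>m\<in>I. ideal_prob m) \<le> 1"
  proof -
    have "(\<Sum>m\<in>I. ideal_prob m) \<le> (\<Sum>m\<in>moves k. ideal_prob m)"
      using finite_moves ideal_nonneg by (intro sum_mono2) (auto simp: I_def)
    also have "\<dots> = 1" unfolding ideal_prob_def sum_divide_distrib[symmetric]
      using exact_sum[OF supp cu(1)] pos by simp
    finally show ?thesis .
  qed
  have "real (card (completions A st)) = (\<Sum>m\<in>legal k. real (card (completions A (apply_move st m))))"
    unfolding card_completions_Suc[OF Suc.prems(1,2), folded k_def] by simp
  \<comment> \<open>Legal moves outside \<open>I\<close> have exact weight zero, hence no
    completions.\<close>
  also have "\<dots> = (\<Sum>m\<in>I. real (card (completions A (apply_move st m))))"
  proof (rule sum.mono_neutral_right[OF finite_legal Il], intro ballI)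
    fix m assume m: "m \<in> legal k - I"
    hence "weight exact k m = 0" using weight_nonneg[of exact k m] exact_nonneg by (auto simp: I_def legal_def)
    hence "card (completions UNIV (apply_move st m)) = 0"
      using card_completions[of "apply_move st m" n] nx[of m] m by (simp add: ideal_prob_def)
    moreover have "card (completions A (apply_move st m)) \<le> card (completions UNIV (apply_move st m))"
      using nx(1)[of m] m by (intro card_mono finite_completions) (auto simp: completions_def)
    ultimately show "real (card (completions A (apply_move st m))) = 0" by simp
  qed
  finally have "real (card (completions A st)) / ?C = (\<Sum>m\<in>I. real (card (completions A (apply_move st m))) / ?C)"
    by (simp add: sum_divide_distrib)
  also have "\<dots> = (\<Sum>m\<in>I. ideal_prob m * (real (card (completions A (apply_move st m))) / real (card (completions UNIV (apply_move st m)))))"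
    using ratio by simp
  also have "\<dots> \<le> (\<Sum>m\<in>I. ideal_prob m * (?run m + real n * step_error))"
    using IH ideal_nonneg by (intro sum_mono mult_left_mono) (auto simp: algebra_simps)
  also have "\<dots> = (\<Sum>m\<in>I. ideal_prob m * ?run m) + (\<Sum>m\<in>I. ideal_prob m) * (real n * step_error)"
    by (simp add: distrib_left sum.distrib sum_distrib_right)
  also have "\<dots> \<le> (\<Sum>m\<in>I. choice_prob m * ?run m) + step_error + 1 * (real n * step_error)"
  proof (intro add_mono mult_right_mono ideal_sum)
    have "0 \<le> sum loss I" by (intro sum_nonneg) (simp add: loss_def)
    hence se: "0 \<le> step_error" using step_loss unfolding step_error_def I_def by linarith
    thus "0 \<le> real n * step_error" by simp
    \<comment> \<open>Replacing the ideal by the actual probability costs at most the deficit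
      \<open>loss m\<close>, since the remaining run has probability at most 1.\<close>
    have "ideal_prob m * ?run m \<le> choice_prob m * ?run m + loss m" for m
    proof -
      have "ideal_prob m * ?run m \<le> (choice_prob m + loss m) * ?run m"
        using run_le by (intro mult_right_mono) (auto simp: loss_def)
      also have "\<dots> \<le> choice_prob m * ?run m + loss m"
        using mult_left_mono[OF run_le(2)[of m], of "loss m"] by (simp add: distrib_right loss_def)
      finally show ?thesis .
    qed
    hence "(\<Sum>m\<in>I. ideal_prob m * ?run m) \<le> (\<Sum>m\<in>I. choice_prob m * ?run m + loss m)" by (intro sum_mono)
    thus "(\<Sum>m\<in>I. ideal_prob m * ?run m) \<le> (\<Sum>m\<in>I. choice_prob m * ?run m) + step_error"
      using step_loss unfolding step_error_def I_def by (simp add: sum.distrib)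
  qed
  also have "(\<Sum>m\<in>I. choice_prob m * ?run m) \<le> measure_pmf.prob (run_sampler R G sc (Suc n) st) A"
  proof -
    define M where "M = map_pmf (\<lambda>bs. choose_move sc k (stored_value R G k) (uniform53 bs)) random_bits"
    define f where "f = (\<lambda>mo. case map_option (apply_move st) mo of None \<Rightarrow> return_pmf None | Some st' \<Rightarrow> run_sampler R G sc n st')"
    have "letter_choice R G sc st = map_pmf (map_option (apply_move st)) M"
      unfolding letter_choice_def M_def k_def by (simp add: pmf.map_comp comp_def)
    hence "run_sampler R G sc (Suc n) st = bind_pmf M f"
      by (simp add: bind_spmf_def bind_map_pmf f_def)
    moreover have "pmf M (Some m) = choice_prob m" for m
      unfolding M_def pmf_map choice_prob_def by (simp add: vimage_def)
    moreover have "(\<Sum>x\<in>Some ` I. pmf M x * measure_pmf.prob (f x) A) = (\<Sum>m\<in>I. pmf M (Some m) * ?run m)"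
      by (subst sum.reindex) (auto simp: f_def)
    ultimately show ?thesis using prob_bind_pmf_ge[of "Some ` I" M f A] fI by simp
  qed
  finally show ?case by (simp add: algebra_simps)
qed

end

section \<open>The initial state\<close>

lemma contains_12453: "contains_pattern [1, 2, 4, 5, 3] w \<longleftrightarrow> \<not> avoids_12453 w"
proof
  assume "contains_pattern [1, 2, 4, 5, 3] w"
  then obtain us where us: "subseq us w" "length us = 5"
    "\<forall>i<5. \<forall>j<5. us ! i < us ! j \<longleftrightarrow> [1, 2, 4, 5, 3] ! i < ([1, 2, 4, 5, 3] ! j :: nat)"
    unfolding contains_pattern_def by auto
  then obtain a b d e c where l: "us = [a, b, d, e, c]"
    by (auto simp: length_Suc_conv eval_nat_numeral)
  have "a < b" "b < c" "c < d" "d < e"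
    using us(3)[rule_format, of 0 1] us(3)[rule_format, of 1 4] us(3)[rule_format, of 4 2] us(3)[rule_format, of 2 3]
    by (simp_all add: l)
  thus "\<not> avoids_12453 w" using us(1) unfolding l avoids_12453_def by blast
next
  assume "\<not> avoids_12453 w"
  then obtain a b c d e where o: "a < b" "b < c" "c < d" "d < e" and s: "subseq [a, b, d, e, c] w"
    unfolding avoids_12453_def by blast
  have "[a, b, d, e, c] ! i < [a, b, d, e, c] ! j \<longleftrightarrow> [1, 2, 4, 5, 3] ! i < ([1, 2, 4, 5, 3] ! j :: nat)"
    if "i < 5" "j < 5" for i j
  proof -
    have i: "i = 0 \<or> i = 1 \<or> i = 2 \<or> i = 3 \<or> i = 4" and j: "j = 0 \<or> j = 1 \<or> j = 2 \<or> j = 3 \<or> j = 4"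
      using that by linarith+
    have "a < c" "a < d" "a < e" "b < d" "b < e" "c < e" using o by linarith+
    with o show ?thesis using i
      by (elim disjE) (use j in \<open>elim disjE; hypsubst; simp\<close>)+
  qed
  note o' = this
  have l: "length [1, 2, 4, 5, 3 :: nat] = 5" by simp
  show "contains_pattern [1, 2, 4, 5, 3] w" unfolding contains_pattern_def l
  proof (rule exI, intro conjI allI impI)
    show "subseq [a, b, d, e, c] w" by (rule s)
    show "length [a, b, d, e, c] = 5" by simp
  qed (rule o')
qed

text \<open>With everything in band 0, the conditions on band 1 and on the blocks are
  vacuous.\<close>

lemma initial_completions: "completions A (initial_state n) = {w \<in> Av n [1, 2, 4, 5, 3]. Some w \<in> A}"
  unfolding completions_def Av_def contains_12453 permutations_of_set_def
  by (auto simp: initial_state_def completion_def completes_def exposures_Nil avoids_1342_def avoids_231_def blocks_ordered_def)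

lemma initial_good: "good_state (initial_state n)" "unread (initial_state n) = n" "0 < weight_of (initial_state n)"
  using exact_Free_pos[of n 0]
  by (simp_all add: initial_state_def good_state_def separated_def unread_def weight_of_def)

lemma prob_spmf_of_set:
  assumes "finite B" "B \<noteq> {}"
  shows "measure_pmf.prob (spmf_of_set B) A = real (card {w \<in> B. Some w \<in> A}) / real (card B)"
proof -
  have "measure_pmf.prob (spmf_of_set B) A = measure_pmf.prob (pmf_of_set B) (Some -` A)"
    using assms by (simp add: spmf_of_set_def spmf_of_pmf_def del: spmf_of_pmf_pmf_of_set)
  also have "\<dots> = real (card (B \<inter> Some -` A)) / real (card B)" by (rule measure_pmf_of_set[OF assms(2,1)])
  also have "B \<inter> Some -` A = {w \<in> B. Some w \<in> A}" by auto
  finally show ?thesis .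
qed

text \<open>Per letter, the table error contributes about \<open>1.117e-7\<close> and the scan about
  \<open>2.6e-9\<close>; 300 letters give about \<open>3.43e-5\<close>.\<close>

lemma step_error_bound: "300 * step_error < 3.5 / 10 ^ 5"
  unfolding step_error_def gamma_err_def by (simp add: \<nu>_def unit_roundoff_def)

lemma step_error_nonneg: "0 \<le> step_error"
  unfolding step_error_def gamma_err_def by (simp add: \<nu>_def unit_roundoff_def)

theorem propositionA2:
  fixes n :: nat and R :: rtable and G :: gtable and sc :: scan
  defines "\<gamma> \<equiv> gamma_err (\<nu> * table_size)"
  defines "\<epsilon> \<equiv> real n * (\<gamma> / (1 - \<gamma>) + 7 * real \<nu> * unit_roundoff)"
  assumes "n \<le> table_size"
    and "stored_tables table_size R G"
    and "tables_in_safe_range table_size R G"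
    and "valid_scan R G sc"
  shows "tv_dist (sampler R G sc n) (spmf_of_set (Av n [1, 2, 4, 5, 3])) \<le> \<epsilon> \<and> \<epsilon> < 3.5 / 10 ^ 5"
proof
  have \<epsilon>: "\<epsilon> = real n * step_error" by (simp add: \<epsilon>_def \<gamma>_def step_error_def table_size_def)
  have n: "n \<le> 300" using assms(3) by (simp add: table_size_def)
  interpret sampler_300 R G sc
    by unfold_locales (use assms in \<open>simp_all add: table_size_def\<close>)
  have av: "completions UNIV (initial_state n) = Av n [1, 2, 4, 5, 3]" by (simp add: initial_completions)
  have "finite (Av n [1, 2, 4, 5, 3])" "Av n [1, 2, 4, 5, 3] \<noteq> {}"
    using finite_completions[OF initial_good(1), of UNIV n] card_completions[OF initial_good(1,2), of n] initial_good(3)[of n]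
    by (auto simp: av)
  from prob_spmf_of_set[OF this] run_sampler_ge[OF initial_good(1,2) n initial_good(3)]
  show "tv_dist (sampler R G sc n) (spmf_of_set (Av n [1, 2, 4, 5, 3])) \<le> \<epsilon>"
    by (intro tv_dist_le) (simp add: \<epsilon> initial_completions sampler_def av)
  have "\<epsilon> \<le> 300 * step_error" unfolding \<epsilon> using n step_error_nonneg by (intro mult_right_mono) auto
  thus "\<epsilon> < 3.5 / 10 ^ 5" using step_error_bound by linarith
qed

end
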